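(* Let $\mathbf S=(S_1,S_2,S_3,\tilde S_1,\tilde S_2)$ be a $\Gamma_{E(3;2;1,2)}$-contraction on a Hilbert space $\mathcal H$ and let $G_1,2G_2,2\tilde G_1,\tilde G_2$ be the fundamental operators of $\mathbf S$. Then each of the following conditions is necessary for $\mathbf S$ to have a $\Gamma_{E(3;2;1,2)}$-isometric dilation (that is, if $\mathbf S$ has a $\Gamma_{E(3;2;1,2)}$-isometric dilation, then all of the following hold): (1) The tuple $(G_1,2G_2,2\tilde G_1,\tilde G_2)$ has a joint dilation to a $4$-tuple of commuting subnormal operators $(H_1,2H_2,2\tilde H_1,\tilde H_2)$, that is, there exist an isometric embedding $\Lambda_0$ of $\mathcal D_{S_3}$ into a larger Hilbert space $\mathcal F$ and such operators on $\mathcal F$ with $G_1=\Lambda_0^*H_1\Lambda_0$, $G_2=\Lambda_0^*H_2\Lambda_0$, $\tilde G_1=\Lambda_0^*\tilde H_1\Lambda_0$, $\tilde G_2=\Lambda_0^*\tilde H_2\Lambda_0$, where $(H_1,2H_2,2\tilde H_1,\tilde H_2)$ can be extended to a $4$-tuple of commuting normal operators $(M_1,2M_2,2\tilde M_1,\tilde M_2)$ (on a Hilbert space containing $\mathcal F$) whose Taylor joint spectrum is contained in $\{(z_1,2z_2,2\tilde z_1,\tilde z_2): |z_1|=|\tilde z_2|\le1,\ |z_2|=|\tilde z_1|\le1\}$. (2) $(\tilde G_2^*D_{S_3}\tilde S_2-G_1^*D_{S_3}S_1)|_{\operatorname{Ker}D_{S_3}}=0$. (2') $(\tilde G_2^*G_1^*-G_1^*\tilde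 G_2^* )D_{S_3}S_3|_{\operatorname{Ker}D_{S_3}}=0$. (3) $(G_2^*D_{S_3}S_2-\tilde G_1^*D_{S_3}\tilde S_1)|_{\operatorname{Ker}D_{S_3}}=0$. (3') $(G_2^*\tilde G_1^*-\tilde G_1^*G_2^* )D_{S_3}S_3|_{\operatorname{Ker}D_{S_3}}=0$. (4) $(\tilde G_2^*D_{S_3}S_2-2\tilde G_1^*D_{S_3}S_1)|_{\operatorname{Ker}D_{S_3}}=0$. (4') $(\tilde G_2^*\tilde G_1^*-\tilde G_1^*\tilde G_2^* )D_{S_3}S_3|_{\operatorname{Ker}D_{S_3}}=0$. (5) $(2G_2^*D_{S_3}\tilde S_2-G_1^*D_{S_3}\tilde S_1)|_{\operatorname{Ker}D_{S_3}}=0$. (5') $(G_2^*G_1^*-G_1^*G_2^* )D_{S_3}S_3|_{\operatorname{Ker}D_{S_3}}=0$. (6) $(\tilde G_2^*D_{S_3}\tilde S_1-2G_2^*D_{S_3}S_1)|_{\operatorname{Ker}D_{S_3}}=0$. (6') $(\tilde G_2^*G_2^*-G_2^*\tilde G_2^* )D_{S_3}S_3|_{\operatorname{Ker}D_{S_3}}=0$. (7) $(2\tilde G_1^*D_{S_3}\tilde S_2-G_1^*D_{S_3}S_2)|_{\operatorname{Ker}D_{S_3}}=0$. (7') $(\tilde G_1^*G_1^*-G_1^*\tilde G_1^* )D_{S_3}S_3|_{\operatorname{Ker}D_{S_3}}=0$.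
   Context: All Hilbert spaces are complex. A compact set $\Omega\subset\mathbb C^m$ is a spectral set for a commuting $m$-tuple $\mathbf T$ of bounded operators if the joint spectrum satisfies $\sigma(\mathbf T)\subseteq\Omega$ and $\|f(\mathbf T)\|\le\sup_{\Omega}|f|$ for every $f$ holomorphic in a neighbourhood of $\Omega$. For a linear subspace $E\subset\mathcal M_{n\times n}(\mathbb C)$, $\mu_E(A)=1/\inf\{\|X\|: X\in E,\ \det(1-AX)=0\}$, with $\mu_E(A)=0$ if $1-AX$ is nonsingular for all $X\in E$ ($\|\cdot\|$ is the operator norm). Let $E(3;2;1,2)=\{\operatorname{diag}(z_1,z_2,z_2): z_1,z_2\in\mathbb C\}$. Then $\Gamma_{E(3;2;1,2)}\subset\mathbb C^5$ is the set of points $(x_1,x_2,x_3,y_1,y_2)$ with $x_1=a_{11}$, $x_2=\det\begin{pmatrix} a_{11} & a_{12} \\ a_{21} & a_{22} \end{pmatrix}+\det\begin{pmatrix} a_{11} & a_{13} \\ a_{31} & a_{33} \end{pmatrix}$, $x_3=\det A$, $y_1=a_{22}+a_{33}$, $y_2=\det\begin{pmatrix} a_{22} & a_{23} \\ a_{32} & a_{33} \end{pmatrix}$, where $A=(a_{ij})\in\mathcal M_{3\times3}(\mathbb C)$ and $\mu_{E(3;2;1,2)}(A)\le1$. Let $$K_1=\{(x_1,x_2,x_3,y_1,y_2)\in\Gamma_{E(3;2;1,2)}: x_1=\bar y_2x_3,\ x_2=\bar y_1x_3,\ |x_3|=1\}.$$ A $\Gamma_{E(3;2;1,2)}$-contraction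 is a commuting $5$-tuple $(S_1,S_2,S_3,\tilde S_1,\tilde S_2)$ of bounded operators on a Hilbert space having $\Gamma_{E(3;2;1,2)}$ as a spectral set. A $\Gamma_{E(3;2;1,2)}$-unitary is a commuting $5$-tuple of normal operators with Taylor joint spectrum contained in $K_1$. A $\Gamma_{E(3;2;1,2)}$-isometry is the restriction of a $\Gamma_{E(3;2;1,2)}$-unitary to a joint invariant subspace. A $\Gamma_{E(3;2;1,2)}$-isometric dilation of a $\Gamma_{E(3;2;1,2)}$-contraction $(S_1,S_2,S_3,\tilde S_1,\tilde S_2)$ on $\mathcal H$ is a $\Gamma_{E(3;2;1,2)}$-isometry $(W_1,W_2,W_3,\tilde W_1,\tilde W_2)$ on a Hilbert space $\mathcal K\supseteq\mathcal H$ with $W_i^*|_{\mathcal H}=S_i^*$ for $1\le i\le3$ and $\tilde W_j^*|_{\mathcal H}=\tilde S_j^*$ for $1\le j\le2$. For a contraction $T$, $D_T=(I-T^*T)^{1/2}$ and $\mathcal D_T=\overline{\operatorname{Ran}}\,D_T$. For a $\Gamma_{E(3;2;1,2)}$-contraction $\mathbf S$, the operators $G_1,G_2,\tilde G_1,\tilde G_2\in\mathcal B(\mathcal D_{S_3})$ are the (known to exist and be unique) solutions of $$S_1-\tilde S_2^*S_3=D_{S_3}G_1D_{S_3},\quad \tilde S_2-S_1^*S_3=D_{S_3}\tilde G_2D_{S_3},$$ $$\tfrac{S_2}{2}-\tfrac{\tilde S_1^*}{2}S_3=D_{S_3}G_2D_{S_3},\quad \tfrac{\tilde S_1}{2}-\tfrac{S_2^*}{2}S_3=D_{S_3}\tilde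 G_1D_{S_3},$$ and $G_1,2G_2,2\tilde G_1,\tilde G_2$ are called the fundamental operators of $\mathbf S$. *)

theory Defs
  imports "HOL-Analysis.Analysis"
begin

section \<open>Complex Hilbert spaces\<close>

text \<open>The inner product is linear in the first argument; its real part is the inner product
  of the underlying real Hilbert space, which also provides norm and topology.\<close>

class complex_hilbert = real_inner + complete_space +
  fixes scaleC :: "complex \<Rightarrow> 'a \<Rightarrow> 'a"  (infixr \<open>*\<^sub>C\<close> 75)
    and cinner :: "'a \<Rightarrow> 'a \<Rightarrow> complex"
  assumes scaleC_add_right: "a *\<^sub>C (x + y) = a *\<^sub>C x + a *\<^sub>C y"
    and scaleC_add_left: "(a + b) *\<^sub>C x = a *\<^sub>C x + b *\<^sub>C x"
    and scaleC_scaleC: "a *\<^sub>C (b *\<^sub>C x) = (a * b) *\<^sub>C x"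
    and scaleC_of_real: "complex_of_real r *\<^sub>C x = r *\<^sub>R x"
    and cinner_commute: "cinner y x = cnj (cinner x y)"
    and cinner_add_left: "cinner (x + y) z = cinner x z + cinner y z"
    and cinner_scaleC_left: "cinner (a *\<^sub>C x) y = a * cinner x y"
    and Re_cinner: "Re (cinner x y) = inner x y"

instantiation complex :: complex_hilbert
begin
definition scaleC_complex :: "complex \<Rightarrow> complex \<Rightarrow> complex"
  where "scaleC_complex a x = a * x"
definition cinner_complex :: "complex \<Rightarrow> complex \<Rightarrow> complex"
  where "cinner_complex x y = x * cnj y"
instance
  by standard
    (auto simp: scaleC_complex_def cinner_complex_def inner_complex_def scaleR_conv_of_real
      algebra_simps)
end

text \<open>A Hilbert space is either a whole type of class \<open>complex_hilbert\<close> or a closed subspace of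
  one. An operator on a closed subspace is a function on the ambient type of which only the
  values on the subspace matter.\<close>

definition closed_csubspace :: "'a::complex_hilbert set \<Rightarrow> bool" where
  "closed_csubspace X \<longleftrightarrow> closed X \<and> 0 \<in> X \<and> (\<forall>x\<in>X. \<forall>y\<in>X. x + y \<in> X) \<and>
     (\<forall>c. \<forall>x\<in>X. c *\<^sub>C x \<in> X)"

definition bounded_clinear_on ::
    "'a::complex_hilbert set \<Rightarrow> 'b::complex_hilbert set \<Rightarrow> ('a \<Rightarrow> 'b) \<Rightarrow> bool" where
  "bounded_clinear_on X Y T \<longleftrightarrow> (\<forall>x\<in>X. T x \<in> Y) \<and>
     (\<forall>x\<in>X. \<forall>y\<in>X. T (x + y) = T x + T y) \<and> (\<forall>c. \<forall>x\<in>X. T (c *\<^sub>C x) = c *\<^sub>C T x) \<and>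
     (\<exists>B. \<forall>x\<in>X. norm (T x) \<le> B * norm x)"

abbreviation bounded_clinear :: "('a::complex_hilbert \<Rightarrow> 'b::complex_hilbert) \<Rightarrow> bool" where
  "bounded_clinear \<equiv> bounded_clinear_on UNIV UNIV"

definition isometric_on ::
    "'a::complex_hilbert set \<Rightarrow> 'b::complex_hilbert set \<Rightarrow> ('a \<Rightarrow> 'b) \<Rightarrow> bool" where
  "isometric_on X Y V \<longleftrightarrow> bounded_clinear_on X Y V \<and> (\<forall>x\<in>X. norm (V x) = norm x)"

text \<open>The adjoint of an operator with domain the Hilbert space \<open>X\<close>.\<close>

definition adj_on ::
    "'a::complex_hilbert set \<Rightarrow> ('a \<Rightarrow> 'b::complex_hilbert) \<Rightarrow> 'b \<Rightarrow> 'a" where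
  "adj_on X T y = (THE x. x \<in> X \<and> (\<forall>u\<in>X. cinner (T u) y = cinner u x))"

abbreviation adj :: "('a::complex_hilbert \<Rightarrow> 'b::complex_hilbert) \<Rightarrow> 'b \<Rightarrow> 'a" where
  "adj \<equiv> adj_on UNIV"

definition normal_op :: "('a::complex_hilbert \<Rightarrow> 'a) \<Rightarrow> bool" where
  "normal_op T \<longleftrightarrow> bounded_clinear T \<and> T \<circ> adj T = adj T \<circ> T"

definition positive_op :: "('a::complex_hilbert \<Rightarrow> 'a) \<Rightarrow> bool" where
  "positive_op T \<longleftrightarrow> bounded_clinear T \<and> (\<forall>x. cinner (T x) x \<in> \<real> \<and> 0 \<le> Re (cinner (T x) x))"

definition sqrt_op :: "('a::complex_hilbert \<Rightarrow> 'a) \<Rightarrow> 'a \<Rightarrow> 'a" where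
  "sqrt_op P = (THE R. positive_op R \<and> R \<circ> R = P)"

definition defect_op :: "('a::complex_hilbert \<Rightarrow> 'a) \<Rightarrow> 'a \<Rightarrow> 'a" where
  "defect_op T = sqrt_op (\<lambda>x. x - adj T (T x))"

definition defect_space :: "('a::complex_hilbert \<Rightarrow> 'a) \<Rightarrow> 'a set" where
  "defect_space T = closure (range (defect_op T))"

definition commuting_on :: "'a set \<Rightarrow> ('i \<Rightarrow> 'a \<Rightarrow> 'a) \<Rightarrow> bool" where
  "commuting_on X T \<longleftrightarrow> (\<forall>i j. \<forall>x\<in>X. T i (T j x) = T j (T i x))"


section \<open>The Taylor joint spectrum\<close>

text \<open>A \<open>p\<close>-form \<open>w\<close> on the index set \<open>I\<close> with coefficients in the Hilbert space is given by its
  coefficient \<open>w J\<close> at \<open>e\<^bsub>j\<^sub>1\<^esub> \<and> \<dots> \<and> e\<^bsub>j\<^sub>p\<^esub>\<close> for each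
  \<open>J = {j\<^sub>1 < \<dots> < j\<^sub>p} \<subseteq> I\<close>. The Koszul differential is
  \<open>x e\<^sub>J \<mapsto> \<Sum>j. A j x e\<^sub>j \<and> e\<^sub>J\<close>.\<close>

definition koszul_forms :: "'i set \<Rightarrow> nat \<Rightarrow> ('i set \<Rightarrow> 'a::zero) set" where
  "koszul_forms I p = {w. \<forall>J. w J \<noteq> 0 \<longrightarrow> J \<subseteq> I \<and> card J = p}"

definition koszul_diff ::
    "'i::linorder set \<Rightarrow> ('i \<Rightarrow> 'a \<Rightarrow> 'a) \<Rightarrow> ('i set \<Rightarrow> 'a) \<Rightarrow> 'i set \<Rightarrow> 'a::real_vector" where
  "koszul_diff I A w J =
     (if J \<subseteq> I then \<Sum>j\<in>J. (-1) ^ card {i\<in>J. i < j} *\<^sub>R A j (w (J - {j})) else 0)"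

definition koszul_exact :: "'i::linorder set \<Rightarrow> ('i \<Rightarrow> 'a \<Rightarrow> 'a::real_vector) \<Rightarrow> bool" where
  "koszul_exact I A \<longleftrightarrow>
     {w \<in> koszul_forms I 0. koszul_diff I A w = (\<lambda>_. 0)} = {\<lambda>_. 0} \<and>
     (\<forall>p. {w \<in> koszul_forms I (Suc p). koszul_diff I A w = (\<lambda>_. 0)} =
          koszul_diff I A ` koszul_forms I p)"

definition taylor_singular ::
    "'i::linorder set \<Rightarrow> ('i \<Rightarrow> 'a \<Rightarrow> 'a::complex_hilbert) \<Rightarrow> ('i \<Rightarrow> complex) \<Rightarrow> bool" where
  "taylor_singular I T z \<longleftrightarrow> \<not> koszul_exact I (\<lambda>i x. T i x - z i *\<^sub>C x)"

definition taylor_spectrum ::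
    "('i \<Rightarrow> 'a \<Rightarrow> 'a::complex_hilbert) \<Rightarrow> (complex^'i::{finite,linorder}) set" where
  "taylor_spectrum T = {z. taylor_singular UNIV T (\<lambda>i. z $ i)}"


section \<open>Holomorphic functional calculus and spectral sets\<close>

definition holomorphic_in :: "(complex^'i) set \<Rightarrow> (complex^'i \<Rightarrow> complex) \<Rightarrow> bool" where
  "holomorphic_in U f \<longleftrightarrow>
     (\<forall>z\<in>U. \<exists>D. (f has_derivative D) (at z) \<and> (\<forall>c v. D (c *s v) = c * D v))"

definition holomorphic_near :: "(complex^'i) set \<Rightarrow> (complex^'i \<Rightarrow> complex) \<Rightarrow> bool" where
  "holomorphic_near \<Omega> f \<longleftrightarrow> (\<exists>U. open U \<and> \<Omega> \<subseteq> U \<and> holomorphic_in U f)"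

text \<open>\<open>\<Phi> f\<close> is \<open>f(T)\<close> for \<open>f\<close> holomorphic near the compact set \<open>\<Omega> \<supseteq> \<sigma>(T)\<close>. By theorems of
  Taylor (existence) and Putinar (uniqueness), the functional calculus is the only map that
  depends on the germ of \<open>f\<close> along \<open>\<Omega>\<close>, is a unital algebra homomorphism sending the coordinate
  functions to the operators, is continuous (for locally uniform convergence on each open
  neighbourhood of \<open>\<Omega>\<close>), and has the spectral mapping property for finite tuples
  \<open>F 0, \<dots>, F (n - 1)\<close>.\<close>

definition holomorphic_calculus ::
    "(complex^'i::{finite,linorder}) set \<Rightarrow> ('i \<Rightarrow> 'a \<Rightarrow> 'a::complex_hilbert) \<Rightarrow>
     ((complex^'i::{finite,linorder} \<Rightarrow> complex) \<Rightarrow> 'a \<Rightarrow> 'a) \<Rightarrow> bool" where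
  "holomorphic_calculus \<Omega> T \<Phi> \<longleftrightarrow>
     (\<forall>f. holomorphic_near \<Omega> f \<longrightarrow> bounded_clinear (\<Phi> f)) \<and>
     (\<forall>f g U. holomorphic_near \<Omega> f \<and> holomorphic_near \<Omega> g \<and>
        open U \<and> \<Omega> \<subseteq> U \<and> (\<forall>z\<in>U. f z = g z) \<longrightarrow> \<Phi> f = \<Phi> g) \<and>
     \<Phi> (\<lambda>_. 1) = id \<and>
     (\<forall>i. \<Phi> (\<lambda>z. z $ i) = T i) \<and>
     (\<forall>f g. holomorphic_near \<Omega> f \<and> holomorphic_near \<Omega> g \<longrightarrow>
        \<Phi> (\<lambda>z. f z + g z) = (\<lambda>x. \<Phi> f x + \<Phi> g x) \<and> \<Phi> (\<lambda>z. f z * g z) = \<Phi> f \<circ> \<Phi> g) \<and>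
     (\<forall>c f. holomorphic_near \<Omega> f \<longrightarrow> \<Phi> (\<lambda>z. c * f z) = (\<lambda>x. c *\<^sub>C \<Phi> f x)) \<and>
     (\<forall>U F g. open U \<and> \<Omega> \<subseteq> U \<and> (\<forall>n. holomorphic_in U (F n)) \<and> holomorphic_in U g \<and>
        (\<forall>C. compact C \<and> C \<subseteq> U \<longrightarrow> uniform_limit C F g sequentially) \<longrightarrow>
        (\<lambda>n. onorm (\<lambda>x. \<Phi> (F n) x - \<Phi> g x)) \<longlonglongrightarrow> 0) \<and>
     (\<forall>(n::nat) F w. (\<forall>i<n. holomorphic_near \<Omega> (F i)) \<longrightarrow>
        (taylor_singular {..<n} (\<lambda>i. \<Phi> (F i)) w \<longleftrightarrow>
         (\<exists>z\<in>taylor_spectrum T. \<forall>i<n. w i = F i z)))"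

definition spectral_set ::
    "(complex^'i::{finite,linorder}) set \<Rightarrow> ('i \<Rightarrow> 'a \<Rightarrow> 'a::complex_hilbert) \<Rightarrow> bool" where
  "spectral_set \<Omega> T \<longleftrightarrow> compact \<Omega> \<and> taylor_spectrum T \<subseteq> \<Omega> \<and>
     (\<exists>\<Phi>. holomorphic_calculus \<Omega> T \<Phi> \<and>
        (\<forall>f. holomorphic_near \<Omega> f \<longrightarrow> onorm (\<Phi> f) \<le> (SUP z\<in>\<Omega>. cmod (f z))))"


section \<open>The domain \<open>\<Gamma>\<^bsub>E(3;2;1,2)\<^esub>\<close>\<close>

text \<open>The matrix norm is the operator norm for the Euclidean norm on \<open>\<complex>\<^sup>n\<close>.\<close>

definition mu :: "(complex^'n^'n) set \<Rightarrow> complex^'n^'n \<Rightarrow> real" where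
  "mu E A = (if \<forall>X\<in>E. det (mat 1 - A ** X) \<noteq> 0 then 0
     else 1 / Inf {onorm ((*v) X) | X. X \<in> E \<and> det (mat 1 - A ** X) = 0})"

definition E_3_2_12 :: "(complex^3^3) set" where
  "E_3_2_12 = {(\<chi> i j. if i = j then (if i = 1 then z1 else z2) else 0) | z1 z2. True}"

text \<open>In the index types \<open>5\<close>, \<open>4\<close> and \<open>3\<close> the numerals \<open>1, \<dots>, n\<close> are the \<open>n\<close> distinct
  elements (with \<open>n = 0\<close>), so the last branches below are those of index \<open>5\<close> and \<open>4\<close>.\<close>

definition tuple5 :: "'a \<Rightarrow> 'a \<Rightarrow> 'a \<Rightarrow> 'a \<Rightarrow> 'a \<Rightarrow> 5 \<Rightarrow> 'a" where
  "tuple5 a b c d e = (\<lambda>i. if i = 1 then a else if i = 2 then b else if i = 3 then c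
     else if i = 4 then d else e)"

definition tuple4 :: "'a \<Rightarrow> 'a \<Rightarrow> 'a \<Rightarrow> 'a \<Rightarrow> 4 \<Rightarrow> 'a" where
  "tuple4 a b c d = (\<lambda>i. if i = 1 then a else if i = 2 then b else if i = 3 then c else d)"

definition Gamma_E :: "(complex^5) set" where
  "Gamma_E = {vec_lambda (tuple5
        (A$1$1)
        (det (vector [vector [A$1$1, A$1$2], vector [A$2$1, A$2$2]] :: complex^2^2)
         + det (vector [vector [A$1$1, A$1$3], vector [A$3$1, A$3$3]] :: complex^2^2))
        (det A)
        (A$2$2 + A$3$3)
        (det (vector [vector [A$2$2, A$2$3], vector [A$3$2, A$3$3]] :: complex^2^2)))
      | A :: complex^3^3. mu E_3_2_12 A \<le> 1}"

definition K1 :: "(complex^5) set" where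
  "K1 = {vec_lambda (tuple5 x1 x2 x3 y1 y2) | x1 x2 x3 y1 y2.
     vec_lambda (tuple5 x1 x2 x3 y1 y2) \<in> Gamma_E \<and>
     x1 = cnj y2 * x3 \<and> x2 = cnj y1 * x3 \<and> cmod x3 = 1}"


section \<open>Operator tuples associated with \<open>\<Gamma>\<^bsub>E(3;2;1,2)\<^esub>\<close>\<close>

definition Gamma_contraction :: "(5 \<Rightarrow> 'a \<Rightarrow> 'a::complex_hilbert) \<Rightarrow> bool" where
  "Gamma_contraction S \<longleftrightarrow>
     (\<forall>i. bounded_clinear (S i)) \<and> commuting_on UNIV S \<and> spectral_set Gamma_E S"

definition Gamma_unitary :: "(5 \<Rightarrow> 'a \<Rightarrow> 'a::complex_hilbert) \<Rightarrow> bool" where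
  "Gamma_unitary N \<longleftrightarrow>
     (\<forall>i. normal_op (N i)) \<and> commuting_on UNIV N \<and> taylor_spectrum N \<subseteq> K1"

definition Gamma_isometry :: "'a::complex_hilbert set \<Rightarrow> (5 \<Rightarrow> 'a \<Rightarrow> 'a) \<Rightarrow> bool" where
  "Gamma_isometry K W \<longleftrightarrow> closed_csubspace K \<and>
     (\<exists>N. Gamma_unitary N \<and> (\<forall>i. \<forall>x\<in>K. N i x \<in> K \<and> W i x = N i x))"

text \<open>The dilation space \<open>K\<close> contains the original space via an isometric embedding \<open>J\<close>. The type
  argument fixes the Hilbert space in which \<open>K\<close> lives and on which the \<open>\<Gamma>\<close>-unitary extension
  acts; it is a free type variable wherever the notion is used as a hypothesis.\<close>

definition has_Gamma_isometric_dilation ::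
    "'k::complex_hilbert itself \<Rightarrow> (5 \<Rightarrow> 'a \<Rightarrow> 'a::complex_hilbert) \<Rightarrow> bool" where
  "has_Gamma_isometric_dilation (_ :: 'k itself) S \<longleftrightarrow>
     (\<exists>(K :: 'k set) W J. Gamma_isometry K W \<and> isometric_on UNIV K J \<and>
        (\<forall>i h. adj_on K (W i) (J h) = J (adj (S i) h)))"

text \<open>\<open>G1, 2 G2, 2 Gt1, Gt2\<close> are the fundamental operators of \<open>(S1, S2, S3, St1, St2)\<close>.\<close>

definition fundamental_ops ::
    "('a::complex_hilbert \<Rightarrow> 'a) \<Rightarrow> ('a \<Rightarrow> 'a) \<Rightarrow> ('a \<Rightarrow> 'a) \<Rightarrow> ('a \<Rightarrow> 'a) \<Rightarrow> ('a \<Rightarrow> 'a) \<Rightarrow>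
     ('a \<Rightarrow> 'a) \<Rightarrow> ('a \<Rightarrow> 'a) \<Rightarrow> ('a \<Rightarrow> 'a) \<Rightarrow> ('a \<Rightarrow> 'a) \<Rightarrow> bool" where
  "fundamental_ops S1 S2 S3 St1 St2 G1 G2 Gt1 Gt2 \<longleftrightarrow>
     (let D = defect_op S3; X = defect_space S3 in
        bounded_clinear_on X X G1 \<and> bounded_clinear_on X X G2 \<and>
        bounded_clinear_on X X Gt1 \<and> bounded_clinear_on X X Gt2 \<and>
        (\<forall>h. S1 h - adj St2 (S3 h) = D (G1 (D h))) \<and>
        (\<forall>h. St2 h - adj S1 (S3 h) = D (Gt2 (D h))) \<and>
        (\<forall>h. (1/2) *\<^sub>R S2 h - (1/2) *\<^sub>R adj St1 (S3 h) = D (G2 (D h))) \<and>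
        (\<forall>h. (1/2) *\<^sub>R St1 h - (1/2) *\<^sub>R adj S2 (S3 h) = D (Gt1 (D h))))"

text \<open>Joint dilation of \<open>(G1, 2 G2, 2 Gt1, Gt2)\<close>, operators on \<open>X\<close>, to commuting operators
  \<open>(H1, 2 H2, 2 Ht1, Ht2)\<close> on \<open>F\<close> extending to commuting normal operators
  \<open>(M1, 2 M2, 2 Mt1, Mt2)\<close> on the Hilbert space \<open>'k \<supseteq> F\<close>.\<close>

definition has_subnormal_joint_dilation ::
    "'k::complex_hilbert itself \<Rightarrow> 'a::complex_hilbert set \<Rightarrow>
     ('a \<Rightarrow> 'a) \<Rightarrow> ('a \<Rightarrow> 'a) \<Rightarrow> ('a \<Rightarrow> 'a) \<Rightarrow> ('a \<Rightarrow> 'a) \<Rightarrow> bool" where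
  "has_subnormal_joint_dilation (_ :: 'k itself) X G1 G2 Gt1 Gt2 \<longleftrightarrow>
     (\<exists>(F :: 'k set) L H1 H2 Ht1 Ht2 M1 M2 Mt1 Mt2.
        closed_csubspace F \<and> isometric_on X F L \<and>
        bounded_clinear_on F F H1 \<and> bounded_clinear_on F F H2 \<and>
        bounded_clinear_on F F Ht1 \<and> bounded_clinear_on F F Ht2 \<and>
        commuting_on F (tuple4 H1 (\<lambda>x. 2 *\<^sub>R H2 x) (\<lambda>x. 2 *\<^sub>R Ht1 x) Ht2) \<and>
        (\<forall>x\<in>X. G1 x = adj_on X L (H1 (L x)) \<and> G2 x = adj_on X L (H2 (L x)) \<and>
               Gt1 x = adj_on X L (Ht1 (L x)) \<and> Gt2 x = adj_on X L (Ht2 (L x))) \<and>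
        (\<forall>x\<in>F. M1 x = H1 x \<and> M2 x = H2 x \<and> Mt1 x = Ht1 x \<and> Mt2 x = Ht2 x) \<and>
        (let M = tuple4 M1 (\<lambda>x. 2 *\<^sub>R M2 x) (\<lambda>x. 2 *\<^sub>R Mt1 x) Mt2 in
           (\<forall>i. normal_op (M i)) \<and> commuting_on UNIV M \<and>
           taylor_spectrum M \<subseteq> {vec_lambda (tuple4 z1 (2 * z2) (2 * zt1) zt2) | z1 z2 zt1 zt2.
             cmod z1 = cmod zt2 \<and> cmod zt2 \<le> 1 \<and> cmod z2 = cmod zt1 \<and> cmod zt1 \<le> 1}))"

end

theory Submission
  imports Defs "HOL-Complex_Analysis.Cauchy_Integral_Formula"
begin

text \<open>Let \<open>J\<close> embed \<open>\<H>\<close> into \<open>\<K>\<close>, let \<open>N\<close> be the \<open>\<Gamma>\<close>-unitary that extends the dilation, and let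
  \<open>D\<close> be the defect operator of \<open>S\<^sub>3\<close>. Entries are numbered in the order \<open>x\<^sub>1, x\<^sub>2, x\<^sub>3, y\<^sub>1, y\<^sub>2\<close>. On \<open>K\<^sub>1\<close> we have \<open>x\<^sub>1 = cnj y\<^sub>2 x\<^sub>3\<close>, \<open>x\<^sub>2 = cnj y\<^sub>1 x\<^sub>3\<close> and
  \<open>\<bar>x\<^sub>3\<bar> = 1\<close>, so \<open>N\<^sub>3\<close> is unitary, \<open>N\<^sub>1 = N\<^sub>5\<^sup>* N\<^sub>3\<close> and \<open>N\<^sub>2 = N\<^sub>4\<^sup>* N\<^sub>3\<close>; both relations are symmetric
  in their two partners \<open>(1, 5)\<close> and \<open>(2, 4)\<close>, and also \<open>\<parallel>N\<^sub>5\<parallel> \<le> 1\<close> and \<open>\<parallel>N\<^sub>4\<parallel> \<le> 2\<close>.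

  The operator \<open>E = N\<^sub>3 J - J S\<^sub>3\<close> has range orthogonal to \<open>J \<H>\<close> and satisfies \<open>E\<^sup>* E = 1 - S\<^sub>3\<^sup>* S\<^sub>3 = D\<^sup>2\<close>.
  Hence \<open>E = U D\<close> with an isometry \<open>U\<close> of the defect space into \<open>\<K>\<close>. If \<open>i\<close> and \<open>j\<close> are partners,
  then \<open>D U\<^sup>* N\<^sub>i U D = E\<^sup>* N\<^sub>i E = S\<^sub>i - S\<^sub>j\<^sup>* S\<^sub>3\<close>, which identifies \<open>G\<^sub>1\<close>, \<open>2 G\<^sub>2\<close>, \<open>2 Gt\<^sub>1\<close>, \<open>Gt\<^sub>2\<close> with the
  compressions \<open>U\<^sup>* N\<^sub>i U\<close> for \<open>i = 1, 2, 4, 5\<close>. So \<open>(N\<^sub>1, N\<^sub>2, N\<^sub>4, N\<^sub>5)\<close> is the normal tuple wanted for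
  the joint dilation (\<open>compression_equation\<close>, \<open>Gamma_unitary_reduced_spectrum\<close>).

  For the other conditions, \<open>(U\<^sup>* N\<^sub>i U)\<^sup>* D = U\<^sup>* N\<^sub>j J\<close> (\<open>compression_adj\<close>), and \<open>D h = 0\<close> implies
  \<open>N\<^sub>k J h = J S\<^sub>k h\<close> for all \<open>k\<close> (\<open>kernel_dilation\<close>). Therefore \<open>(U\<^sup>* N\<^sub>i U)\<^sup>* D S\<^sub>k h = U\<^sup>* N\<^sub>j N\<^sub>k J h\<close>, and
  the conditions that contain two different operators \<open>S\<^sub>k\<close> express that the \<open>N\<^sub>i\<close> commute. Since \<open>U\<^sup>* N\<^sub>3 J = D\<close>, the case \<open>k = 3\<close> reads
  \<open>(U\<^sup>* N\<^sub>i U)\<^sup>* D S\<^sub>3 h = D S\<^sub>j h\<close>, which turns each condition about a commutator of adjoints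
  into one of the former.

  The analytic input is the passage between the Taylor spectrum of a commuting normal tuple and
  relations among its entries. A point \<open>z\<close> lies in that spectrum if and only if the family
  \<open>N\<^sub>i - z\<^sub>i\<close> is not bounded below (\<open>taylor_spectrum_bounded_below\<close>): exactness of the Koszul complex
  gives a lower bound by uniform boundedness, and a lower bound for a family \<open>A\<close> makes
  \<open>P = \<Sum>i. A\<^sub>i\<^sup>* A\<^sub>i\<close> invertible, so that the \<open>P\<^sup>-\<^sup>1 A\<^sub>i\<^sup>*\<close> contract the complex. Relations that
  hold at all points of the spectrum carry over to the operators because there are enough joint approximate eigenvectors (\<open>norm_le_by_taylor_spectrum\<close>). Both parts
  rest on Fuglede's theorem.\<close>

section \<open>Complex Hilbert spaces\<close>

lemma cinner_add_right: "cinner x (y + z) = cinner x y + cinner x (z::'a::complex_hilbert)"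
  by (metis cinner_add_left cinner_commute complex_cnj_add)

lemma cinner_scaleC_right: "cinner x (a *\<^sub>C y) = cnj a * cinner x (y::'a::complex_hilbert)"
  by (metis cinner_scaleC_left cinner_commute complex_cnj_mult)

lemma cinner_scaleR_left: "cinner (r *\<^sub>R x) y = of_real r * cinner x (y::'a::complex_hilbert)"
  by (metis scaleC_of_real cinner_scaleC_left)

lemma cinner_scaleR_right: "cinner x (r *\<^sub>R y) = of_real r * cinner x (y::'a::complex_hilbert)"
  by (metis scaleC_of_real cinner_scaleC_right complex_cnj_complex_of_real)

lemma cinner_zero_left [simp]: "cinner 0 (y::'a::complex_hilbert) = 0"
  using cinner_scaleR_left[of 0 0 y] by simp

lemma cinner_zero_right [simp]: "cinner (x::'a::complex_hilbert) 0 = 0"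
  using cinner_scaleR_right[of x 0 0] by simp

lemma cinner_minus_left: "cinner (- x) y = - cinner x (y::'a::complex_hilbert)"
  using cinner_scaleR_left[of "-1" x y] by simp

lemma cinner_minus_right: "cinner x (- y) = - cinner x (y::'a::complex_hilbert)"
  using cinner_scaleR_right[of x "-1" y] by simp

lemma cinner_diff_left: "cinner (x - y) z = cinner x z - cinner y (z::'a::complex_hilbert)"
  using cinner_add_left[of x "- y" z] by (simp add: cinner_minus_left)

lemma cinner_diff_right: "cinner x (y - z) = cinner x y - cinner x (z::'a::complex_hilbert)"
  using cinner_add_right[of x y "- z"] by (simp add: cinner_minus_right)

lemma cinner_sum_left: "cinner (\<Sum>i\<in>I. f i) z = (\<Sum>i\<in>I. cinner (f i) (z::'a::complex_hilbert))"
  by (induction I rule: infinite_finite_induct) (auto simp: cinner_add_left)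

lemma cinner_sum_right: "cinner z (\<Sum>i\<in>I. f i) = (\<Sum>i\<in>I. cinner z (f i :: 'a::complex_hilbert))"
  by (induction I rule: infinite_finite_induct) (auto simp: cinner_add_right)

lemmas cinner_simps = cinner_add_left cinner_add_right cinner_diff_left cinner_diff_right
  cinner_minus_left cinner_minus_right cinner_scaleC_left cinner_scaleC_right
  cinner_scaleR_left cinner_scaleR_right

lemma cinner_self: "cinner x x = of_real ((norm (x::'a::complex_hilbert))\<^sup>2)"
proof -
  have "Im (cinner x x) = 0"
    using cinner_commute[of x x] by (metis cnj.simps(2) equal_neg_zero)
  then show ?thesis
    by (simp add: complex_eq_iff Re_cinner power2_norm_eq_inner)
qed

lemma scaleC_one [simp]: "1 *\<^sub>C x = (x::'a::complex_hilbert)"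
  using scaleC_of_real[of 1 x] by simp

lemma scaleC_zero_left [simp]: "0 *\<^sub>C x = (0::'a::complex_hilbert)"
  using scaleC_of_real[of 0 x] by simp

lemma scaleC_zero_right [simp]: "a *\<^sub>C (0::'a::complex_hilbert) = 0"
  using scaleC_add_right[of a 0 "0::'a"] by simp

lemma scaleC_minus_right: "a *\<^sub>C (- x) = - (a *\<^sub>C (x::'a::complex_hilbert))"
  using scaleC_add_right[of a x "-x"] by (simp add: eq_neg_iff_add_eq_0 add.commute)

lemma scaleC_diff_right: "a *\<^sub>C (x - y) = a *\<^sub>C x - a *\<^sub>C (y::'a::complex_hilbert)"
  using scaleC_add_right[of a x "-y"] by (simp add: scaleC_minus_right)

lemma scaleC_minus_left: "(- a) *\<^sub>C x = - (a *\<^sub>C (x::'a::complex_hilbert))"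
  using scaleC_add_left[of a "-a" x] by (simp add: eq_neg_iff_add_eq_0 add.commute)

lemma scaleC_scaleR: "a *\<^sub>C (r *\<^sub>R x) = r *\<^sub>R (a *\<^sub>C (x::'a::complex_hilbert))"
  by (metis mult.commute scaleC_of_real scaleC_scaleC)

lemma norm_scaleC: "norm (a *\<^sub>C x) = cmod a * norm (x::'a::complex_hilbert)"
proof -
  have "complex_of_real ((norm (a *\<^sub>C x))\<^sup>2) = (a * cnj a) * of_real ((norm x)\<^sup>2)"
    by (simp only: cinner_self[symmetric] cinner_scaleC_left cinner_scaleC_right) simp
  also have "\<dots> = of_real ((cmod a * norm x)\<^sup>2)"
    by (simp add: power_mult_distrib flip: complex_norm_square)
  finally have "(norm (a *\<^sub>C x))\<^sup>2 = (cmod a * norm x)\<^sup>2"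
    using of_real_eq_iff by blast
  then show ?thesis
    by (simp add: power2_eq_iff_nonneg)
qed

lemma norm_cinner_le: "cmod (cinner x y) \<le> norm x * norm (y::'a::complex_hilbert)"
proof (cases "cinner x y = 0")
  case False
  define c where "c = cinner x y"
  have "cinner x (c *\<^sub>C y) = of_real ((cmod c)\<^sup>2)"
    by (simp add: cinner_scaleC_right c_def mult.commute flip: complex_norm_square)
  then have "(cmod c)\<^sup>2 = Re (cinner x (c *\<^sub>C y))"
    by simp
  also have "\<dots> \<le> norm x * norm (c *\<^sub>C y)"
    by (simp add: Re_cinner norm_cauchy_schwarz)
  finally have "cmod c * cmod c \<le> cmod c * (norm x * norm y)"
    by (simp add: norm_scaleC power2_eq_square mult_ac)
  then show ?thesis
    using False c_def by simp
qed simp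

lemma cinner_ext:
  assumes "\<And>u. cinner u x = cinner u (y::'a::complex_hilbert)"
  shows "x = y"
  using assms[of "x - y"] cinner_self[of "x - y"] by (simp add: cinner_diff_right)

lemma cinner_ext_left:
  assumes "\<And>u. cinner x u = cinner (y::'a::complex_hilbert) u"
  shows "x = y"
  by (rule cinner_ext) (metis assms cinner_commute)

lemma bounded_linear_scaleC: "bounded_linear (\<lambda>x::'a::complex_hilbert. a *\<^sub>C x)"
  by (rule bounded_linear_intro[where K = "cmod a"])
    (auto simp: scaleC_add_right scaleC_scaleR norm_scaleC mult.commute)

lemma bounded_linear_cinner_left: "bounded_linear (\<lambda>x. cinner x (y::'a::complex_hilbert))"
  by (rule bounded_linear_intro[where K = "norm y"])
    (auto simp: cinner_simps norm_cinner_le scaleR_conv_of_real)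

lemma bounded_linear_cinner_right: "bounded_linear (\<lambda>y. cinner (x::'a::complex_hilbert) y)"
  by (rule bounded_linear_intro[where K = "norm x"])
    (auto simp: cinner_simps norm_cinner_le scaleR_conv_of_real mult.commute[of "norm _" "norm x"])

lemma tendsto_scaleC: "(f \<longlongrightarrow> l) F \<Longrightarrow> ((\<lambda>x. a *\<^sub>C f x) \<longlongrightarrow> a *\<^sub>C (l::'a::complex_hilbert)) F"
  using bounded_linear.tendsto[OF bounded_linear_scaleC] .

lemma closed_csubspace_UNIV [simp]: "closed_csubspace UNIV"
  by (simp add: closed_csubspace_def)

context
  fixes X :: "'a::complex_hilbert set"
  assumes X: "closed_csubspace X"
begin

lemma csubspace_zero: "0 \<in> X"
  and csubspace_add: "x \<in> X \<Longrightarrow> y \<in> X \<Longrightarrow> x + y \<in> X"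
  and csubspace_scaleC: "x \<in> X \<Longrightarrow> c *\<^sub>C x \<in> X"
  and csubspace_closed: "closed X"
  using X by (auto simp: closed_csubspace_def)

lemma csubspace_scaleR: "x \<in> X \<Longrightarrow> r *\<^sub>R x \<in> X"
  by (metis csubspace_scaleC scaleC_of_real)

lemma csubspace_diff: "x \<in> X \<Longrightarrow> y \<in> X \<Longrightarrow> x - y \<in> X"
  using csubspace_add[of x "(-1) *\<^sub>R y"] csubspace_scaleR[of y "-1"] by simp

end


section \<open>Bounded operators\<close>

lemma bounded_clinear_onI:
  assumes "\<And>x. x \<in> X \<Longrightarrow> T x \<in> Y"
    and "\<And>x y. x \<in> X \<Longrightarrow> y \<in> X \<Longrightarrow> T (x + y) = T x + T y"
    and "\<And>c x. x \<in> X \<Longrightarrow> T (c *\<^sub>C x) = c *\<^sub>C T x"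
    and "\<And>x. x \<in> X \<Longrightarrow> norm (T x) \<le> B * norm x"
  shows "bounded_clinear_on X Y T"
  using assms unfolding bounded_clinear_on_def by blast

lemma bounded_clinear_on_bound:
  assumes "bounded_clinear_on X Y T"
  shows "\<exists>B>0. \<forall>x\<in>X. norm (T x) \<le> B * norm x"
proof -
  from assms obtain B where B: "\<And>x. x \<in> X \<Longrightarrow> norm (T x) \<le> B * norm x"
    unfolding bounded_clinear_on_def by blast
  have "norm (T x) \<le> (\<bar>B\<bar> + 1) * norm x" if "x \<in> X" for x
    using B[OF that] mult_right_mono[of B "\<bar>B\<bar> + 1" "norm x"] by fastforce
  then show ?thesis
    by (intro exI[of _ "\<bar>B\<bar> + 1"]) auto
qed

lemma bounded_clinear_add: "bounded_clinear T \<Longrightarrow> T (x + y) = T x + T y"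
  and bounded_clinear_scaleC: "bounded_clinear T \<Longrightarrow> T (c *\<^sub>C x) = c *\<^sub>C T x"
  by (auto simp: bounded_clinear_on_def)

lemma bounded_clinear_scaleR: "bounded_clinear T \<Longrightarrow> T (r *\<^sub>R x) = r *\<^sub>R T x"
  by (metis bounded_clinear_scaleC scaleC_of_real)

lemma bounded_clinear_bounded_linear: "bounded_clinear T \<Longrightarrow> bounded_linear T"
proof -
  assume T: "bounded_clinear T"
  obtain B where "0 < B" "\<And>x. x \<in> UNIV \<Longrightarrow> norm (T x) \<le> B * norm x"
    using bounded_clinear_on_bound[OF T] by blast
  then show ?thesis
    by (intro bounded_linear_intro[where K = B])
      (auto simp: bounded_clinear_add[OF T] bounded_clinear_scaleR[OF T] mult.commute)
qed

lemma bounded_clinear_zero: "bounded_clinear T \<Longrightarrow> T 0 = 0"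
  and bounded_clinear_diff: "bounded_clinear T \<Longrightarrow> T (x - y) = T x - T y"
  and bounded_clinear_minus: "bounded_clinear T \<Longrightarrow> T (- x) = - T x"
  and bounded_clinear_sum: "bounded_clinear T \<Longrightarrow> T (\<Sum>i\<in>I. f i) = (\<Sum>i\<in>I. T (f i))"
  using bounded_clinear_bounded_linear[of T] bounded_linear.linear[of T]
  by (auto simp: linear_0 linear_diff linear_neg linear_sum)

lemmas bounded_clinear_simps = bounded_clinear_add bounded_clinear_diff bounded_clinear_minus
  bounded_clinear_zero bounded_clinear_scaleC bounded_clinear_scaleR bounded_clinear_sum

lemma bounded_clinear_tendsto:
  "bounded_clinear T \<Longrightarrow> (f \<longlongrightarrow> l) F \<Longrightarrow> ((\<lambda>x. T (f x)) \<longlongrightarrow> T l) F"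
  using bounded_linear.tendsto[OF bounded_clinear_bounded_linear] .

lemma bounded_clinear_from_bounded_linear:
  assumes "bounded_linear T" and "\<And>c x. T (c *\<^sub>C x) = c *\<^sub>C T x"
  shows "bounded_clinear T"
proof -
  obtain B where "\<And>x. norm (T x) \<le> B * norm x"
    using bounded_linear.nonneg_bounded[OF assms(1)] by (auto simp: mult.commute)
  then show ?thesis
    using assms(2) linear_add[OF bounded_linear.linear[OF assms(1)]]
    by (intro bounded_clinear_onI[where B = B]) auto
qed

lemma bounded_clinear_compose:
  assumes "bounded_clinear S" "bounded_clinear T"
  shows "bounded_clinear (\<lambda>x. S (T x))"
  using bounded_linear_compose[OF assms[THEN bounded_clinear_bounded_linear]]
  by (rule bounded_clinear_from_bounded_linear) (simp add: bounded_clinear_scaleC assms)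

lemma bounded_clinear_plus:
  assumes "bounded_clinear S" "bounded_clinear T"
  shows "bounded_clinear (\<lambda>x. S x + T x)"
  using bounded_linear_add[OF assms[THEN bounded_clinear_bounded_linear]]
  by (rule bounded_clinear_from_bounded_linear)
    (simp add: bounded_clinear_scaleC assms scaleC_add_right)

lemma bounded_clinear_minus_op:
  assumes "bounded_clinear S" "bounded_clinear T"
  shows "bounded_clinear (\<lambda>x. S x - T x)"
  using bounded_linear_sub[OF assms[THEN bounded_clinear_bounded_linear]]
  by (rule bounded_clinear_from_bounded_linear)
    (simp add: bounded_clinear_scaleC assms scaleC_diff_right)

lemma bounded_clinear_times:
  assumes "bounded_clinear T"
  shows "bounded_clinear (\<lambda>x. c *\<^sub>C T x)"
  using bounded_linear_compose[OF bounded_linear_scaleC bounded_clinear_bounded_linear[OF assms]]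
  by (rule bounded_clinear_from_bounded_linear)
    (simp add: bounded_clinear_scaleC assms scaleC_scaleC mult.commute)

lemma bounded_clinear_timesR:
  assumes "bounded_clinear T"
  shows "bounded_clinear (\<lambda>x. r *\<^sub>R T x)"
  using bounded_clinear_times[OF assms, of "of_real r"] by (simp add: scaleC_of_real)

lemma bounded_clinear_ident: "bounded_clinear (\<lambda>x. x)"
  by (rule bounded_clinear_onI[where B = 1]) auto

lemma bounded_clinear_zero_op: "bounded_clinear (\<lambda>x. 0)"
  by (rule bounded_clinear_onI[where B = 1]) auto

lemma bounded_clinear_sum_op:
  assumes "\<And>i. i \<in> I \<Longrightarrow> bounded_clinear (T i)"
  shows "bounded_clinear (\<lambda>x. \<Sum>i\<in>I. T i x)"
  using assms
  by (induction I rule: infinite_finite_induct)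
    (auto intro: bounded_clinear_plus bounded_clinear_zero_op)

lemmas bounded_clinear_intros = bounded_clinear_compose bounded_clinear_plus
  bounded_clinear_minus_op bounded_clinear_times bounded_clinear_timesR bounded_clinear_ident
  bounded_clinear_zero_op bounded_clinear_sum_op

lemma bounded_clinear_on_restrict:
  assumes "bounded_clinear T" "\<And>x. x \<in> X \<Longrightarrow> T x \<in> Y"
  shows "bounded_clinear_on X Y T"
  using assms unfolding bounded_clinear_on_def by blast


section \<open>Riesz representation and adjoints\<close>

text \<open>The representing vector of a bounded functional \<open>f\<close> minimises \<open>\<parallel>u\<parallel>\<^sup>2 - 2 Re (f u)\<close>. A minimising
  sequence is Cauchy by the parallelogram law. Projection onto a closed subspace is the instance
  \<open>f u = \<langle>u, y\<rangle>\<close>.\<close>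

lemma riesz_representation:
  fixes f :: "'a::complex_hilbert \<Rightarrow> complex"
  assumes X: "closed_csubspace X"
    and add: "\<And>u v. u \<in> X \<Longrightarrow> v \<in> X \<Longrightarrow> f (u + v) = f u + f v"
    and scale: "\<And>c u. u \<in> X \<Longrightarrow> f (c *\<^sub>C u) = c * f u"
    and bound: "\<And>u. u \<in> X \<Longrightarrow> cmod (f u) \<le> B * norm u"
  shows "\<exists>x\<in>X. \<forall>u\<in>X. f u = cinner u x"
proof -
  note sub = csubspace_zero[OF X] csubspace_add[OF X] csubspace_scaleR[OF X] csubspace_scaleC[OF X]
    csubspace_diff[OF X]
  define g where "g u = Re (f u)" for u
  define \<phi> where "\<phi> u = (norm u)\<^sup>2 - 2 * g u" for u
  have g_add: "g (u + v) = g u + g v" if "u \<in> X" "v \<in> X" for u v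
    using add that by (simp add: g_def)
  have g_scale: "g (r *\<^sub>R u) = r * g u" if "u \<in> X" for r u
    using scale[OF that, of "of_real r"] by (simp add: g_def scaleC_of_real)
  have g_bound: "\<bar>g u\<bar> \<le> B * norm u" if "u \<in> X" for u
    using bound[OF that] abs_Re_le_cmod[of "f u"] by (simp add: g_def)
  have low: "- B\<^sup>2 \<le> \<phi> u" if "u \<in> X" for u
  proof -
    have "0 \<le> (norm u - B)\<^sup>2" by simp
    then have "- B\<^sup>2 \<le> (norm u)\<^sup>2 - 2 * (B * norm u)"
      by (simp add: power2_diff mult_ac)
    then show ?thesis
      using g_bound[OF that] by (simp add: \<phi>_def)
  qed
  define m where "m = Inf (\<phi> ` X)"
  have bdd: "bdd_below (\<phi> ` X)"
    using low by (auto intro!: bdd_belowI[of _ "- B\<^sup>2"])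
  have m_le: "m \<le> \<phi> u" if "u \<in> X" for u
    unfolding m_def using that bdd by (auto intro: cInf_lower)
  have "\<exists>u\<in>X. \<phi> u < m + 1 / Suc n" for n
  proof -
    have "Inf (\<phi> ` X) < m + 1 / Suc n" by (simp add: m_def)
    then show ?thesis
      using cInf_less_iff[OF _ bdd, of "m + 1 / Suc n"] sub(1) by blast
  qed
  then obtain s where sX: "\<And>n. s n \<in> X" and s: "\<And>n. \<phi> (s n) < m + 1 / Suc n"
    by metis
  have par: "(norm (u - v))\<^sup>2 \<le> 2 * (\<phi> u - m) + 2 * (\<phi> v - m)" if "u \<in> X" "v \<in> X" for u v
  proof -
    have "\<phi> ((1/2) *\<^sub>R (u + v)) = (norm (u + v))\<^sup>2 / 4 - g (u + v)"
      unfolding \<phi>_def g_scale[OF sub(2)[OF that]] norm_scaleR power_mult_distrib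
      by (simp add: power2_eq_square)
    moreover have "m \<le> \<phi> ((1/2) *\<^sub>R (u + v))"
      by (intro m_le sub(3) sub(2) that)
    moreover have "(norm (u - v))\<^sup>2 = 2 * (norm u)\<^sup>2 + 2 * (norm v)\<^sup>2 - (norm (u + v))\<^sup>2"
      by (simp add: power2_norm_eq_inner inner_add inner_diff inner_commute)
    ultimately show ?thesis
      using g_add[OF that] by (simp add: \<phi>_def)
  qed
  have "Cauchy s"
  proof (rule metric_CauchyI)
    fix e :: real assume "0 < e"
    then obtain M where M: "inverse (real (Suc M)) < e\<^sup>2 / 4"
      using reals_Archimedean[of "e\<^sup>2 / 4"] by auto
    have "dist (s i) (s j) < e" if "M \<le> i" "M \<le> j" for i j
    proof -
      have "1 / real (Suc i) \<le> 1 / real (Suc M)" "1 / real (Suc j) \<le> 1 / real (Suc M)"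
        using that by (auto simp: divide_simps)
      then have "(norm (s i - s j))\<^sup>2 < e\<^sup>2"
        using par[OF sX sX, of i j] s[of i] s[of j] M by (simp add: inverse_eq_divide)
      then show ?thesis
        using \<open>0 < e\<close> by (simp add: dist_norm power2_less_imp_less)
    qed
    then show "\<exists>M. \<forall>i\<ge>M. \<forall>j\<ge>M. dist (s i) (s j) < e"
      by blast
  qed
  then obtain x where lim: "s \<longlonglongrightarrow> x"
    using Cauchy_convergent convergent_def by blast
  have xX: "x \<in> X"
    using closed_sequentially[OF csubspace_closed[OF X]] sX lim by blast
  have "(\<lambda>n. g (s n)) \<longlonglongrightarrow> g x"
  proof (rule Lim_null_comparison[THEN Lim_null[THEN iffD2]])
    have "g (s n) - g x = g (s n - x)" for n
      using g_add[OF sX sub(3)[OF xX, of "-1"], of n] g_scale[OF xX, of "-1"] by simp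
    then show "\<forall>\<^sub>F n in sequentially. norm (g (s n) - g x) \<le> B * norm (s n - x)"
      using g_bound sub(5)[OF sX xX] by simp
    show "(\<lambda>n. B * norm (s n - x)) \<longlonglongrightarrow> 0"
      using tendsto_mult[OF tendsto_const tendsto_norm[OF LIM_zero[OF lim]], of B] by simp
  qed
  then have "(\<lambda>n. \<phi> (s n)) \<longlonglongrightarrow> \<phi> x"
    unfolding \<phi>_def by (intro tendsto_intros lim)
  moreover have "(\<lambda>n. m + 1 / real (Suc n)) \<longlonglongrightarrow> m"
    using LIMSEQ_inverse_real_of_nat_add[of m] by (simp add: inverse_eq_divide)
  ultimately have "\<phi> x \<le> m"
    using s by (meson LIMSEQ_le less_imp_le)
  then have min: "\<phi> x \<le> \<phi> u" if "u \<in> X" for u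
    using m_le[OF that] by linarith
  have real: "g u = inner u x" if u: "u \<in> X" for u
  proof (rule ccontr)
    define d where "d = inner u x - g u"
    assume "g u \<noteq> inner u x"
    then have d: "d \<noteq> 0" by (simp add: d_def)
    have quad: "0 \<le> 2 * t * d + t\<^sup>2 * (norm u)\<^sup>2" for t
    proof -
      have "\<phi> (x + t *\<^sub>R u) = \<phi> x + (2 * t * d + t\<^sup>2 * (norm u)\<^sup>2)"
        unfolding \<phi>_def d_def power2_norm_eq_inner
        using g_add[OF xX sub(3)[OF u, of t]] g_scale[OF u, of t]
        by (simp add: inner_add inner_commute algebra_simps power2_eq_square)
      then show ?thesis
        using min[OF sub(2)[OF xX sub(3)[OF u, of t]]] by simp
    qed
    \<comment> \<open>close to the minimiser of the quadratic, but defined for \<open>u = 0\<close> too\<close>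
    define t where "t = - d / ((norm u)\<^sup>2 + 1)"
    have pos: "0 < (norm u)\<^sup>2 + 1"
      by (simp add: add_nonneg_pos)
    then have "t * ((norm u)\<^sup>2 + 1) = - d"
      by (simp add: t_def)
    then have "t * (t * ((norm u)\<^sup>2 + 1)) = t * (- d)"
      by simp
    then have "2 * t * d + t\<^sup>2 * (norm u)\<^sup>2 = t * d - t\<^sup>2"
      by (simp add: algebra_simps power2_eq_square)
    moreover have "t * d = - (d\<^sup>2 / ((norm u)\<^sup>2 + 1))"
      by (simp add: t_def power2_eq_square)
    then have "t * d < 0"
      using d pos by simp
    ultimately show False
      using quad[of t] zero_le_power2[of t] by linarith
  qed
  have "f u = cinner u x" if u: "u \<in> X" for u
  proof (rule complex_eqI)
    show "Re (f u) = Re (cinner u x)"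
      using real[OF u] by (simp add: g_def Re_cinner)
    have "Re (\<i> * f u) = Re (\<i> * cinner u x)"
      using real[OF sub(4)[OF u, of \<i>]] scale[OF u, of \<i>]
      by (simp add: g_def Re_cinner[symmetric] cinner_scaleC_left)
    then show "Im (f u) = Im (cinner u x)" by simp
  qed
  then show ?thesis using xX by blast
qed

lemma adj_on_eqI:
  assumes "closed_csubspace X" "x \<in> X" "\<And>u. u \<in> X \<Longrightarrow> cinner (T u) y = cinner u x"
  shows "adj_on X T y = x"
  unfolding adj_on_def
proof (rule the_equality)
  fix x' assume x': "x' \<in> X \<and> (\<forall>u\<in>X. cinner (T u) y = cinner u x')"
  have d: "x' - x \<in> X" using csubspace_diff[OF assms(1)] assms(2) x' by blast
  then have "cinner (x' - x) x' = cinner (x' - x) x"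
    using assms(3)[OF d] x' by force
  then have "cinner (x' - x) (x' - x) = 0"
    by (simp add: cinner_diff_right)
  then show "x' = x" by (simp add: cinner_self)
qed (use assms in auto)

context
  fixes X :: "'a::complex_hilbert set" and Y :: "'b::complex_hilbert set" and T
  assumes X: "closed_csubspace X" and T: "bounded_clinear_on X Y T"
begin

lemma adj_on_ex: "\<exists>x\<in>X. \<forall>u\<in>X. cinner (T u) y = cinner u x"
proof -
  obtain B where "0 < B" and B: "\<And>x. x \<in> X \<Longrightarrow> norm (T x) \<le> B * norm x"
    using bounded_clinear_on_bound[OF T] by blast
  show ?thesis
  proof (rule riesz_representation[OF X, where B = "B * norm y"])
    fix u assume "u \<in> X"
    then show "cmod (cinner (T u) y) \<le> B * norm y * norm u"
      using norm_cinner_le[of "T u" y] mult_right_mono[OF B, of u "norm y"] by (simp add: mult_ac)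
  qed (use T in \<open>auto simp: bounded_clinear_on_def cinner_simps\<close>)
qed

lemma adj_on_in: "adj_on X T y \<in> X"
  and cinner_adj_on: "u \<in> X \<Longrightarrow> cinner (T u) y = cinner u (adj_on X T y)"
proof -
  obtain x where x: "x \<in> X" "\<And>u. u \<in> X \<Longrightarrow> cinner (T u) y = cinner u x"
    using adj_on_ex by blast
  then have "adj_on X T y = x" by (rule adj_on_eqI[OF X])
  with x show "adj_on X T y \<in> X" "u \<in> X \<Longrightarrow> cinner (T u) y = cinner u (adj_on X T y)"
    by auto
qed

lemma cinner_adj_on': "u \<in> X \<Longrightarrow> cinner y (T u) = cinner (adj_on X T y) u"
  by (metis cinner_adj_on cinner_commute)

lemma bounded_clinear_adj_on: "bounded_clinear_on UNIV X (adj_on X T)"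
proof -
  obtain B where B: "0 < B" "\<And>x. x \<in> X \<Longrightarrow> norm (T x) \<le> B * norm x"
    using bounded_clinear_on_bound[OF T] by blast
  show ?thesis
  proof (rule bounded_clinear_onI[where B = B])
    show "adj_on X T (x + y) = adj_on X T x + adj_on X T y" for x y
      by (rule adj_on_eqI[OF X]) (auto simp: csubspace_add[OF X] adj_on_in cinner_adj_on cinner_simps)
    show "adj_on X T (c *\<^sub>C x) = c *\<^sub>C adj_on X T x" for c x
      by (rule adj_on_eqI[OF X]) (auto simp: csubspace_scaleC[OF X] adj_on_in cinner_adj_on cinner_simps)
    show "norm (adj_on X T x) \<le> B * norm x" for x
    proof -
      let ?a = "adj_on X T x"
      have "(norm ?a)\<^sup>2 = cmod (cinner (T ?a) x)"
        using cinner_adj_on[OF adj_on_in, of x x] by (simp add: cinner_self norm_power)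
      also have "\<dots> \<le> norm ?a * (B * norm x)"
        using norm_cinner_le[of "T ?a" x] mult_right_mono[OF B(2)[OF adj_on_in[of x]], of "norm x"]
        by (simp add: mult_ac)
      finally show ?thesis
        using B(1) by (cases "?a = 0") (auto simp: power2_eq_square)
    qed
  qed (rule adj_on_in)
qed

end

lemma cinner_adj: "bounded_clinear T \<Longrightarrow> cinner (T u) y = cinner u (adj T y)"
  and cinner_adj': "bounded_clinear T \<Longrightarrow> cinner y (T u) = cinner (adj T y) u"
  and bounded_clinear_adj: "bounded_clinear T \<Longrightarrow> bounded_clinear (adj T)"
  by (auto intro!: cinner_adj_on cinner_adj_on' bounded_clinear_adj_on)

lemma adj_eqI: "(\<And>u. cinner (T u) y = cinner u x) \<Longrightarrow> adj T y = x"
  by (rule adj_on_eqI) auto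

lemma adj_adj: "bounded_clinear T \<Longrightarrow> adj (adj T) = T"
  by (rule ext, rule adj_eqI) (simp add: cinner_adj')

lemma adj_compose:
  "bounded_clinear S \<Longrightarrow> bounded_clinear T \<Longrightarrow> adj (\<lambda>x. S (T x)) = (\<lambda>x. adj T (adj S x))"
  by (rule ext, rule adj_eqI) (simp add: cinner_adj)

lemma orthogonal_projection_ex:
  assumes X: "closed_csubspace X"
  shows "\<exists>x\<in>X. \<forall>u\<in>X. cinner u (y - x) = 0"
proof -
  have "\<exists>x\<in>X. \<forall>u\<in>X. cinner u y = cinner u x"
    by (rule riesz_representation[OF X, where B = "norm y"])
      (auto simp: cinner_simps norm_cinner_le mult.commute[of "norm y"])
  then show ?thesis by (auto simp: cinner_diff_right)
qed


section \<open>Positive operators and their square roots\<close>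

definition self_adjoint :: "('a::complex_hilbert \<Rightarrow> 'a) \<Rightarrow> bool" where
  "self_adjoint T \<longleftrightarrow> bounded_clinear T \<and> (\<forall>x y. cinner (T x) y = cinner x (T y))"

lemma self_adjoint_bounded: "self_adjoint T \<Longrightarrow> bounded_clinear T"
  and self_adjoint_cinner: "self_adjoint T \<Longrightarrow> cinner (T x) y = cinner x (T y)"
  by (auto simp: self_adjoint_def)

lemma self_adjoint_inner: "self_adjoint T \<Longrightarrow> inner (T x) y = inner x (T y)"
  by (metis Re_cinner self_adjoint_cinner)

text \<open>By polarisation: reality of the form at \<open>x + y\<close> and \<open>x + \<i> y\<close> makes the imaginary and the
  real part of \<open>\<langle>T x, y\<rangle> - \<langle>x, T y\<rangle>\<close> vanish.\<close>

lemma positive_op_self_adjoint: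
  assumes "positive_op T"
  shows "self_adjoint T"
proof -
  have T: "bounded_clinear T" and re: "Im (cinner (T x) x) = 0" for x
    using assms by (auto simp: positive_op_def complex_is_Real_iff)
  have "cinner (T x) y = cinner x (T y)" for x y
  proof -
    define a b where "a = cinner (T x) y" and "b = cinner (T y) x"
    have "Im (a + b) = 0"
      using re[of "x + y"] re[of x] re[of y]
      by (simp add: a_def b_def bounded_clinear_add[OF T] cinner_simps)
    moreover have "Im (\<i> * b - \<i> * a) = 0"
      using re[of "x + \<i> *\<^sub>C y"] re[of x] re[of y]
      by (simp add: a_def b_def bounded_clinear_add[OF T] bounded_clinear_scaleC[OF T] cinner_simps)
    ultimately have "a = cnj b"
      by (simp add: complex_eq_iff)
    then show ?thesis
      using cinner_commute[of x "T y"] by (simp add: a_def b_def)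
  qed
  then show ?thesis using T by (simp add: self_adjoint_def)
qed

lemma positive_op_iff: "positive_op T \<longleftrightarrow> self_adjoint T \<and> (\<forall>x. 0 \<le> inner (T x) x)"
proof
  assume "self_adjoint T \<and> (\<forall>x. 0 \<le> inner (T x) x)"
  moreover from this have "Im (cinner (T x) x) = 0" for x
    using cinner_commute[of x "T x"] by (metis cnj.simps(2) equal_neg_zero self_adjoint_cinner)
  ultimately show "positive_op T"
    by (auto simp: positive_op_def self_adjoint_def complex_is_Real_iff Re_cinner inner_commute)
qed (auto simp: positive_op_self_adjoint, auto simp: positive_op_def Re_cinner)

lemma positive_op_inner: "positive_op T \<Longrightarrow> 0 \<le> inner (T x) x"
  by (simp add: positive_op_iff)

lemma quadratic_nonneg_discriminant:
  fixes a b c :: real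
  assumes q: "\<And>t. 0 \<le> a + 2 * t * b + t\<^sup>2 * c" and c: "0 \<le> c"
  shows "b\<^sup>2 \<le> a * c"
proof (cases "c = 0")
  case True
  have "b = 0"
  proof (rule ccontr)
    assume "b \<noteq> 0"
    then have "2 * (- (a + 1) / (2 * b)) * b = - (a + 1)" by simp
    with q[of "- (a + 1) / (2 * b)"] True show False by simp
  qed
  with True show ?thesis by simp
next
  case False
  then have "0 < c" using c by simp
  have "0 \<le> c * (a + 2 * (- b / c) * b + (- b / c)\<^sup>2 * c)"
    using c q[of "- b / c"] by (rule mult_nonneg_nonneg)
  also have "\<dots> = a * c - b\<^sup>2"
    using \<open>0 < c\<close> by (simp add: field_simps power2_eq_square)
  finally show ?thesis by simp
qed

lemma positive_op_Cauchy_Schwarz: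
  assumes "positive_op T"
  shows "(inner (T x) y)\<^sup>2 \<le> inner (T x) x * inner (T y) y"
proof (rule quadratic_nonneg_discriminant)
  fix t
  have sa: "self_adjoint T" using assms by (rule positive_op_self_adjoint)
  have "0 \<le> inner (T (x + t *\<^sub>R y)) (x + t *\<^sub>R y)"
    using assms by (rule positive_op_inner)
  also have "\<dots> = inner (T x) x + 2 * t * inner (T x) y + t\<^sup>2 * inner (T y) y"
    using self_adjoint_inner[OF sa, of y x]
    by (simp add: bounded_clinear_add[OF self_adjoint_bounded[OF sa]] inner_add inner_commute
        bounded_clinear_scaleR[OF self_adjoint_bounded[OF sa]] algebra_simps power2_eq_square)
  finally show "0 \<le> inner (T x) x + 2 * t * inner (T x) y + t\<^sup>2 * inner (T y) y" .
qed (rule positive_op_inner[OF assms])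

lemma positive_op_kernel:
  assumes "positive_op T" "inner (T x) x = 0"
  shows "T x = 0"
  using positive_op_Cauchy_Schwarz[OF assms(1), of x "T x"] assms(2) by simp

lemma positive_op_contraction:
  assumes T: "positive_op T" and le: "\<And>x. inner (T x) x \<le> (norm x)\<^sup>2"
  shows "norm (T x) \<le> norm x"
proof (cases "T x = 0")
  case False
  have "((norm (T x))\<^sup>2)\<^sup>2 \<le> inner (T x) x * inner (T (T x)) (T x)"
    using positive_op_Cauchy_Schwarz[OF T, of x "T x"] by (simp add: power2_norm_eq_inner)
  also have "\<dots> \<le> (norm x)\<^sup>2 * (norm (T x))\<^sup>2"
    by (intro mult_mono le positive_op_inner[OF T]) auto
  finally have "(norm (T x))\<^sup>2 \<le> (norm x)\<^sup>2"
    unfolding power2_eq_square[of "(norm (T x))\<^sup>2"]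
    by (rule mult_right_le_imp_le) (use False in simp)
  then show ?thesis by (rule power2_le_imp_le) simp
qed simp

text \<open>The root of \<open>1 - X\<close> is \<open>1 - Y\<close> with \<open>Y = (X + Y\<^sup>2) / 2\<close>, found by iteration from \<open>0\<close>. The iterates
  and their increments are polynomials in \<open>X\<close> with nonnegative coefficients, and such a polynomial
  is bounded in norm by its value at the number \<open>1\<close>. The following predicate records a polynomial
  of this kind together with that value, so that the convergence of the iteration reduces to
  the scalar case \<open>X = 1\<close>.\<close>

inductive dominated :: "('a::complex_hilbert \<Rightarrow> 'a) \<Rightarrow> ('a \<Rightarrow> 'a) \<Rightarrow> real \<Rightarrow> bool"
  for X where
  zero: "dominated X (\<lambda>x. 0) 0"
| gen: "dominated X X 1"
| add: "dominated X S a \<Longrightarrow> dominated X T b \<Longrightarrow> dominated X (\<lambda>x. S x + T x) (a + b)"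
| comp: "dominated X S a \<Longrightarrow> dominated X T b \<Longrightarrow> dominated X (\<lambda>x. S (T x)) (a * b)"
| scale: "dominated X S a \<Longrightarrow> 0 \<le> r \<Longrightarrow> dominated X (\<lambda>x. r *\<^sub>R S x) (r * a)"

lemma dominated_bound:
  assumes "dominated X T c" "bounded_clinear X" "\<And>x. norm (X x) \<le> norm x"
  shows "0 \<le> c \<and> bounded_clinear T \<and> (\<forall>x. norm (T x) \<le> c * norm x)"
  using assms(1)
proof induction
  case (add S a T b)
  have "norm (S x + T x) \<le> (a + b) * norm x" for x
    using add.IH norm_triangle_ineq[of "S x" "T x"] by (simp add: distrib_right) (smt (verit))
  then show ?case using add.IH by (auto intro: bounded_clinear_plus)
next
  case (comp S a T b)
  have "norm (S (T x)) \<le> a * b * norm x" for x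
  proof -
    have "norm (S (T x)) \<le> a * norm (T x)" using comp.IH by blast
    also have "\<dots> \<le> a * (b * norm x)" using comp.IH by (intro mult_left_mono) auto
    finally show ?thesis by simp
  qed
  then show ?case using comp.IH by (auto intro: bounded_clinear_compose)
next
  case (scale S a r)
  then show ?case by (auto intro: bounded_clinear_timesR mult_left_mono simp: mult.assoc)
qed (use assms in \<open>auto intro: bounded_clinear_zero_op\<close>)

lemma dominated_commute:
  assumes "dominated X T c" "bounded_clinear S" "\<And>x. S (X x) = X (S x)"
  shows "S (T x) = T (S x)"
  using assms(1) by (induction arbitrary: x) (auto simp: bounded_clinear_simps[OF assms(2)] assms(3))

lemma dominated_commute2:
  assumes "dominated X S a" "dominated X T b" "bounded_clinear X" "\<And>x. norm (X x) \<le> norm x"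
  shows "S (T x) = T (S x)"
proof -
  have S: "bounded_clinear S" using dominated_bound[OF assms(1,3,4)] by blast
  have "S (X x) = X (S x)" for x
    using dominated_commute[OF assms(1,3), of x] by simp
  then show ?thesis using dominated_commute[OF assms(2) S] by blast
qed

lemma dominated_self_adjoint:
  assumes "dominated X T c" "self_adjoint X" "\<And>x. norm (X x) \<le> norm x"
  shows "cinner (T x) y = cinner x (T y)"
  using assms(1)
proof (induction arbitrary: x y)
  case (comp S a T b)
  have "S (T z) = T (S z)" for z
    by (rule dominated_commute2[OF comp.hyps(1,2) self_adjoint_bounded[OF assms(2)] assms(3)])
  then show ?case using comp.IH by metis
qed (auto simp: cinner_simps self_adjoint_cinner[OF assms(2)])

primrec root_iter :: "('a::complex_hilbert \<Rightarrow> 'a) \<Rightarrow> nat \<Rightarrow> 'a \<Rightarrow> 'a" where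
  "root_iter X 0 = (\<lambda>x. 0)"
| "root_iter X (Suc n) = (\<lambda>x. (1/2) *\<^sub>R (X x + root_iter X n (root_iter X n x)))"

primrec root_bound :: "nat \<Rightarrow> real" where
  "root_bound 0 = 0"
| "root_bound (Suc n) = (1/2) * (1 + root_bound n * root_bound n)"

lemma root_bound_le: "0 \<le> root_bound n \<and> root_bound n \<le> 1"
proof (induction n)
  case (Suc n)
  then have "root_bound n * root_bound n \<le> 1 * 1" by (intro mult_mono) auto
  then show ?case by simp
qed simp

lemma convergent_root_bound: "convergent root_bound"
proof (rule Bseq_mono_convergent)
  show "Bseq root_bound"
    using root_bound_le by (intro BseqI'[where K = 1]) auto
  have "root_bound n \<le> root_bound (Suc n)" for n
    using zero_le_power2[of "root_bound n - 1"] by (simp add: power2_eq_square algebra_simps)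
  then show "\<forall>m n. m \<le> n \<longrightarrow> root_bound m \<le> root_bound n"
    by (meson lift_Suc_mono_le)
qed

lemma dominated_root_iter: "dominated X (root_iter X n) (root_bound n)"
proof (induction n)
  case (Suc n)
  show ?case
    unfolding root_iter.simps root_bound.simps
    by (intro dominated.scale dominated.add dominated.gen dominated.comp Suc.IH) simp
qed (simp add: dominated.zero)

text \<open>With \<open>Y\<close> for the iterates, \<open>Y\<^sub>n\<^sub>+\<^sub>2 - Y\<^sub>n\<^sub>+\<^sub>1 = (Y\<^sub>n\<^sub>+\<^sub>1 - Y\<^sub>n) (Y\<^sub>n\<^sub>+\<^sub>1 + Y\<^sub>n) / 2\<close>, so nonnegativity of the
  coefficients propagates.\<close>

lemma dominated_root_iter_diff:
  assumes "bounded_clinear X" "\<And>x. norm (X x) \<le> norm x"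
  shows "dominated X (\<lambda>x. root_iter X (Suc n) x - root_iter X n x) (root_bound (Suc n) - root_bound n)"
proof (induction n)
  case 0
  show ?case using dominated.scale[OF dominated.gen, of "1/2" X] by simp
next
  case (Suc n)
  let ?Y = "root_iter X"
  have lin: "bounded_clinear (?Y k)" for k
    using dominated_bound[OF dominated_root_iter assms] by blast
  have comm: "?Y j (?Y k x) = ?Y k (?Y j x)" for j k x
    by (rule dominated_commute2[OF dominated_root_iter dominated_root_iter assms])
  have eq: "?Y (Suc (Suc n)) x - ?Y (Suc n) x =
      (1/2) *\<^sub>R ((\<lambda>x. ?Y (Suc n) x - ?Y n x) (?Y (Suc n) x + ?Y n x))" for x
  proof -
    have "?Y (Suc (Suc n)) x - ?Y (Suc n) x =
        (1/2) *\<^sub>R (?Y (Suc n) (?Y (Suc n) x) - ?Y n (?Y n x))"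
      by (simp only: root_iter.simps(2)[of X "Suc n"])
        (simp add: scaleR_diff_right[symmetric] scaleR_add_right[symmetric] del: scaleR_diff_right
          scaleR_add_right)
    also have "?Y (Suc n) (?Y (Suc n) x) - ?Y n (?Y n x) =
        (\<lambda>x. ?Y (Suc n) x - ?Y n x) (?Y (Suc n) x + ?Y n x)"
      using comm[of n "Suc n" x] bounded_clinear_add[OF lin]
      by (simp del: root_iter.simps)
    finally show ?thesis .
  qed
  have "dominated X (\<lambda>x. ?Y (Suc (Suc n)) x - ?Y (Suc n) x)
      ((1/2) * ((root_bound (Suc n) - root_bound n) * (root_bound (Suc n) + root_bound n)))"
    unfolding eq
    by (intro dominated.scale dominated.comp[OF Suc.IH] dominated.add dominated_root_iter) simp
  moreover have "(1/2) * ((root_bound (Suc n) - root_bound n) * (root_bound (Suc n) + root_bound n))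
      = root_bound (Suc (Suc n)) - root_bound (Suc n)"
    by (simp only: root_bound.simps(2)[of "Suc n"] root_bound.simps(2)[of n]) (simp add: algebra_simps)
  ultimately show ?case by metis
qed

lemma root_iter_Cauchy_bound:
  assumes "bounded_clinear X" "\<And>x. norm (X x) \<le> norm x" "n \<le> m"
  shows "norm (root_iter X m x - root_iter X n x) \<le> (root_bound m - root_bound n) * norm x"
  using assms(3)
proof (induction m rule: dec_induct)
  case (step m)
  have "norm (root_iter X (Suc m) x - root_iter X m x) \<le> (root_bound (Suc m) - root_bound m) * norm x"
    using dominated_bound[OF dominated_root_iter_diff[OF assms(1,2)] assms(1,2)] by blast
  then have "norm ((root_iter X (Suc m) x - root_iter X m x) + (root_iter X m x - root_iter X n x))
      \<le> (root_bound (Suc m) - root_bound m) * norm x + (root_bound m - root_bound n) * norm x"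
    using step.IH by (rule norm_triangle_mono)
  then show ?case by (simp add: algebra_simps del: root_iter.simps root_bound.simps)
qed simp

text \<open>The root is a strong limit of polynomials in \<open>X\<close>. Therefore it commutes with the commutant of
  \<open>X\<close>, which is what makes positive roots unique.\<close>

lemma contraction_sqrt_ex:
  assumes X: "self_adjoint X" and contr: "\<And>x. norm (X x) \<le> norm x"
  shows "\<exists>R. positive_op R \<and> (\<forall>x. R (R x) = x - X x) \<and>
    (\<forall>S. bounded_clinear S \<longrightarrow> (\<forall>x. S (X x) = X (S x)) \<longrightarrow> (\<forall>x. S (R x) = R (S x)))"
proof -
  note XB = self_adjoint_bounded[OF X] contr
  let ?Y = "root_iter X"
  have Ybd: "norm (?Y n x) \<le> norm x" and Ylin: "bounded_clinear (?Y n)" for n x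
  proof -
    have "norm (?Y n x) \<le> root_bound n * norm x" "bounded_clinear (?Y n)"
      using dominated_bound[OF dominated_root_iter XB] by blast+
    moreover have "root_bound n * norm x \<le> 1 * norm x"
      using root_bound_le by (intro mult_right_mono) auto
    ultimately show "norm (?Y n x) \<le> norm x" "bounded_clinear (?Y n)" by linarith+
  qed
  have "Cauchy (\<lambda>n. ?Y n x)" for x
  proof -
    have "Cauchy (\<lambda>n. root_bound n * norm x)"
      using convergent_mult[OF convergent_root_bound convergent_const] convergent_Cauchy by blast
    then have c: "\<exists>M. \<forall>m\<ge>M. \<forall>n\<ge>M. \<bar>root_bound m * norm x - root_bound n * norm x\<bar> < e" if "e > 0" for e
      using that by (simp add: Cauchy_def dist_real_def)
    have le: "dist (?Y m x) (?Y n x) \<le> \<bar>root_bound m * norm x - root_bound n * norm x\<bar>" for m n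
    proof (cases "n \<le> m")
      case True
      show ?thesis
        using root_iter_Cauchy_bound[OF XB True, of x] by (simp add: dist_norm left_diff_distrib)
    next
      case False
      then show ?thesis
        using root_iter_Cauchy_bound[OF XB, of m n x]
        by (simp add: dist_norm left_diff_distrib norm_minus_commute)
    qed
    show ?thesis
    proof (rule metric_CauchyI)
      fix e :: real assume "0 < e"
      from c[OF this] show "\<exists>M. \<forall>m\<ge>M. \<forall>n\<ge>M. dist (?Y m x) (?Y n x) < e"
        using le by (meson order.strict_trans1)
    qed
  qed
  then have "\<exists>l. (\<lambda>n. ?Y n x) \<longlonglongrightarrow> l" for x
    using Cauchy_convergent convergent_def by blast
  then obtain Y where Y: "\<And>x. (\<lambda>n. ?Y n x) \<longlonglongrightarrow> Y x" by metis
  have add: "Y (x + y) = Y x + Y y" for x y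
    by (rule LIMSEQ_unique[OF Y[of "x + y"]])
      (simp add: bounded_clinear_add[OF Ylin] tendsto_add Y)
  have scale: "Y (c *\<^sub>C x) = c *\<^sub>C Y x" for c x
    by (rule LIMSEQ_unique[OF Y[of "c *\<^sub>C x"]])
      (simp add: bounded_clinear_scaleC[OF Ylin] tendsto_scaleC Y)
  have bd: "norm (Y x) \<le> norm x" for x
    by (rule LIMSEQ_le_const2[OF tendsto_norm[OF Y]]) (use Ybd in auto)
  have lin: "bounded_clinear Y"
    by (rule bounded_clinear_onI[where B = 1]) (auto simp: add scale bd)
  have sa: "cinner (Y x) y = cinner x (Y y)" for x y
  proof (rule LIMSEQ_unique)
    show "(\<lambda>n. cinner (?Y n x) y) \<longlonglongrightarrow> cinner (Y x) y"
      by (rule bounded_linear.tendsto[OF bounded_linear_cinner_left Y])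
    show "(\<lambda>n. cinner (?Y n x) y) \<longlonglongrightarrow> cinner x (Y y)"
      unfolding dominated_self_adjoint[OF dominated_root_iter X contr]
      by (rule bounded_linear.tendsto[OF bounded_linear_cinner_right Y])
  qed
  have square: "(\<lambda>n. ?Y n (?Y n x)) \<longlonglongrightarrow> Y (Y x)" for x
  proof -
    have "(\<lambda>n. ?Y n (?Y n x) - ?Y n (Y x)) \<longlonglongrightarrow> 0"
    proof (rule Lim_null_comparison)
      show "\<forall>\<^sub>F n in sequentially. norm (?Y n (?Y n x) - ?Y n (Y x)) \<le> norm (?Y n x - Y x)"
        by (simp add: bounded_clinear_diff[OF Ylin, symmetric] Ybd)
      show "(\<lambda>n. norm (?Y n x - Y x)) \<longlonglongrightarrow> 0"
        using tendsto_norm[OF LIM_zero[OF Y]] by simp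
    qed
    from tendsto_add[OF this Y[of "Y x"]] show ?thesis by simp
  qed
  have fix_eq: "Y x = (1/2) *\<^sub>R (X x + Y (Y x))" for x
  proof (rule LIMSEQ_unique)
    show "(\<lambda>n. ?Y (Suc n) x) \<longlonglongrightarrow> Y x"
      using Y by (rule LIMSEQ_Suc)
    show "(\<lambda>n. ?Y (Suc n) x) \<longlonglongrightarrow> (1/2) *\<^sub>R (X x + Y (Y x))"
      unfolding root_iter.simps by (intro tendsto_intros square)
  qed
  show ?thesis
  proof (intro exI conjI allI impI)
    show "positive_op (\<lambda>x. x - Y x)"
      unfolding positive_op_iff self_adjoint_def
    proof (intro conjI allI)
      show "0 \<le> inner (x - Y x) x" for x
        using norm_cauchy_schwarz[of "Y x" x] mult_right_mono[OF bd[of x], of "norm x"]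
        by (simp add: inner_diff_left power2_norm_eq_inner[symmetric] power2_eq_square)
    qed (auto intro: bounded_clinear_intros lin simp: cinner_simps sa)
    show "(x - Y x) - Y (x - Y x) = x - X x" for x
    proof -
      have "2 *\<^sub>R Y x = X x + Y (Y x)"
        using arg_cong[OF fix_eq[of x], of "\<lambda>z. 2 *\<^sub>R z"] by simp
      then show ?thesis
        by (simp add: bounded_clinear_diff[OF lin] scaleR_2 algebra_simps)
    qed
    fix S x assume S: "bounded_clinear S" "\<forall>x. S (X x) = X (S x)"
    have "S (Y x) = Y (S x)"
    proof (rule LIMSEQ_unique)
      show "(\<lambda>n. S (?Y n x)) \<longlonglongrightarrow> S (Y x)"
        by (rule bounded_clinear_tendsto[OF S(1) Y])
      have "S (?Y n x) = ?Y n (S x)" for n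
        using dominated_commute[OF dominated_root_iter S(1)] S(2) by blast
      then show "(\<lambda>n. S (?Y n x)) \<longlonglongrightarrow> Y (S x)"
        using Y by simp
    qed
    then show "S (x - Y x) = S x - Y (S x)"
      by (simp add: bounded_clinear_diff[OF S(1)])
  qed
qed

text \<open>Rescaling by a bound \<open>c\<close> of \<open>P\<close> reduces to \<open>1 - X\<close> with \<open>X = 1 - P / c\<close>.\<close>

lemma positive_sqrt_ex:
  assumes P: "positive_op P"
  shows "\<exists>R. positive_op R \<and> (\<forall>x. R (R x) = P x) \<and>
    (\<forall>S. bounded_clinear S \<longrightarrow> (\<forall>x. S (P x) = P (S x)) \<longrightarrow> (\<forall>x. S (R x) = R (S x)))"
proof -
  have PB: "bounded_clinear P" and sa: "self_adjoint P"
    using P by (auto simp: positive_op_def positive_op_self_adjoint)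
  obtain c where c: "0 < c" "\<And>x. norm (P x) \<le> c * norm x"
    using bounded_clinear_on_bound[OF PB] by auto
  define X where "X x = x - (1/c) *\<^sub>R P x" for x
  have X: "self_adjoint X"
    unfolding X_def self_adjoint_def
    by (auto intro!: bounded_clinear_minus_op bounded_clinear_timesR bounded_clinear_ident PB
        simp: cinner_simps self_adjoint_cinner[OF sa])
  have le: "inner (X x) x \<le> (norm x)\<^sup>2" for x
    using positive_op_inner[OF P, of x] c by (simp add: X_def inner_diff_left power2_norm_eq_inner)
  have "0 \<le> inner (X x) x" for x
  proof -
    have "inner (P x) x \<le> c * norm x * norm x"
      using norm_cauchy_schwarz[of "P x" x] mult_right_mono[OF c(2)[of x], of "norm x"] by simp
    then have "(1/c) * inner (P x) x \<le> norm x * norm x"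
      using c(1) by (simp add: field_simps)
    then show ?thesis
      by (simp add: X_def inner_diff_left power2_norm_eq_inner[symmetric] power2_eq_square)
  qed
  then have contr: "norm (X x) \<le> norm x" for x
    by (intro positive_op_contraction[OF _ le]) (simp add: positive_op_iff X)
  obtain R where R: "positive_op R" "\<And>x. R (R x) = x - X x"
    and comm: "\<And>S x. bounded_clinear S \<Longrightarrow> (\<And>x. S (X x) = X (S x)) \<Longrightarrow> S (R x) = R (S x)"
    using contraction_sqrt_ex[OF X contr] by blast
  have RB: "bounded_clinear R" and Rsa: "self_adjoint R"
    using R(1) by (auto simp: positive_op_def positive_op_self_adjoint)
  show ?thesis
  proof (intro exI conjI allI impI)
    show "positive_op (\<lambda>x. sqrt c *\<^sub>R R x)"
      using c(1) positive_op_inner[OF R(1)]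
      by (auto simp: positive_op_iff self_adjoint_def cinner_simps self_adjoint_cinner[OF Rsa]
          intro: bounded_clinear_timesR RB)
    show "sqrt c *\<^sub>R R (sqrt c *\<^sub>R R x) = P x" for x
      using c(1) by (simp add: bounded_clinear_scaleR[OF RB] R(2) X_def)
    fix S x assume S: "bounded_clinear S" "\<forall>x. S (P x) = P (S x)"
    then have "S (R x) = R (S x)"
      by (intro comm) (auto simp: X_def bounded_clinear_simps)
    then show "S (sqrt c *\<^sub>R R x) = sqrt c *\<^sub>R R (S x)"
      by (simp add: bounded_clinear_scaleR[OF S(1)])
  qed
qed

text \<open>Any positive root \<open>Q\<close> commutes with \<open>P = Q\<^sup>2\<close>, hence with the root \<open>R\<close> just constructed. Then
  \<open>(R + Q) (R - Q) = 0\<close> makes both \<open>R\<close> and \<open>Q\<close> vanish on the range of \<open>R - Q\<close>.\<close>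

lemma sqrt_op_exists_unique:
  assumes P: "positive_op P"
  shows "\<exists>!R. positive_op R \<and> R \<circ> R = P"
proof -
  obtain R where R: "positive_op R" "\<And>x. R (R x) = P x"
    and comm: "\<And>S x. bounded_clinear S \<Longrightarrow> (\<And>x. S (P x) = P (S x)) \<Longrightarrow> S (R x) = R (S x)"
    using positive_sqrt_ex[OF P] by blast
  show ?thesis
  proof (rule ex1I[of _ R])
    show "positive_op R \<and> R \<circ> R = P" using R by auto
    fix Q assume Q: "positive_op Q \<and> Q \<circ> Q = P"
    then have Qsq: "P x = Q (Q x)" for x by auto
    have QB: "bounded_clinear Q" and RB: "bounded_clinear R"
      using Q R by (auto simp: positive_op_def)
    have QR: "Q (R x) = R (Q x)" for x
      by (rule comm[OF QB]) (simp add: Qsq)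
    have "Q x = R x" for x
    proof -
      define y where "y = R x - Q x"
      have "R y + Q y = 0"
        by (simp add: y_def bounded_clinear_diff[OF QB] bounded_clinear_diff[OF RB] QR R(2) Qsq)
      then have "inner (R y) y + inner (Q y) y = 0"
        by (metis inner_add_left inner_zero_left)
      then have "R y = 0" "Q y = 0"
        using positive_op_inner[of R y] positive_op_inner[of Q y] Q R(1) positive_op_kernel
        by (smt (verit))+
      have "inner y y = inner (R x) y - inner (Q x) y"
        by (simp add: y_def inner_diff_left)
      also have "\<dots> = inner x (R y) - inner x (Q y)"
        using Q R(1) by (simp add: self_adjoint_inner positive_op_self_adjoint)
      finally have "y = 0"
        using \<open>R y = 0\<close> \<open>Q y = 0\<close> by simp
      then show ?thesis by (simp add: y_def)
    qed
    then show "Q = R" by auto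
  qed
qed

lemma positive_op_adj_compose:
  assumes T: "bounded_clinear T"
  shows "positive_op (\<lambda>x. adj T (T x))"
  unfolding positive_op_iff self_adjoint_def
proof (intro conjI allI)
  show "cinner (adj T (T x)) y = cinner x (adj T (T y))" for x y
    by (simp add: cinner_adj[OF T, symmetric] cinner_adj'[OF T, symmetric])
  show "0 \<le> inner (adj T (T x)) x" for x
    using cinner_adj'[OF T, of "T x" x, symmetric] by (simp add: Re_cinner[symmetric] cinner_self)
qed (auto intro: bounded_clinear_compose bounded_clinear_adj T)

lemma norm_adj_compose: "bounded_clinear T \<Longrightarrow> inner (adj T (T x)) x = (norm (T x))\<^sup>2"
  using cinner_adj'[of T "T x" x, symmetric] by (simp add: Re_cinner[symmetric] cinner_self)

lemma defect_op_properties: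
  assumes T: "bounded_clinear T" and contr: "\<And>x. norm (T x) \<le> norm x"
  shows "self_adjoint (defect_op T)" and "defect_op T (defect_op T x) = x - adj T (T x)"
proof -
  let ?P = "\<lambda>x. x - adj T (T x)"
  have sa: "self_adjoint (\<lambda>x. adj T (T x))"
    by (rule positive_op_self_adjoint[OF positive_op_adj_compose[OF T]])
  have "positive_op ?P"
    unfolding positive_op_iff self_adjoint_def
  proof (intro conjI allI)
    show "0 \<le> inner (x - adj T (T x)) x" for x
      using power_mono[OF contr[of x], of 2]
      by (simp add: inner_diff_left norm_adj_compose[OF T] power2_norm_eq_inner[symmetric])
  qed (auto intro!: bounded_clinear_minus_op bounded_clinear_ident self_adjoint_bounded[OF sa]
      simp: cinner_simps self_adjoint_cinner[OF sa])
  from theI'[OF sqrt_op_exists_unique[OF this]]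
  have D: "positive_op (defect_op T)" "defect_op T \<circ> defect_op T = ?P"
    by (auto simp: defect_op_def sqrt_op_def)
  then show "self_adjoint (defect_op T)" "defect_op T (defect_op T x) = x - adj T (T x)"
    using positive_op_self_adjoint by (auto simp flip: comp_apply[of "defect_op T" "defect_op T" x])
qed


section \<open>Fuglede's theorem\<close>

lemma normal_op_bounded: "normal_op T \<Longrightarrow> bounded_clinear T"
  by (simp add: normal_op_def)

lemma normal_op_commute: "normal_op T \<Longrightarrow> T (adj T x) = adj T (T x)"
  unfolding normal_op_def by (metis comp_apply)

lemma normal_op_norm_adj:
  assumes "normal_op T"
  shows "norm (adj T x) = norm (T x)"
proof -
  note T = normal_op_bounded[OF assms]
  have "complex_of_real ((norm (adj T x))\<^sup>2) = of_real ((norm (T x))\<^sup>2)"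
    unfolding cinner_self[symmetric]
    by (metis T cinner_adj cinner_adj' normal_op_commute[OF assms])
  then show ?thesis
    by (simp only: of_real_eq_iff) (simp add: power2_eq_iff_nonneg)
qed

lemma adj_shift:
  assumes "bounded_clinear T"
  shows "adj (\<lambda>x. T x - z *\<^sub>C x) = (\<lambda>y. adj T y - cnj z *\<^sub>C y)"
  by (rule ext, rule adj_eqI) (simp add: cinner_simps cinner_adj[OF assms])

lemma normal_op_shift:
  assumes "normal_op T"
  shows "normal_op (\<lambda>x. T x - z *\<^sub>C x)"
proof -
  note T = normal_op_bounded[OF assms] and T' = bounded_clinear_adj[OF normal_op_bounded[OF assms]]
  show ?thesis
    unfolding normal_op_def adj_shift[OF T]
    by (auto simp: bounded_clinear_simps[OF T] bounded_clinear_simps[OF T'] scaleC_scaleC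
        normal_op_commute[OF assms] scaleC_diff_right algebra_simps
        intro!: bounded_clinear_minus_op bounded_clinear_times bounded_clinear_ident T)
qed

lemma normal_op_norm_shift:
  assumes "normal_op T"
  shows "norm (adj T x - cnj z *\<^sub>C x) = norm (T x - z *\<^sub>C x)"
  using normal_op_norm_adj[OF normal_op_shift[OF assms], of z x]
  by (simp add: adj_shift[OF normal_op_bounded[OF assms]])

text \<open>The value and the derivative at \<open>0\<close> are arguments because Cauchy's estimate will concern just these.
  Weak holomorphy is enough for it, and bounded operators preserve it through their adjoints.\<close>

definition weakly_holomorphic ::
    "(complex \<Rightarrow> 'a::complex_hilbert) \<Rightarrow> 'a \<Rightarrow> 'a \<Rightarrow> bool" where
  "weakly_holomorphic F a b \<longleftrightarrow> F 0 = a \<and> (\<forall>y. (\<lambda>z. cinner (F z) y) holomorphic_on UNIV \<and>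
     ((\<lambda>z. cinner (F z) y) has_field_derivative cinner b y) (at 0))"

lemma weakly_holomorphic_const: "weakly_holomorphic (\<lambda>z. a) a 0"
  by (simp add: weakly_holomorphic_def)

lemma weakly_holomorphic_op:
  assumes "weakly_holomorphic F a b" "bounded_clinear M"
  shows "weakly_holomorphic (\<lambda>z. M (F z)) (M a) (M b)"
  using assms(1) by (simp add: weakly_holomorphic_def cinner_adj[OF assms(2)])

lemma weakly_holomorphic_affine:
  assumes F: "weakly_holomorphic F a b" and T: "bounded_clinear T"
  shows "weakly_holomorphic (\<lambda>z. F z + z *\<^sub>C T (F z)) a (b + T a)"
  unfolding weakly_holomorphic_def
proof (intro conjI allI)
  fix y
  have h: "(\<lambda>z. cinner (F z) u) holomorphic_on UNIV"
    and d: "((\<lambda>z. cinner (F z) u) has_field_derivative cinner b u) (at 0)" for u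
    using F by (auto simp: weakly_holomorphic_def)
  have F0: "F 0 = a" using F by (simp add: weakly_holomorphic_def)
  show "(\<lambda>z. cinner (F z + z *\<^sub>C T (F z)) y) holomorphic_on UNIV"
    unfolding cinner_simps cinner_adj[OF T] by (intro holomorphic_intros h)
  have "((\<lambda>z. cinner (F z) y + z * cinner (F z) (adj T y)) has_field_derivative
      cinner b y + (1 * cinner (F 0) (adj T y) + cinner b (adj T y) * 0)) (at 0)"
    by (intro derivative_intros d)
  then show "((\<lambda>z. cinner (F z + z *\<^sub>C T (F z)) y) has_field_derivative cinner (b + T a) y) (at 0)"
    by (simp add: cinner_simps cinner_adj[OF T] F0)
qed (use F in \<open>simp add: weakly_holomorphic_def\<close>)

lemma weakly_holomorphic_funpow:
  assumes F: "weakly_holomorphic F a b" and T: "bounded_clinear T"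
  shows "weakly_holomorphic (\<lambda>z. ((\<lambda>x. x + z *\<^sub>C T x) ^^ n) (F z)) a (b + real n *\<^sub>R T a)"
proof (induction n)
  case (Suc n)
  from weakly_holomorphic_affine[OF Suc T] show ?case
    by (simp add: algebra_simps)
qed (use F in simp)

text \<open>Since \<open>\<parallel>(T - z) w\<parallel> = \<parallel>(T\<^sup>* - cnj z) w\<parallel>\<close> for normal \<open>T\<close>, an operator that commutes with \<open>T\<^sup>*\<close> can be
  pulled out of the norm of a polynomial in \<open>T\<close>.\<close>

lemma normal_funpow_bound:
  fixes T M :: "'a::complex_hilbert \<Rightarrow> 'a"
  assumes T: "normal_op T" and M: "bounded_clinear M" and comm: "\<And>x. adj T (M x) = M (adj T x)"
    and bd: "\<And>x. norm (M x) \<le> c * norm x" and c: "0 \<le> c"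
  shows "norm (((\<lambda>x. x + z *\<^sub>C T x) ^^ n) (M v)) \<le> c * norm (((\<lambda>x. x + z *\<^sub>C T x) ^^ n) v)"
proof -
  note TB = normal_op_bounded[OF T]
  note TB' = bounded_clinear_adj[OF TB]
  let ?A = "\<lambda>x. x + z *\<^sub>C T x" and ?B = "\<lambda>x. x + cnj z *\<^sub>C adj T x"
  have A: "bounded_clinear ?A" and B: "bounded_clinear ?B"
    by (intro bounded_clinear_plus bounded_clinear_ident bounded_clinear_times TB TB')+
  have AB: "?A (?B x) = ?B (?A x)" for x
    by (simp add: bounded_clinear_simps[OF TB] bounded_clinear_simps[OF TB'] scaleC_scaleC
        normal_op_commute[OF T] scaleC_add_right mult.commute algebra_simps)
  have "adj ?A = ?B"
    by (rule ext, rule adj_eqI) (simp add: cinner_simps cinner_adj[OF TB])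
  then have nA: "normal_op ?A"
    unfolding normal_op_def using A AB by (auto simp: fun_eq_iff)
  have eq: "norm (?A x) = norm (?B x)" for x
    using normal_op_norm_adj[OF nA, of x] by (simp add: \<open>adj ?A = ?B\<close>)
  have BM: "?B (M x) = M (?B x)" for x
    by (simp add: bounded_clinear_simps[OF M] comm)
  have swap: "(?B ^^ k) (?A x) = ?A ((?B ^^ k) x)" for k x
    by (induction k) (auto simp only: funpow.simps id_def comp_def AB)
  have pow: "norm ((?A ^^ n) x) = norm ((?B ^^ n) x)" for x
  proof (induction n arbitrary: x)
    case (Suc n)
    have "norm ((?A ^^ Suc n) x) = norm ((?B ^^ n) (?A x))"
      using Suc[of "?A x"] by (simp only: funpow_Suc_right comp_def)
    also have "\<dots> = norm (?B ((?B ^^ n) x))"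
      by (simp only: swap eq)
    finally show ?case by (simp only: funpow.simps comp_def)
  qed simp
  have "(?B ^^ n) (M v) = M ((?B ^^ n) v)"
    by (induction n) (auto simp only: funpow.simps id_def comp_def BM)
  then show ?thesis
    using pow[of "M v"] pow[of v] bd[of "(?B ^^ n) v"] by simp
qed

text \<open>The entire function \<open>z \<mapsto> \<langle>(1 + z T)\<^sup>n M (1 - z T)\<^sup>n x, y\<rangle>\<close> has derivative
  \<open>n \<langle>(T M - M T) x, y\<rangle>\<close> at \<open>0\<close>. By the preceding lemma it is bounded by
  \<open>\<parallel>M\<parallel> \<parallel>(1 - z\<^sup>2 T\<^sup>2)\<^sup>n x\<parallel> \<parallel>y\<parallel>\<close>, hence by a constant on the disc \<open>\<bar>z\<bar> \<le> 1 / (\<parallel>T\<parallel> \<surd>n)\<close>. Cauchy's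
  estimate leaves a commutator of size \<open>O(1 / \<surd>n)\<close>. Polynomials thus take the place
  of the exponentials in the argument from Liouville's theorem.\<close>

theorem Fuglede:
  fixes T M :: "'a::complex_hilbert \<Rightarrow> 'a"
  assumes T: "normal_op T" and M: "bounded_clinear M" and comm: "\<And>x. adj T (M x) = M (adj T x)"
  shows "T (M x) = M (T x)"
proof (rule cinner_ext_left)
  fix y
  note TB = normal_op_bounded[OF T]
  obtain c where c: "0 < c" "\<And>x. norm (M x) \<le> c * norm x"
    using bounded_clinear_on_bound[OF M] by auto
  obtain t where t: "0 < t" "\<And>x. norm (T x) \<le> t * norm x"
    using bounded_clinear_on_bound[OF TB] by auto
  define C where "C = cmod (cinner (T (M x) - M (T x)) y)"
  define K where "K = c * exp 1 * norm x * norm y * t"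
  have main: "C * sqrt n \<le> K" if n: "0 < n" for n :: nat
  proof -
    \<comment> \<open>with this radius \<open>(1 + r\<^sup>2 t\<^sup>2)\<^sup>n \<le> e\<close>\<close>
    define r where "r = 1 / (t * sqrt n)"
    have r: "0 < r" using t n by (simp add: r_def)
    have rt: "(r * t)\<^sup>2 = 1 / n" using t n by (simp add: r_def power_divide)
    let ?A = "\<lambda>z x. x + z *\<^sub>C T x"
    define F where "F z = (?A z ^^ n) (M ((?A (- z) ^^ n) x))" for z
    define f where "f z = cinner (F z) y" for z
    have "weakly_holomorphic (\<lambda>z. (?A z ^^ n) x) x (0 + real n *\<^sub>R T x)"
      by (rule weakly_holomorphic_funpow[OF weakly_holomorphic_const TB])
    have neg: "bounded_clinear (\<lambda>x. - T x)"
      using bounded_clinear_timesR[OF TB, of "-1"] by simp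
    have "weakly_holomorphic (\<lambda>z. ((\<lambda>x. x + z *\<^sub>C (- T x)) ^^ n) x) x (0 + real n *\<^sub>R (- T x))"
      by (rule weakly_holomorphic_funpow[OF weakly_holomorphic_const neg])
    then have "weakly_holomorphic (\<lambda>z. (?A (- z) ^^ n) x) x (- (real n *\<^sub>R T x))"
      by (simp add: scaleC_minus_right scaleC_minus_left)
    from weakly_holomorphic_funpow[OF weakly_holomorphic_op[OF this M] TB, of n]
    have "weakly_holomorphic F (M x) (real n *\<^sub>R (T (M x) - M (T x)))"
      by (simp add: F_def[abs_def] bounded_clinear_simps[OF M] scaleR_diff_right)
    then have hol: "f holomorphic_on UNIV"
      and der: "(f has_field_derivative real n * cinner (T (M x) - M (T x)) y) (at 0)"
      unfolding weakly_holomorphic_def f_def[abs_def] by (auto simp: cinner_scaleR_left)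
    have bound: "cmod (f z) \<le> c * exp 1 * norm x * norm y" if z: "cmod z = r" for z
    proof -
      have "(?A z ^^ n) ((?A (- z) ^^ n) x) = ((\<lambda>x. ?A z (?A (-z) x)) ^^ n) x"
      proof (induction n arbitrary: x)
        case (Suc n)
        have swap: "(?A (- z) ^^ n) (?A z x) = ?A z ((?A (- z) ^^ n) x)" for n x
        proof (induction n)
          case (Suc n)
          then show ?case
            by (simp add: bounded_clinear_simps[OF TB] scaleC_add_right scaleC_scaleC algebra_simps)
        qed simp
        have "(?A z ^^ Suc n) ((?A (- z) ^^ Suc n) x) =
            (?A z ^^ n) (?A z ((?A (- z) ^^ n) (?A (- z) x)))"
          by (simp only: funpow_Suc_right comp_def)
        also have "\<dots> = (?A z ^^ n) ((?A (- z) ^^ n) (?A z (?A (- z) x)))"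
          by (simp only: swap)
        also have "\<dots> = ((\<lambda>x. ?A z (?A (-z) x)) ^^ n) (?A z (?A (- z) x))"
          by (rule Suc)
        finally show ?case by (simp only: funpow_Suc_right comp_def)
      qed simp
      also have "norm (((\<lambda>x. ?A z (?A (-z) x)) ^^ n) x) \<le> (1 + 1 / n) ^ n * norm x"
      proof -
        have step: "norm (?A z (?A (-z) x)) \<le> (1 + 1 / n) * norm x" for x
        proof -
          have "?A z (?A (-z) x) = x - (z * z) *\<^sub>C T (T x)"
            by (simp add: bounded_clinear_simps[OF TB] scaleC_add_right scaleC_diff_right
                scaleC_scaleC scaleC_minus_left)
          then have "norm (?A z (?A (-z) x)) \<le> norm x + norm ((z * z) *\<^sub>C T (T x))"
            using norm_triangle_ineq4[of x "(z * z) *\<^sub>C T (T x)"] by metis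
          also have "norm ((z * z) *\<^sub>C T (T x)) = r * r * norm (T (T x))"
            by (simp add: norm_scaleC norm_mult z)
          also have "norm x + \<dots> \<le> norm x + r * r * (t * (t * norm x))"
            using t order.trans[OF t(2)[of "T x"] mult_left_mono[OF t(2)[of x], of t]] r
            by (intro add_left_mono mult_left_mono) auto
          also have "\<dots> = (1 + (r * t)\<^sup>2) * norm x"
            by (simp add: power2_eq_square algebra_simps)
          finally show ?thesis by (simp add: rt)
        qed
        have "norm (((\<lambda>x. ?A z (?A (-z) x)) ^^ k) x) \<le> (1 + 1 / n) ^ k * norm x" for k
        proof (induction k)
          case (Suc k)
          have "norm (((\<lambda>x. ?A z (?A (-z) x)) ^^ Suc k) x)
              \<le> (1 + 1 / n) * norm (((\<lambda>x. ?A z (?A (-z) x)) ^^ k) x)"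
            unfolding funpow.simps comp_def by (rule step)
          also have "\<dots> \<le> (1 + 1 / n) * ((1 + 1 / n) ^ k * norm x)"
            by (rule mult_left_mono[OF Suc]) simp
          finally show ?case by (simp add: mult.assoc)
        qed simp
        then show ?thesis .
      qed
      also have "(1 + 1 / n) ^ n \<le> exp (1 / real n) ^ n"
        by (rule power_mono) (auto simp: exp_ge_add_one_self)
      also have "exp (1 / real n) ^ n = exp 1"
        using n by (simp add: exp_of_nat_mult[symmetric])
      finally have "norm ((?A z ^^ n) ((?A (- z) ^^ n) x)) \<le> exp 1 * norm x"
        by (simp add: mult_right_mono)
      then have "norm (F z) \<le> c * (exp 1 * norm x)"
        using normal_funpow_bound[OF T M comm c(2), of n z "(?A (- z) ^^ n) x"] c(1)
        unfolding F_def by (meson less_imp_le mult_left_mono order.trans)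
      then show ?thesis
        using norm_cinner_le[of "F z" y] mult_right_mono[of "norm (F z)" _ "norm y"]
        unfolding f_def by (smt (verit) mult.assoc norm_ge_zero)
    qed
    have "cmod ((deriv ^^ 1) f 0) \<le> fact 1 * (c * exp 1 * norm x * norm y) / r ^ 1"
      by (rule Cauchy_inequality)
        (use hol r bound in \<open>auto intro: holomorphic_on_subset holomorphic_on_imp_continuous_on\<close>)
    then have "n * C \<le> c * exp 1 * norm x * norm y / r"
      using DERIV_imp_deriv[OF der] by (simp add: C_def norm_mult)
    also have "\<dots> = K * sqrt n"
      using t n by (simp add: r_def K_def)
    finally have "(C * sqrt n) * sqrt n \<le> K * sqrt n"
      by (simp add: mult.assoc mult.commute[of _ C])
    then show ?thesis using n by simp
  qed
  have "C = 0"
  proof (rule ccontr)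
    assume "C \<noteq> 0"
    then have C: "0 < C" by (simp add: C_def)
    obtain n :: nat where n: "(K / C)\<^sup>2 < n" using reals_Archimedean2 by blast
    then have "0 < n" by (metis less_le_trans not_gr_zero of_nat_0 zero_le_power2 less_irrefl)
    have "K / C < sqrt n"
      by (rule real_less_rsqrt[OF n])
    then have "K < C * sqrt n" using C by (simp add: field_simps)
    with main[OF \<open>0 < n\<close>] show False by simp
  qed
  then show "cinner (T (M x)) y = cinner (M (T x)) y"
    by (simp add: C_def cinner_diff_left)
qed

corollary normal_ops_doubly_commute:
  assumes S: "normal_op S" and T: "normal_op T" and comm: "\<And>x. S (T x) = T (S x)"
  shows "adj S (T x) = T (adj S x)"
proof -
  note B = normal_op_bounded[OF S] normal_op_bounded[OF T]
  have nS: "normal_op (adj S)"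
    unfolding normal_op_def adj_adj[OF B(1)]
    using bounded_clinear_adj[OF B(1)] by (auto simp: normal_op_commute[OF S])
  show ?thesis
    by (rule Fuglede[OF nS B(2)]) (simp add: adj_adj[OF B(1)] comm)
qed


section \<open>Joint approximate eigenvectors\<close>

text \<open>On the vectors that \<open>q\<close> makes small, \<open>m\<close> is the asymptotic maximum of the quadratic form of
  \<open>T\<close>. A nearly maximising \<open>x\<close> is an approximate eigenvector: otherwise, moving from \<open>x\<close> in the
  direction \<open>T x - m x\<close>, which \<open>q\<close> again makes small, would increase the form beyond \<open>m\<close>. Letting
  \<open>q\<close> measure the defects of operators treated before yields joint approximate eigenvectors.\<close>

lemma self_adjoint_approximate_eigenvector:
  fixes T :: "'a::complex_hilbert \<Rightarrow> 'a"
  assumes T: "self_adjoint T"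
    and q_add: "\<And>x y. q (x + y) \<le> q x + q y"
    and q_scale: "\<And>r x. q (r *\<^sub>R x) = \<bar>r\<bar> * q x"
    and q_inv: "\<And>x. q (T x) \<le> C * q x"
    and deg: "\<And>\<epsilon>. 0 < \<epsilon> \<Longrightarrow> \<exists>x. norm x = 1 \<and> q x < \<epsilon>"
  shows "\<exists>m. (\<forall>\<epsilon>>0. \<exists>x. norm x = 1 \<and> q x < \<epsilon> \<and> norm (T x - m *\<^sub>R x) < \<epsilon>) \<and>
    (\<forall>x. norm x = 1 \<longrightarrow> q x = 0 \<longrightarrow> inner (T x) x \<le> m)"
proof -
  note TB = self_adjoint_bounded[OF T]
  have q_zero: "q 0 = 0" using q_scale[of 0 0] by simp
  have q_nonneg: "0 \<le> q x" for x
    using q_add[of x "(-1) *\<^sub>R x"] q_scale[of "-1" x] q_zero by simp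
  obtain b where b: "0 < b" "\<And>x. norm (T x) \<le> b * norm x"
    using bounded_clinear_on_bound[OF TB] by auto
  have form: "\<bar>inner (T x) x\<bar> \<le> b" if "norm x = 1" for x
    using Cauchy_Schwarz_ineq2[of "T x" x] b(2)[of x] that by simp
  define V where "V \<epsilon> = {inner (T x) x | x. norm x = 1 \<and> q x < \<epsilon>}" for \<epsilon>
  define \<Phi> where "\<Phi> \<epsilon> = Sup (V \<epsilon>)" for \<epsilon> :: real
  define m where "m = Inf (\<Phi> ` {0<..})"
  have V_bdd: "bdd_above (V \<epsilon>)" for \<epsilon>
    using form by (intro bdd_aboveI[of _ b]) (auto simp: V_def abs_le_iff)
  have V_le: "inner (T x) x \<le> \<Phi> \<epsilon>" if "norm x = 1" "q x < \<epsilon>" for x \<epsilon>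
    unfolding \<Phi>_def using that V_bdd by (intro cSup_upper) (auto simp: V_def)
  have \<Phi>_low: "- b \<le> \<Phi> \<epsilon>" if "0 < \<epsilon>" for \<epsilon>
    using deg[OF that] V_le form by (force simp: abs_le_iff)
  have bdd: "bdd_below (\<Phi> ` {0<..})"
    using \<Phi>_low by (intro bdd_belowI[of _ "- b"]) auto
  have m_le: "m \<le> \<Phi> \<epsilon>" if "0 < \<epsilon>" for \<epsilon>
    unfolding m_def using that bdd by (intro cInf_lower) auto
  define B where "B = \<bar>m\<bar> + b"
  have B: "0 < B" using b by (simp add: B_def)
  have approx: "\<exists>x. norm x = 1 \<and> q x < \<epsilon> \<and> norm (T x - m *\<^sub>R x) < \<epsilon>" if \<epsilon>: "0 < \<epsilon>" for \<epsilon>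
  proof -
    \<comment> \<open>the step \<open>t\<close> is so small that the gain \<open>2 t \<parallel>y\<parallel>\<^sup>2\<close> dominates the term quadratic in \<open>t\<close>; the
      precisions \<open>\<eta>\<close> and \<open>\<delta>\<close> of the maximisation and of \<open>q\<close> are adapted to \<open>t\<close>\<close>
    define t where "t = min (1 / (2 * B)) (\<epsilon>\<^sup>2 / (2 * B ^ 3))"
    have t: "0 < t" "t * B \<le> 1 / 2" "t * B ^ 3 \<le> \<epsilon>\<^sup>2 / 2"
    proof -
      show "0 < t" using B \<epsilon> by (simp add: t_def)
      have "t \<le> 1 / (2 * B)" "t \<le> \<epsilon>\<^sup>2 / (2 * B ^ 3)" by (auto simp: t_def)
      then show "t * B \<le> 1 / 2" "t * B ^ 3 \<le> \<epsilon>\<^sup>2 / 2"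
        using B by (auto simp: field_simps)
    qed
    define \<eta> where "\<eta> = t * \<epsilon>\<^sup>2 / 4"
    have \<eta>: "0 < \<eta>" using t \<epsilon> by (simp add: \<eta>_def)
    have "\<exists>y\<in>\<Phi> ` {0<..}. y < m + \<eta>"
      using cInf_less_iff[OF _ bdd, of "m + \<eta>"] \<eta> by (auto simp: m_def)
    then obtain \<epsilon>0 where \<epsilon>0: "0 < \<epsilon>0" "\<Phi> \<epsilon>0 < m + \<eta>" by auto
    define L where "L = 1 + t * (\<bar>m\<bar> + \<bar>C\<bar>)"
    have L: "0 < L" using t by (simp add: L_def add_pos_nonneg)
    define \<delta> where "\<delta> = min \<epsilon> (\<epsilon>0 / (2 * L))"
    have \<delta>: "0 < \<delta>" "\<delta> \<le> \<epsilon>" "L * \<delta> \<le> \<epsilon>0 / 2"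
    proof -
      have "\<delta> \<le> \<epsilon>0 / (2 * L)" by (simp add: \<delta>_def)
      then show "L * \<delta> \<le> \<epsilon>0 / 2" using L by (simp add: field_simps)
    qed (use \<epsilon> \<epsilon>0 L in \<open>auto simp: \<delta>_def\<close>)
    have "\<exists>y\<in>V \<delta>. m - \<eta> < y"
    proof -
      have "V \<delta> \<noteq> {}" using deg[OF \<delta>(1)] by (auto simp: V_def)
      moreover have "m - \<eta> < Sup (V \<delta>)" using m_le[OF \<delta>(1)] \<eta> by (simp add: \<Phi>_def)
      ultimately show ?thesis using less_cSup_iff[OF _ V_bdd] by blast
    qed
    then obtain x where x: "norm x = 1" "q x < \<delta>" "m - \<eta> < inner (T x) x"
      by (auto simp: V_def)
    define y where "y = m *\<^sub>R x - T x"
    define \<phi> where "\<phi> v = m * inner v v - inner (T v) v" for v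
    define v where "v = x - t *\<^sub>R y"
    have y_le: "norm y \<le> B"
      using norm_triangle_ineq4[of "m *\<^sub>R x" "T x"] b(2)[of x] x(1) by (simp add: y_def B_def)
    have v_norm: "1 / 2 \<le> norm v" "norm v \<le> 3 / 2"
    proof -
      have "norm (t *\<^sub>R y) \<le> 1 / 2"
        using order_trans[OF mult_left_mono[OF y_le, of t] t(2)] t(1) by simp
      then show "1 / 2 \<le> norm v" "norm v \<le> 3 / 2"
        using norm_triangle_ineq4[of x "t *\<^sub>R y"] norm_triangle_ineq2[of x "t *\<^sub>R y"] x(1)
        unfolding v_def by linarith+
    qed
    have q_v: "q v < \<epsilon>0 / 2"
    proof -
      have "q y \<le> \<bar>m\<bar> * q x + q (T x)"
        using q_add[of "m *\<^sub>R x" "(-1) *\<^sub>R T x"] q_scale[of m x] q_scale[of "-1" "T x"]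
        by (simp add: y_def)
      also have "q (T x) \<le> \<bar>C\<bar> * q x"
        using q_inv[of x] mult_right_mono[OF abs_ge_self[of C] q_nonneg[of x]] by linarith
      finally have "q y \<le> (\<bar>m\<bar> + \<bar>C\<bar>) * q x" by (simp add: algebra_simps)
      then have "t * q y \<le> t * ((\<bar>m\<bar> + \<bar>C\<bar>) * q x)"
        using t by (intro mult_left_mono) auto
      moreover have "q v \<le> q x + t * q y"
        using q_add[of x "(- t) *\<^sub>R y"] q_scale[of "- t" y] t by (simp add: v_def)
      ultimately have "q v \<le> L * q x" by (simp add: L_def algebra_simps)
      also have "\<dots> < L * \<delta>" using x(2) L by simp
      finally show ?thesis using \<delta>(3) by simp
    qed
    have low: "- \<eta> * (norm v)\<^sup>2 \<le> \<phi> v"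
    proof -
      define u where "u = (1 / norm v) *\<^sub>R v"
      have "v \<noteq> 0" using v_norm(1) by auto
      then have "norm u = 1" by (simp add: u_def)
      moreover have "q u < \<epsilon>0"
      proof -
        have "q u = q v / norm v" using q_scale[of "1 / norm v" v] by (simp add: u_def)
        also have "\<dots> < \<epsilon>0"
        proof -
          have "\<epsilon>0 / 2 \<le> \<epsilon>0 * norm v"
            using mult_left_mono[OF v_norm(1), of \<epsilon>0] \<epsilon>0(1) by simp
          then show ?thesis
            using q_v \<open>v \<noteq> 0\<close> by (simp add: pos_divide_less_eq)
        qed
        finally show ?thesis .
      qed
      ultimately have "inner (T u) u \<le> m + \<eta>"
        using V_le[of u \<epsilon>0] \<epsilon>0(2) by simp
      moreover have "inner (T u) u = inner (T v) v / (norm v)\<^sup>2"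
        by (simp add: u_def bounded_clinear_scaleR[OF TB] power2_eq_square)
      ultimately have "inner (T v) v \<le> (m + \<eta>) * (norm v)\<^sup>2"
        using \<open>v \<noteq> 0\<close> by (simp add: pos_divide_le_eq)
      then show ?thesis by (simp add: \<phi>_def power2_norm_eq_inner algebra_simps)
    qed
    have expand: "\<phi> v = \<phi> x - 2 * t * (norm y)\<^sup>2 + t\<^sup>2 * \<phi> y"
      using self_adjoint_inner[OF T, of y x]
      unfolding \<phi>_def v_def power2_norm_eq_inner
      by (simp add: bounded_clinear_simps[OF TB] inner_diff inner_commute y_def
          algebra_simps power2_eq_square)
    have \<phi>_y: "\<phi> y \<le> B ^ 3"
    proof -
      have "\<phi> y \<le> \<bar>m\<bar> * (norm y)\<^sup>2 + norm (T y) * norm y"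
        unfolding \<phi>_def power2_norm_eq_inner
        using norm_cauchy_schwarz[of "- T y" y] mult_right_mono[OF abs_ge_self[of m], of "inner y y"]
        by simp
      also have "norm (T y) * norm y \<le> b * norm y * norm y"
        using b(2)[of y] by (intro mult_right_mono) auto
      finally have "\<phi> y \<le> B * (norm y)\<^sup>2" by (simp add: B_def power2_eq_square algebra_simps)
      also have "\<dots> \<le> B * B\<^sup>2" using y_le B by (intro mult_left_mono power_mono) auto
      finally show ?thesis by (simp add: power3_eq_cube power2_eq_square)
    qed
    have \<phi>_x: "\<phi> x < \<eta>"
      using x(1,3) by (simp add: \<phi>_def power2_norm_eq_inner[symmetric])
    have "\<eta> * (norm v)\<^sup>2 \<le> \<eta> * (3 / 2)\<^sup>2"
      using v_norm \<eta> by (intro mult_left_mono power_mono) auto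
    moreover have "t\<^sup>2 * \<phi> y \<le> t\<^sup>2 * B ^ 3"
      using \<phi>_y by (rule mult_left_mono) simp
    moreover have "t\<^sup>2 * B ^ 3 \<le> t * (\<epsilon>\<^sup>2 / 2)"
      using mult_left_mono[OF t(3), of t] t(1) by (simp add: power2_eq_square mult_ac)
    moreover have "\<eta> * (3 / 2)\<^sup>2 = 9 / 4 * \<eta>" "t * (\<epsilon>\<^sup>2 / 2) = 2 * \<eta>" "t * (3 / 2 * \<epsilon>\<^sup>2) = 6 * \<eta>"
      "(- \<eta>) * (norm v)\<^sup>2 = - (\<eta> * (norm v)\<^sup>2)" "t * (2 * (norm y)\<^sup>2) = 2 * t * (norm y)\<^sup>2"
      by (simp_all add: \<eta>_def power2_eq_square)
    ultimately have "t * (2 * (norm y)\<^sup>2) < t * (3 / 2 * \<epsilon>\<^sup>2)"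
      using low expand \<phi>_x \<eta> by linarith
    then have "2 * (norm y)\<^sup>2 < 3 / 2 * \<epsilon>\<^sup>2" using t(1) by (simp only: mult_less_cancel_left_pos)
    then have "(norm y)\<^sup>2 < \<epsilon>\<^sup>2" using zero_le_power2[of \<epsilon>] by linarith
    then have "norm y < \<epsilon>" by (rule power2_less_imp_less) (use \<epsilon> in simp)
    then have "norm (T x - m *\<^sub>R x) < \<epsilon>" by (simp add: y_def norm_minus_commute)
    then show ?thesis using x \<delta>(2) by (intro exI[of _ x]) auto
  qed
  have "inner (T x) x \<le> m" if "norm x = 1" "q x = 0" for x
    unfolding m_def using V_le that by (intro cInf_greatest) auto
  then show ?thesis using approx by blast
qed

text \<open>One operator at a time: once \<open>m\<close> is found for \<open>T\<^sub>i\<close>, the seminorm \<open>\<parallel>T\<^sub>i x - m x\<parallel>\<close> is added to \<open>q\<close>.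
  Commutation keeps the new seminorm compatible with the remaining operators.\<close>

lemma self_adjoint_family_approximate_eigenvector:
  fixes T :: "'j \<Rightarrow> 'a::complex_hilbert \<Rightarrow> 'a"
  assumes "finite I"
    and T: "\<And>i. i \<in> I \<Longrightarrow> self_adjoint (T i)"
    and comm: "\<And>i j x. i \<in> I \<Longrightarrow> j \<in> I \<Longrightarrow> T i (T j x) = T j (T i x)"
    and "\<And>x y. q (x + y) \<le> q x + q y"
    and "\<And>r x. q (r *\<^sub>R x) = \<bar>r\<bar> * q x"
    and "\<And>i. i \<in> I \<Longrightarrow> \<exists>C. \<forall>x. q (T i x) \<le> C * q x"
    and "\<And>\<epsilon>. 0 < \<epsilon> \<Longrightarrow> \<exists>x. norm x = 1 \<and> q x < \<epsilon>"
  shows "\<exists>t. \<forall>\<epsilon>>0. \<exists>x. norm x = 1 \<and> q x < \<epsilon> \<and> (\<forall>i\<in>I. norm (T i x - t i *\<^sub>R x) < \<epsilon>)"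
  using assms
proof (induction I arbitrary: q rule: finite_induct)
  case (insert i I)
  note Ti = insert.prems(1)[of i, simplified] and q_add = insert.prems(3) and q_scale = insert.prems(4)
  obtain C where C: "\<And>x. q (T i x) \<le> C * q x" using insert.prems(5)[of i] by auto
  obtain m where m: "\<And>\<epsilon>. 0 < \<epsilon> \<Longrightarrow> \<exists>x. norm x = 1 \<and> q x < \<epsilon> \<and> norm (T i x - m *\<^sub>R x) < \<epsilon>"
    using self_adjoint_approximate_eigenvector[of "T i" q C, OF Ti q_add q_scale C insert.prems(6)]
    by blast
  define q' where "q' x = q x + norm (T i x - m *\<^sub>R x)" for x
  have "\<exists>t. \<forall>\<epsilon>>0. \<exists>x. norm x = 1 \<and> q' x < \<epsilon> \<and> (\<forall>i\<in>I. norm (T i x - t i *\<^sub>R x) < \<epsilon>)"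
  proof (rule insert.IH[of q'])
    show "q' (x + y) \<le> q' x + q' y" for x y
      using q_add[of x y] norm_triangle_ineq[of "T i x - m *\<^sub>R x" "T i y - m *\<^sub>R y"]
      by (simp add: q'_def bounded_clinear_add[OF self_adjoint_bounded[OF Ti]] algebra_simps)
    show "q' (r *\<^sub>R x) = \<bar>r\<bar> * q' x" for r x
    proof -
      have "T i (r *\<^sub>R x) - m *\<^sub>R (r *\<^sub>R x) = r *\<^sub>R (T i x - m *\<^sub>R x)"
        by (simp add: bounded_clinear_scaleR[OF self_adjoint_bounded[OF Ti]] algebra_simps)
      then show ?thesis
        by (simp add: q'_def q_scale distrib_left)
    qed
    show "\<exists>C. \<forall>x. q' (T j x) \<le> C * q' x" if j: "j \<in> I" for j
    proof -
      have jB: "bounded_clinear (T j)" using insert.prems(1)[of j] j by (simp add: self_adjoint_bounded)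
      obtain D where D: "\<And>x. q (T j x) \<le> D * q x" using insert.prems(5)[of j] j by auto
      obtain b where b: "0 < b" "\<And>x. norm (T j x) \<le> b * norm x"
        using bounded_clinear_on_bound[OF jB] by auto
      have q_nonneg: "0 \<le> q x" for x
        using q_add[of x "(-1) *\<^sub>R x"] q_scale[of "-1" x] q_scale[of 0 0] by simp
      have "q' (T j x) \<le> (\<bar>D\<bar> + b) * q' x" for x
      proof -
        have "T i (T j x) - m *\<^sub>R T j x = T j (T i x - m *\<^sub>R x)"
          using insert.prems(2)[of i j x] j by (simp add: bounded_clinear_simps[OF jB])
        then have "norm (T i (T j x) - m *\<^sub>R T j x) \<le> b * norm (T i x - m *\<^sub>R x)"
          using b(2) by simp
        moreover have "q (T j x) \<le> \<bar>D\<bar> * q x"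
          using D[of x] mult_right_mono[OF abs_ge_self[of D] q_nonneg[of x]] by linarith
        moreover have "0 \<le> b * q x"
          using b(1) q_nonneg by simp
        moreover have "0 \<le> \<bar>D\<bar> * norm (T i x - m *\<^sub>R x)"
          by simp
        ultimately show ?thesis unfolding q'_def distrib_left distrib_right by linarith
      qed
      then show ?thesis by blast
    qed
    fix \<epsilon> :: real assume "0 < \<epsilon>"
    then have "0 < \<epsilon> / 2" by simp
    from m[OF this] show "\<exists>x. norm x = 1 \<and> q' x < \<epsilon>"
      unfolding q'_def by (metis add_strict_mono field_sum_of_halves)
  qed (use insert.prems in auto)
  then obtain t where t: "\<And>\<epsilon>. 0 < \<epsilon> \<Longrightarrow>
      \<exists>x. norm x = 1 \<and> q' x < \<epsilon> \<and> (\<forall>i\<in>I. norm (T i x - t i *\<^sub>R x) < \<epsilon>)"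
    by blast
  have q_nonneg: "0 \<le> q x" for x
    using q_add[of x "(-1) *\<^sub>R x"] q_scale[of "-1" x] q_scale[of 0 0] by simp
  show ?case
  proof (rule exI[of _ "t(i := m)"], intro allI impI)
    fix \<epsilon> :: real assume "0 < \<epsilon>"
    then obtain x where x: "norm x = 1" "q' x < \<epsilon>" "\<forall>i\<in>I. norm (T i x - t i *\<^sub>R x) < \<epsilon>"
      using t by blast
    have "q x < \<epsilon>" "norm (T i x - m *\<^sub>R x) < \<epsilon>"
      using x(2) q_nonneg[of x] norm_ge_zero[of "T i x - m *\<^sub>R x"] unfolding q'_def by linarith+
    then show "\<exists>x. norm x = 1 \<and> q x < \<epsilon> \<and> (\<forall>j\<in>insert i I. norm (T j x - (t(i := m)) j *\<^sub>R x) < \<epsilon>)"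
      using x insert.hyps by (intro exI[of _ x]) auto
  qed
next
  case empty
  then show ?case by auto
qed

lemma cartesian_decomposition:
  fixes N :: "'a::complex_hilbert \<Rightarrow> 'a"
  assumes N: "bounded_clinear N"
  defines "A \<equiv> \<lambda>x. (1/2) *\<^sub>C (N x + adj N x)" and "B \<equiv> \<lambda>x. (- \<i> / 2) *\<^sub>C (N x - adj N x)"
  shows "self_adjoint A" "self_adjoint B" "N x = A x + \<i> *\<^sub>C B x"
proof -
  note N' = bounded_clinear_adj[OF N]
  have "bounded_clinear A" "bounded_clinear B"
    unfolding A_def B_def
    by (intro bounded_clinear_times bounded_clinear_plus bounded_clinear_minus_op N N')+
  moreover have "cinner (A x) y = cinner x (A y)" "cinner (B x) y = cinner x (B y)" for x y
    using cinner_adj[OF N, of x y] cinner_adj'[OF N, of x y]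
    by (simp_all add: A_def B_def cinner_simps) (metis minus_diff_eq mult_minus_right)
  ultimately show "self_adjoint A" "self_adjoint B"
    by (auto simp: self_adjoint_def)
  have "\<i> *\<^sub>C B x = (1/2) *\<^sub>C (N x - adj N x)"
    by (simp add: B_def scaleC_scaleC)
  then have "A x + \<i> *\<^sub>C B x = (1/2 + 1/2) *\<^sub>C N x"
    by (simp only: A_def scaleC_add_left) (simp add: scaleC_add_right scaleC_diff_right)
  then show "N x = A x + \<i> *\<^sub>C B x" by simp
qed

text \<open>The family consists of the real and imaginary parts of the \<open>N\<^sub>i\<close>, which commute by Fuglede's
  theorem; \<open>T\<close> is treated first so that its approximate eigenvalue is the top of its numerical range.\<close>

lemma normal_family_approximate_eigenvector:
  fixes N :: "'i::finite \<Rightarrow> 'a::complex_hilbert \<Rightarrow> 'a"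
  assumes N: "\<And>i. normal_op (N i)" and comm: "\<And>i j x. N i (N j x) = N j (N i x)"
    and T: "self_adjoint T" and TN: "\<And>i x. T (N i x) = N i (T x)"
    and y: "norm y = 1"
  shows "\<exists>m z. inner (T y) y \<le> m \<and> (\<forall>\<epsilon>>0. \<exists>x. norm x = 1 \<and> norm (T x - m *\<^sub>R x) < \<epsilon> \<and>
    (\<forall>i. norm (N i x - z i *\<^sub>C x) < \<epsilon>))"
proof -
  note TB = self_adjoint_bounded[OF T]
  note NB = normal_op_bounded[OF N]
  note NB' = bounded_clinear_adj[OF NB]
  have dc: "adj (N i) (N j x) = N j (adj (N i) x)" for i j x
    by (rule normal_ops_doubly_commute) (rule N comm)+
  have dc': "adj (N i) (adj (N j) x) = adj (N j) (adj (N i) x)" for i j x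
    using arg_cong[of _ _ "\<lambda>T. adj T x", OF ext[of "\<lambda>x. N i (N j x)" "\<lambda>x. N j (N i x)", OF comm]]
    by (simp add: adj_compose[OF NB NB])
  have "adj T = T" by (rule ext, rule adj_eqI) (simp add: self_adjoint_cinner[OF T])
  then have TN': "T (adj (N i) x) = adj (N i) (T x)" for i x
    using arg_cong[of _ _ "\<lambda>T. adj T x", OF ext[of "\<lambda>x. T (N i x)" "\<lambda>x. N i (T x)", OF TN]]
    by (simp add: adj_compose[OF NB TB] adj_compose[OF TB NB])
  obtain m where m: "\<And>\<epsilon>. 0 < \<epsilon> \<Longrightarrow> \<exists>x. norm x = 1 \<and> norm (T x - m *\<^sub>R x) < \<epsilon>"
    and m_ge: "inner (T y) y \<le> m"
    using self_adjoint_approximate_eigenvector[of T "\<lambda>x. 0" 0, OF T] y by auto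
  define A where "A = (\<lambda>(i, b) x. if b then (1/2) *\<^sub>C (N i x + adj (N i) x)
    else (- \<i> / 2) *\<^sub>C (N i x - adj (N i) x))"
  define \<alpha> where "\<alpha> b = (if b then 1/2 else - \<i> / 2)" for b
  define \<beta> where "\<beta> b = (if b then 1/2 else \<i> / 2)" for b
  have A_eq: "A (i, b) x = \<alpha> b *\<^sub>C N i x + \<beta> b *\<^sub>C adj (N i) x" for i b x
    by (simp add: A_def \<alpha>_def \<beta>_def scaleC_add_right scaleC_diff_right
        scaleC_minus_left[symmetric])
  define q where "q x = norm (T x - m *\<^sub>R x)" for x
  have A: "self_adjoint (A k)" for k
  proof -
    obtain i b where k: "k = (i, b)" by (cases k)
    show ?thesis
      using cartesian_decomposition(1,2)[OF NB, of i] unfolding k by (cases b) (simp_all add: A_def)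
  qed
  have AT: "T (A k x) = A k (T x)" for k x
    by (cases k) (simp add: A_eq bounded_clinear_add[OF TB] bounded_clinear_scaleC[OF TB] TN TN')
  have "\<exists>t. \<forall>\<epsilon>>0. \<exists>x. norm x = 1 \<and> q x < \<epsilon> \<and> (\<forall>k\<in>UNIV. norm (A k x - t k *\<^sub>R x) < \<epsilon>)"
  proof (rule self_adjoint_family_approximate_eigenvector)
    show "A k (A l x) = A l (A k x)" for k l x
    proof -
      obtain i b where k: "k = (i, b)" by (cases k)
      obtain j d where l: "l = (j, d)" by (cases l)
      show ?thesis
        unfolding k l A_eq bounded_clinear_add[OF NB] bounded_clinear_add[OF NB']
          bounded_clinear_scaleC[OF NB] bounded_clinear_scaleC[OF NB'] scaleC_add_right scaleC_scaleC
          dc comm[of i j] dc'[of i j]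
        by (simp only: add_ac mult.commute)
    qed
    show "q (x + y) \<le> q x + q y" for x y
      using norm_triangle_ineq[of "T x - m *\<^sub>R x" "T y - m *\<^sub>R y"]
      by (simp add: q_def bounded_clinear_add[OF TB] algebra_simps)
    show "q (r *\<^sub>R x) = \<bar>r\<bar> * q x" for r x
    proof -
      have "T (r *\<^sub>R x) - m *\<^sub>R (r *\<^sub>R x) = r *\<^sub>R (T x - m *\<^sub>R x)"
        by (simp add: bounded_clinear_scaleR[OF TB] algebra_simps)
      then show ?thesis by (simp add: q_def)
    qed
    show "\<exists>C. \<forall>x. q (A k x) \<le> C * q x" for k
    proof -
      obtain b where "0 < b" "\<And>x. norm (A k x) \<le> b * norm x"
        using bounded_clinear_on_bound[OF self_adjoint_bounded[OF A[of k]]] by auto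
      moreover have "T (A k x) - m *\<^sub>R A k x = A k (T x - m *\<^sub>R x)" for x
        by (simp add: AT bounded_clinear_simps[OF self_adjoint_bounded[OF A]])
      ultimately have "q (A k x) \<le> b * q x" for x by (simp add: q_def)
      then show ?thesis by blast
    qed
    show "\<exists>x. norm x = 1 \<and> q x < \<epsilon>" if "0 < \<epsilon>" for \<epsilon>
      using m[OF that] by (simp add: q_def)
  qed (auto simp: A)
  then obtain t where t: "\<And>\<epsilon>. 0 < \<epsilon> \<Longrightarrow>
      \<exists>x. norm x = 1 \<and> q x < \<epsilon> \<and> (\<forall>k. norm (A k x - t k *\<^sub>R x) < \<epsilon>)"
    by auto
  define z where "z i = Complex (t (i, True)) (t (i, False))" for i
  have "\<exists>x. norm x = 1 \<and> norm (T x - m *\<^sub>R x) < \<epsilon> \<and> (\<forall>i. norm (N i x - z i *\<^sub>C x) < \<epsilon>)"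
    if "0 < \<epsilon>" for \<epsilon>
  proof -
    have "0 < \<epsilon> / 2" using that by simp
    then obtain x where x: "norm x = 1" "q x < \<epsilon> / 2" "\<And>k. norm (A k x - t k *\<^sub>R x) < \<epsilon> / 2"
      using t by blast
    have "norm (N i x - z i *\<^sub>C x) < \<epsilon>" for i
    proof -
      have "N i x = A (i, True) x + \<i> *\<^sub>C A (i, False) x"
        using cartesian_decomposition(3)[OF NB, of i x] by (simp add: A_def)
      moreover have "z i *\<^sub>C x = t (i, True) *\<^sub>R x + \<i> *\<^sub>C (t (i, False) *\<^sub>R x)"
        by (simp add: z_def Complex_eq scaleC_add_left scaleC_of_real[symmetric] scaleC_scaleC)
      ultimately have "N i x - z i *\<^sub>C x = (A (i, True) x - t (i, True) *\<^sub>R x)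
          + \<i> *\<^sub>C (A (i, False) x - t (i, False) *\<^sub>R x)"
        by (simp add: scaleC_diff_right)
      then have "norm (N i x - z i *\<^sub>C x) \<le> norm (A (i, True) x - t (i, True) *\<^sub>R x)
          + norm (A (i, False) x - t (i, False) *\<^sub>R x)"
        using norm_triangle_ineq[of "A (i, True) x - t (i, True) *\<^sub>R x"
            "\<i> *\<^sub>C (A (i, False) x - t (i, False) *\<^sub>R x)"]
        by (simp add: norm_scaleC)
      then show ?thesis using x(3)[of "(i, True)"] x(3)[of "(i, False)"] by linarith
    qed
    then show ?thesis using x(1,2) that by (intro exI[of _ x]) (auto simp: q_def)
  qed
  then show ?thesis using m_ge by blast
qed


section \<open>The Koszul complex\<close>

definition jointly_bounded_below :: "'i set \<Rightarrow> ('i \<Rightarrow> 'a \<Rightarrow> 'a::complex_hilbert) \<Rightarrow> bool" where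
  "jointly_bounded_below I A \<longleftrightarrow> (\<exists>C. \<forall>x. norm x \<le> C * (\<Sum>i\<in>I. norm (A i x)))"

definition koszul_sign :: "'i::linorder \<Rightarrow> 'i set \<Rightarrow> real" where
  "koszul_sign j J = (-1) ^ card {i\<in>J. i < j}"

lemma koszul_diff_sign:
  "J \<subseteq> I \<Longrightarrow> koszul_diff I A w J = (\<Sum>j\<in>J. koszul_sign j J *\<^sub>R A j (w (J - {j})))"
  by (simp add: koszul_diff_def koszul_sign_def)

lemma koszul_sign_singleton [simp]: "koszul_sign j {j} = 1"
proof -
  have "{i\<in>{j}. i < j} = {}" by auto
  then show ?thesis by (simp only: koszul_sign_def) simp
qed

text \<open>Exactness at the forms of degree \<open>0\<close>, which are single vectors.\<close>

lemma koszul_exact_kernel: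
  assumes ex: "koszul_exact I A" and lin: "\<And>i. i \<in> I \<Longrightarrow> A i 0 = 0"
    and x: "\<And>i. i \<in> I \<Longrightarrow> A i x = 0"
  shows "x = 0"
proof -
  define w where "w J = (if J = {} then x else 0)" for J :: "'a set"
  have "w \<in> koszul_forms I 0" by (auto simp: w_def koszul_forms_def)
  moreover have "koszul_diff I A w = (\<lambda>_. 0)"
  proof
    fix J
    have "A j (w (J - {j})) = 0" if "j \<in> I" for j
      using lin[OF that] x[OF that] by (simp add: w_def)
    then show "koszul_diff I A w J = 0"
      by (simp add: koszul_diff_def subset_iff)
  qed
  ultimately have "w = (\<lambda>_. 0)"
    using ex by (auto simp: koszul_exact_def)
  then have "w {} = 0" by simp
  then show ?thesis by (simp add: w_def)
qed

text \<open>Exactness at degree \<open>1\<close>: a form is a family \<open>y\<close> of vectors, and its differential at \<open>{a, b}\<close> is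
  \<open>A\<^sub>a y\<^sub>b - A\<^sub>b y\<^sub>a\<close>.\<close>

lemma koszul_exact_solve:
  fixes A :: "'i::linorder \<Rightarrow> 'a \<Rightarrow> 'a::real_vector"
  assumes ex: "koszul_exact I A" and lin: "\<And>i. i \<in> I \<Longrightarrow> A i 0 = 0"
    and comp: "\<And>i j. i \<in> I \<Longrightarrow> j \<in> I \<Longrightarrow> A i (y j) = A j (y i)"
  shows "\<exists>x. \<forall>i\<in>I. A i x = y i"
proof -
  define w where "w J = (if \<exists>j\<in>I. J = {j} then y (the_elem J) else 0)" for J
  have w1: "w {j} = y j" if "j \<in> I" for j using that by (simp add: w_def)
  have "w \<in> koszul_forms I (Suc 0)"
    by (auto simp: w_def koszul_forms_def split: if_splits)
  moreover have "koszul_diff I A w J = 0" for J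
  proof (cases "J \<subseteq> I \<and> card J = 2")
    case True
    then obtain a b where "J = {a, b}" "a \<noteq> b" by (auto simp: card_2_iff)
    then obtain a b where J: "J = {a, b}" "a < b"
      by (metis insert_commute linorder_neqE)
    then have I: "a \<in> I" "b \<in> I" using True by auto
    have c: "{i\<in>J. i < a} = {}" "{i\<in>J. i < b} = {a}" "J - {a} = {b}" "J - {b} = {a}"
      using J by auto
    have "koszul_diff I A w J = (\<Sum>j\<in>{a, b}. koszul_sign j J *\<^sub>R A j (w (J - {j})))"
      using True J by (simp add: koszul_diff_sign)
    also have "\<dots> = A a (w {b}) - A b (w {a})"
      using J(2) by (simp add: c koszul_sign_def)
    finally have "koszul_diff I A w J = A a (w {b}) - A b (w {a})" .
    then show ?thesis using I by (simp add: w1 comp[of a b])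
  next
    case False
    show ?thesis
    proof (cases "J \<subseteq> I")
      case True
      have "w (J - {j}) = 0" if j: "j \<in> J" for j
      proof -
        have "card J = 2" if "J - {j} = {k}" for k
        proof -
          have "J = {j, k}" "j \<noteq> k" using that j by auto
          then show ?thesis by simp
        qed
        then show ?thesis using False True by (auto simp: w_def)
      qed
      then show ?thesis
        using True lin by (auto simp: koszul_diff_def subset_iff intro!: sum.neutral)
    qed (simp add: koszul_diff_def)
  qed
  then have "koszul_diff I A w = (\<lambda>_. 0)" by auto
  ultimately obtain v where "w = koszul_diff I A v"
    using ex unfolding koszul_exact_def by blast
  then have "A i (v {}) = y i" if "i \<in> I" for i
    using w1[OF that] that by (simp add: koszul_diff_sign)
  then show ?thesis by blast
qed

text \<open>The principle of uniform boundedness for functionals, from Baire's theorem: one of the closed sets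
  of vectors on which all of \<open>V\<close> is bounded by a fixed \<open>n\<close> contains a ball.\<close>

lemma weakly_bounded_imp_bounded:
  fixes V :: "'a::complex_hilbert set"
  assumes "\<And>y. \<exists>C. \<forall>v\<in>V. \<bar>inner y v\<bar> \<le> C"
  shows "\<exists>C. \<forall>v\<in>V. norm v \<le> C"
proof -
  define E where "E n = {y. \<forall>v\<in>V. \<bar>inner y v\<bar> \<le> real n}" for n
  have "E n = (\<Inter>v\<in>V. {y. \<bar>inner y v\<bar> \<le> real n})" for n
    by (auto simp: E_def)
  then have cl: "closed (E n)" for n
    by (auto intro!: closed_INT closed_Collect_le continuous_intros)
  have "y \<in> (\<Union>n. E n)" for y
  proof -
    obtain C where "\<forall>v\<in>V. \<bar>inner y v\<bar> \<le> C" using assms by blast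
    moreover obtain n :: nat where "C \<le> n" using real_arch_simple by blast
    ultimately have "y \<in> E n" unfolding E_def by (blast intro: order_trans)
    then show ?thesis by blast
  qed
  then have U: "(\<Union>n. E n) = UNIV" by blast
  have "\<exists>n. interior (E n) \<noteq> {}"
  proof (rule ccontr)
    assume "\<not> ?thesis"
    then have "(euclidean :: 'a topology) interior_of \<Union> (range E) = {}"
      by (intro Baire_category_alt disjI1 completely_metrizable_space_euclidean)
        (auto simp: cl)
    then show False using U by simp
  qed
  then obtain n x where "x \<in> interior (E n)" by blast
  then obtain r where r: "0 < r" "cball x r \<subseteq> E n"
    by (meson mem_interior_cball)
  have "norm v \<le> 2 * n / r" if v: "v \<in> V" for v
  proof (cases "v = 0")
    case False
    define u where "u = x + (r / norm v) *\<^sub>R v"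
    have "u \<in> cball x r" "x \<in> cball x r" using False r by (auto simp: u_def dist_norm)
    then have "u \<in> E n" "x \<in> E n" using r(2) by auto
    then have "\<bar>inner u v\<bar> \<le> n" "\<bar>inner x v\<bar> \<le> n" using v by (auto simp: E_def)
    moreover have "inner u v = inner x v + r * norm v"
      using False by (simp add: u_def inner_add_left power2_norm_eq_inner[symmetric] power2_eq_square)
    ultimately have "r * norm v \<le> 2 * n" by linarith
    then show ?thesis using r(1) by (simp add: field_simps)
  qed (use r in simp)
  then show ?thesis by blast
qed

lemma self_adjoint_surj:
  assumes R: "self_adjoint R" and inj: "\<And>x. R x = 0 \<Longrightarrow> x = 0" and cl: "closed (range R)"
  shows "\<exists>x. R x = y"
proof -
  note RB = self_adjoint_bounded[OF R]
  have "closed_csubspace (range R)"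
    unfolding closed_csubspace_def
  proof (intro conjI ballI allI)
    show "0 \<in> range R" by (rule range_eqI[of _ _ 0]) (simp add: bounded_clinear_zero[OF RB])
    show "u + v \<in> range R" if "u \<in> range R" "v \<in> range R" for u v
      using that by (auto simp: bounded_clinear_add[OF RB, symmetric])
    show "c *\<^sub>C u \<in> range R" if "u \<in> range R" for c u
      using that by (auto simp: bounded_clinear_scaleC[OF RB, symmetric])
  qed (rule cl)
  from orthogonal_projection_ex[OF this, of y]
  obtain x where x: "\<And>u. cinner (R u) (y - R x) = 0" by auto
  have "cinner u (R (y - R x)) = cinner u 0" for u
    using x[of u] by (simp add: self_adjoint_cinner[OF R])
  then have "R (y - R x) = 0" by (rule cinner_ext)
  then show ?thesis using inj by force
qed

lemma modulus_of_family:
  assumes "finite I" and A: "\<And>i. i \<in> I \<Longrightarrow> bounded_clinear (A i)"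
  shows "\<exists>R. self_adjoint R \<and> (\<forall>x. (norm (R x))\<^sup>2 = (\<Sum>i\<in>I. (norm (A i x))\<^sup>2))"
proof -
  define P where "P x = (\<Sum>i\<in>I. adj (A i) (A i x))" for x
  have sa: "self_adjoint (\<lambda>x. adj (A i) (A i x))" if "i \<in> I" for i
    by (rule positive_op_self_adjoint[OF positive_op_adj_compose[OF A[OF that]]])
  have inner_P: "inner (P x) x = (\<Sum>i\<in>I. (norm (A i x))\<^sup>2)" for x
    by (simp add: P_def inner_sum_left norm_adj_compose[OF A])
  have "positive_op P"
    unfolding positive_op_iff self_adjoint_def
  proof (intro conjI allI)
    show "bounded_clinear P"
      unfolding P_def using sa by (intro bounded_clinear_sum_op) (simp add: self_adjoint_bounded)
    show "cinner (P x) y = cinner x (P y)" for x y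
      unfolding P_def cinner_sum_left cinner_sum_right
      by (intro sum.cong refl self_adjoint_cinner[OF sa])
  qed (simp add: inner_P sum_nonneg)
  then obtain R where R: "positive_op R" "\<And>x. R (R x) = P x"
    using positive_sqrt_ex by blast
  then have "self_adjoint R" by (simp add: positive_op_self_adjoint)
  moreover have "(norm (R x))\<^sup>2 = inner (P x) x" for x
    using self_adjoint_inner[OF \<open>self_adjoint R\<close>, of "R x" x] by (simp add: power2_norm_eq_inner R(2))
  ultimately show ?thesis by (auto simp: inner_P)
qed

text \<open>A lower bound for the family is one for the positive square root of \<open>\<Sum>i. A\<^sub>i\<^sup>* A\<^sub>i\<close>. Exactness in
  degrees \<open>0\<close> and \<open>1\<close> makes this root injective with closed range, so it is onto, and the principle
  of uniform boundedness makes its inverse continuous.\<close>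

theorem koszul_exact_imp_bounded_below:
  fixes A :: "'i::linorder \<Rightarrow> 'a \<Rightarrow> 'a::complex_hilbert"
  assumes ex: "koszul_exact I A" and I: "finite I"
    and A: "\<And>i. i \<in> I \<Longrightarrow> bounded_clinear (A i)"
    and comm: "\<And>i j x. i \<in> I \<Longrightarrow> j \<in> I \<Longrightarrow> A i (A j x) = A j (A i x)"
  shows "jointly_bounded_below I A"
proof -
  obtain R where R: "self_adjoint R" and R_norm: "\<And>x. (norm (R x))\<^sup>2 = (\<Sum>i\<in>I. (norm (A i x))\<^sup>2)"
    using modulus_of_family[of I A] I A by blast
  note RB = self_adjoint_bounded[OF R]
  have A_le_R: "norm (A i x) \<le> norm (R x)" if "i \<in> I" for i x
  proof (rule power2_le_imp_le)
    show "(norm (A i x))\<^sup>2 \<le> (norm (R x))\<^sup>2"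
      unfolding R_norm by (rule member_le_sum[OF that]) (auto simp: I)
  qed simp
  have A0: "A i 0 = 0" if "i \<in> I" for i using A[OF that] by (rule bounded_clinear_zero)
  have inj: "x = 0" if "R x = 0" for x
    by (rule koszul_exact_kernel[OF ex A0]) (use A_le_R[of _ x] that in auto)
  have "closed (range R)"
    unfolding closed_sequential_limits
  proof (intro allI impI)
    fix s y assume s: "(\<forall>n. s n \<in> range R) \<and> s \<longlonglongrightarrow> y"
    then have "\<forall>n. \<exists>x. s n = R x" by auto
    then obtain x where x: "\<And>n. s n = R (x n)" by metis
    have cau: "Cauchy (\<lambda>n. R (x n))" using s x LIMSEQ_imp_Cauchy by (metis (full_types) ext)
    have "\<exists>l. (\<lambda>n. A i (x n)) \<longlonglongrightarrow> l" if i: "i \<in> I" for i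
    proof -
      have le: "dist (A i (x m)) (A i (x n)) \<le> dist (R (x m)) (R (x n))" for m n
        using A_le_R[OF i, of "x m - x n"]
        by (simp add: dist_norm bounded_clinear_diff[OF A[OF i]] bounded_clinear_diff[OF RB])
      have "Cauchy (\<lambda>n. A i (x n))"
      proof (rule metric_CauchyI)
        fix e :: real assume "0 < e"
        then show "\<exists>M. \<forall>m\<ge>M. \<forall>n\<ge>M. dist (A i (x m)) (A i (x n)) < e"
          using metric_CauchyD[OF cau] le by (meson order.strict_trans1)
      qed
      then show ?thesis using Cauchy_convergent convergent_def by blast
    qed
    then obtain l where l: "\<And>i. i \<in> I \<Longrightarrow> (\<lambda>n. A i (x n)) \<longlonglongrightarrow> l i" by metis
    have "A i (l j) = A j (l i)" if ij: "i \<in> I" "j \<in> I" for i j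
    proof (rule LIMSEQ_unique)
      show "(\<lambda>n. A i (A j (x n))) \<longlonglongrightarrow> A i (l j)"
        by (rule bounded_clinear_tendsto[OF A l]) (use ij in auto)
      show "(\<lambda>n. A i (A j (x n))) \<longlonglongrightarrow> A j (l i)"
        unfolding comm[OF ij] by (rule bounded_clinear_tendsto[OF A l]) (use ij in auto)
    qed
    from koszul_exact_solve[OF ex A0 this]
    obtain u where u: "\<And>i. i \<in> I \<Longrightarrow> A i u = l i" by blast
    have "(\<lambda>n. \<Sum>i\<in>I. (norm (A i (x n) - l i))\<^sup>2) \<longlonglongrightarrow> (\<Sum>i\<in>I. (norm (l i - l i))\<^sup>2)"
      by (intro tendsto_intros l)
    moreover have "(\<Sum>i\<in>I. (norm (A i (x n) - l i))\<^sup>2) = (norm (R (x n) - R u))\<^sup>2" for n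
      using R_norm[of "x n - u"]
      by (simp add: bounded_clinear_diff[OF A] bounded_clinear_diff[OF RB] u cong: sum.cong)
    ultimately have "(\<lambda>n. sqrt ((norm (R (x n) - R u))\<^sup>2)) \<longlonglongrightarrow> sqrt 0"
      by (intro tendsto_real_sqrt) simp
    then have "(\<lambda>n. R (x n)) \<longlonglongrightarrow> R u"
      by (simp add: tendsto_norm_zero_iff LIM_zero_iff)
    moreover have "(\<lambda>n. R (x n)) \<longlonglongrightarrow> y" using s x by (metis (full_types) ext)
    ultimately have "y = R u" by (rule LIMSEQ_unique[symmetric])
    then show "y \<in> range R" by blast
  qed
  then have surj: "\<exists>x. R x = y" for y
    using self_adjoint_surj[OF R inj] by blast
  have "\<exists>C. \<forall>v\<in>{v. norm (R v) \<le> 1}. norm v \<le> C"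
  proof (rule weakly_bounded_imp_bounded)
    fix y
    obtain u where u: "R u = y" using surj by blast
    have "\<bar>inner y v\<bar> \<le> norm u" if "norm (R v) \<le> 1" for v
      using Cauchy_Schwarz_ineq2[of u "R v"] mult_left_mono[OF that, of "norm u"]
      by (simp add: u[symmetric] self_adjoint_inner[OF R])
    then show "\<exists>C. \<forall>v\<in>{v. norm (R v) \<le> 1}. \<bar>inner y v\<bar> \<le> C" by blast
  qed
  then obtain C where C: "\<And>v. norm (R v) \<le> 1 \<Longrightarrow> norm v \<le> C" by blast
  have R_sum: "norm (R x) \<le> (\<Sum>i\<in>I. norm (A i x))" for x
  proof -
    have "norm (R x) = L2_set (\<lambda>i. norm (A i x)) I"
      by (simp add: L2_set_def R_norm[symmetric])
    also have "\<dots> \<le> (\<Sum>i\<in>I. norm (A i x))" by (rule L2_set_le_sum) simp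
    finally show ?thesis .
  qed
  have "norm x \<le> \<bar>C\<bar> * (\<Sum>i\<in>I. norm (A i x))" for x
  proof (cases "R x = 0")
    case False
    have "norm ((1 / norm (R x)) *\<^sub>R x) \<le> C"
      using False by (intro C) (simp add: bounded_clinear_scaleR[OF RB])
    then have "norm x \<le> C * norm (R x)"
      using False by (simp add: field_simps)
    also have "\<dots> \<le> \<bar>C\<bar> * (\<Sum>i\<in>I. norm (A i x))"
      using R_sum[of x] by (intro mult_mono) (auto intro: order_trans[OF norm_ge_zero])
    finally show ?thesis .
  next
    case True
    then have "x = 0" by (rule inj)
    then show ?thesis by (simp add: sum_nonneg)
  qed
  then show ?thesis unfolding jointly_bounded_below_def by blast
qed

lemma koszul_sign_remove:
  assumes "finite K" "i \<in> K"
  shows "koszul_sign j K = (if i < j then -1 else 1) * koszul_sign j (K - {i})"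
proof -
  have "{k\<in>K. k < j} = (if i < j then insert i {k\<in>K - {i}. k < j} else {k\<in>K - {i}. k < j})"
    using assms by auto
  moreover have "finite {k\<in>K - {i}. k < j}" "i \<notin> {k\<in>K - {i}. k < j}" using assms by auto
  ultimately show ?thesis by (simp add: koszul_sign_def)
qed

lemma koszul_sign_square: "koszul_sign j J * koszul_sign j J = 1"
  by (simp add: koszul_sign_def power_mult_distrib[symmetric])

lemma koszul_sign_self:
  "koszul_sign j (J - {j}) = koszul_sign j J" "koszul_sign j (insert j J) = koszul_sign j J"
proof -
  have "{i\<in>J - {j}. i < j} = {i\<in>J. i < j}" "{i\<in>insert j J. i < j} = {i\<in>J. i < j}" by auto
  then show "koszul_sign j (J - {j}) = koszul_sign j J" "koszul_sign j (insert j J) = koszul_sign j J"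
    by (simp_all only: koszul_sign_def)
qed

lemma koszul_diff_in_forms:
  assumes "finite I" and A: "\<And>j. j \<in> I \<Longrightarrow> A j 0 = 0" and w: "w \<in> koszul_forms I p"
  shows "koszul_diff I A w \<in> koszul_forms I (Suc p)"
  unfolding koszul_forms_def
proof (intro CollectI allI impI)
  fix J assume nz: "koszul_diff I A w J \<noteq> 0"
  then have J: "J \<subseteq> I" by (auto simp: koszul_diff_def split: if_splits)
  have "\<exists>j\<in>J. w (J - {j}) \<noteq> 0"
  proof (rule ccontr)
    assume "\<not> ?thesis"
    then have "koszul_diff I A w J = 0"
      using A J by (auto simp: koszul_diff_def intro!: sum.neutral)
    then show False using nz by simp
  qed
  then obtain j where "j \<in> J" "card (J - {j}) = p"
    using w by (auto simp: koszul_forms_def)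
  then show "J \<subseteq> I \<and> card J = Suc p"
    using J assms(1) finite_subset by (metis card.remove)
qed

text \<open>Removing \<open>j\<close> and \<open>k\<close> in either order gives opposite signs, so the double sum is antisymmetric.\<close>

lemma koszul_diff_diff:
  fixes A :: "'i::linorder \<Rightarrow> 'a \<Rightarrow> 'a::real_vector"
  assumes I: "finite I" and A: "\<And>i. i \<in> I \<Longrightarrow> linear (A i)"
    and comm: "\<And>i j x. i \<in> I \<Longrightarrow> j \<in> I \<Longrightarrow> A i (A j x) = A j (A i x)"
  shows "koszul_diff I A (koszul_diff I A w) J = 0"
proof (cases "J \<subseteq> I")
  case True
  have fin: "finite J" using True I finite_subset by blast
  define g where "g j k = (if k = j then 0 else (koszul_sign j J * koszul_sign k (J - {j})) *\<^sub>R
    A j (A k (w (J - {j} - {k}))))" for j k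
  have "koszul_diff I A (koszul_diff I A w) J =
      (\<Sum>j\<in>J. koszul_sign j J *\<^sub>R A j (\<Sum>k\<in>J - {j}. koszul_sign k (J - {j}) *\<^sub>R A k (w (J - {j} - {k}))))"
    unfolding koszul_diff_sign[OF True]
    using True by (intro sum.cong refl arg_cong2[where f = scaleR] arg_cong[where f = "A _"]
        koszul_diff_sign) auto
  also have "\<dots> = (\<Sum>j\<in>J. \<Sum>k\<in>J. g j k)"
  proof (rule sum.cong[OF refl])
    fix j assume j: "j \<in> J"
    then have lin: "linear (A j)" using A True by blast
    have "koszul_sign j J *\<^sub>R A j (\<Sum>k\<in>J - {j}. koszul_sign k (J - {j}) *\<^sub>R A k (w (J - {j} - {k})))
        = (\<Sum>k\<in>J - {j}. g j k)"
      by (simp add: linear_sum[OF lin] linear_scale[OF lin] scaleR_sum_right g_def)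
    also have "\<dots> = (\<Sum>k\<in>J. g j k)"
      using fin by (intro sum.mono_neutral_left) (auto simp: g_def split: if_splits)
    finally show "koszul_sign j J *\<^sub>R A j (\<Sum>k\<in>J - {j}. koszul_sign k (J - {j}) *\<^sub>R A k (w (J - {j} - {k})))
        = (\<Sum>k\<in>J. g j k)" .
  qed
  finally have eq: "koszul_diff I A (koszul_diff I A w) J = (\<Sum>j\<in>J. \<Sum>k\<in>J. g j k)" .
  have anti: "g k j = - g j k" if "j \<in> J" "k \<in> J" for j k
  proof (cases "j = k")
    case False
    have "koszul_sign k J * koszul_sign j (J - {k}) = - (koszul_sign j J * koszul_sign k (J - {j}))"
    proof -
      define s :: real where "s = (if j < k then -1 else 1)"
      have "koszul_sign k J = s * koszul_sign k (J - {j})"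
        using koszul_sign_remove[OF fin that(1), of k] by (simp only: s_def)
      moreover have "koszul_sign j J = - s * koszul_sign j (J - {k})"
      proof -
        have "(if k < j then - 1 else 1) = - s"
          using False by (cases j k rule: linorder_cases) (auto simp: s_def)
        then show ?thesis by (simp only: koszul_sign_remove[OF fin that(2), of j])
      qed
      ultimately show ?thesis by simp
    qed
    moreover have "J - {k} - {j} = J - {j} - {k}" by auto
    moreover have "A k (A j x) = A j (A k x)" for x
      by (rule comm) (use True that in auto)
    ultimately show ?thesis using False by (simp add: g_def)
  qed (simp add: g_def)
  have "(\<Sum>j\<in>J. \<Sum>k\<in>J. g j k) = (\<Sum>j\<in>J. \<Sum>k\<in>J. g k j)" by (rule sum.swap)
  also have "\<dots> = - (\<Sum>j\<in>J. \<Sum>k\<in>J. g j k)"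
    unfolding sum_negf[symmetric] by (intro sum.cong refl anti)
  finally have "2 *\<^sub>R (\<Sum>j\<in>J. \<Sum>k\<in>J. g j k) = 0"
    by (simp add: scaleR_2 eq_neg_iff_add_eq_0)
  then show ?thesis by (simp add: eq)
qed (simp add: koszul_diff_def)

text \<open>Contraction with \<open>B\<close> is a homotopy from \<open>\<Sum>i. B\<^sub>i A\<^sub>i = 1\<close> to \<open>0\<close>: the terms in which an index is
  removed and the same one inserted add up to the identity, and the mixed terms cancel by sign.\<close>

lemma koszul_exact_of_inverse:
  fixes A B :: "'i::linorder \<Rightarrow> 'a \<Rightarrow> 'a::real_vector"
  assumes I: "finite I" and A: "\<And>i. i \<in> I \<Longrightarrow> linear (A i)" and B: "\<And>i. i \<in> I \<Longrightarrow> linear (B i)"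
    and comm: "\<And>i j x. i \<in> I \<Longrightarrow> j \<in> I \<Longrightarrow> A i (A j x) = A j (A i x)"
    and AB: "\<And>i j x. i \<in> I \<Longrightarrow> j \<in> I \<Longrightarrow> A j (B i x) = B i (A j x)"
    and inv: "\<And>x. (\<Sum>i\<in>I. B i (A i x)) = x"
  shows "koszul_exact I A"
  unfolding koszul_exact_def
proof (intro conjI allI)
  have A0: "A i 0 = 0" and B0: "B i 0 = 0" if "i \<in> I" for i
    using linear_0[OF A[OF that]] linear_0[OF B[OF that]] by auto
  show "{w \<in> koszul_forms I 0. koszul_diff I A w = (\<lambda>_. 0)} = {\<lambda>_. 0}"
  proof (intro equalityI subsetI)
    fix w assume w: "w \<in> {w \<in> koszul_forms I 0. koszul_diff I A w = (\<lambda>_. 0)}"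
    have "A i (w {}) = 0" if "i \<in> I" for i
      using w that by (auto simp: koszul_diff_def dest: fun_cong[of _ _ "{i}"])
    then have "w {} = 0" using inv[of "w {}"] B0 by simp
    moreover have "w J = 0" if "J \<noteq> {}" for J
      using w that I finite_subset by (auto simp: koszul_forms_def card_eq_0_iff)
    ultimately have "w J = 0" for J by (cases "J = {}") auto
    then show "w \<in> {\<lambda>_. 0}" by auto
  qed (auto simp: koszul_forms_def koszul_diff_def A0 subset_iff fun_eq_iff intro!: sum.neutral)
  fix p
  show "{w \<in> koszul_forms I (Suc p). koszul_diff I A w = (\<lambda>_. 0)} = koszul_diff I A ` koszul_forms I p"
  proof (intro equalityI subsetI)
    fix w assume "w \<in> koszul_diff I A ` koszul_forms I p"
    then show "w \<in> {w \<in> koszul_forms I (Suc p). koszul_diff I A w = (\<lambda>_. 0)}"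
      using koszul_diff_diff[OF I A comm] koszul_diff_in_forms[of I A] I A0 by auto
  next
    fix w assume "w \<in> {w \<in> koszul_forms I (Suc p). koszul_diff I A w = (\<lambda>_. 0)}"
    then have w: "w \<in> koszul_forms I (Suc p)" and dw: "koszul_diff I A w J = 0" for J by auto
    define v where "v J = (if J \<subseteq> I then \<Sum>i\<in>I - J. koszul_sign i J *\<^sub>R B i (w (insert i J)) else 0)" for J
    have "v \<in> koszul_forms I p"
      unfolding koszul_forms_def
    proof (intro CollectI allI impI)
      fix J assume nz: "v J \<noteq> 0"
      then have J: "J \<subseteq> I" by (auto simp: v_def split: if_splits)
      have "\<exists>i\<in>I - J. w (insert i J) \<noteq> 0"
      proof (rule ccontr)
        assume "\<not> ?thesis"
        then have "v J = 0" using B0 by (auto simp: v_def intro!: sum.neutral)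
        then show False using nz by simp
      qed
      then obtain i where "i \<notin> J" "card (insert i J) = Suc p"
        using w by (auto simp: koszul_forms_def)
      then show "J \<subseteq> I \<and> card J = p"
        using J I finite_subset by (metis card_insert_disjoint nat.inject)
    qed
    moreover have "koszul_diff I A v J = w J" for J
    proof (cases "J \<subseteq> I")
      case True
      have fin: "finite J" using True I finite_subset by blast
      let ?X = "\<lambda>j i. B i (A j (w (insert i (J - {j}))))"
      have "koszul_diff I A v J =
          (\<Sum>j\<in>J. B j (A j (w J)) +
            (\<Sum>i\<in>I - J. (koszul_sign j J * koszul_sign i (J - {j})) *\<^sub>R ?X j i))"
        unfolding koszul_diff_sign[OF True]
      proof (rule sum.cong[OF refl])
        fix j assume j: "j \<in> J"
        then have lin: "linear (A j)" using A True by blast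
        have ins: "I - (J - {j}) = insert j (I - J)" "J - {j} \<subseteq> I" "j \<notin> I - J" "insert j J = J"
          using j True by auto
        have "v (J - {j}) = koszul_sign j J *\<^sub>R B j (w J)
            + (\<Sum>i\<in>I - J. koszul_sign i (J - {j}) *\<^sub>R B i (w (insert i (J - {j}))))"
          unfolding v_def if_P[OF ins(2)] ins(1) using I ins(3,4)
          by (simp add: koszul_sign_self)
        moreover have "koszul_sign j J *\<^sub>R A j (koszul_sign j J *\<^sub>R B j (w J)) = B j (A j (w J))"
          using AB[of j j] j True by (auto simp: linear_scale[OF lin] koszul_sign_square)
        moreover have "koszul_sign j J *\<^sub>R A j
            (\<Sum>i\<in>I - J. koszul_sign i (J - {j}) *\<^sub>R B i (w (insert i (J - {j}))))
            = (\<Sum>i\<in>I - J. (koszul_sign j J * koszul_sign i (J - {j})) *\<^sub>R ?X j i)"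
          using AB j True
          by (auto simp: linear_sum[OF lin] linear_scale[OF lin] scaleR_sum_right intro!: sum.cong)
        ultimately show "koszul_sign j J *\<^sub>R A j (v (J - {j})) = B j (A j (w J)) +
            (\<Sum>i\<in>I - J. (koszul_sign j J * koszul_sign i (J - {j})) *\<^sub>R ?X j i)"
          by (simp only: linear_add[OF lin] scaleR_add_right)
      qed
      also have "\<dots> = (\<Sum>j\<in>J. B j (A j (w J))) +
            (\<Sum>i\<in>I - J. \<Sum>j\<in>J. (koszul_sign j J * koszul_sign i (J - {j})) *\<^sub>R ?X j i)"
        by (simp add: sum.distrib sum.swap[of _ J "I - J"])
      also have "(\<Sum>i\<in>I - J. \<Sum>j\<in>J. (koszul_sign j J * koszul_sign i (J - {j})) *\<^sub>R ?X j i)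
          = (\<Sum>i\<in>I - J. B i (A i (w J)))"
      proof (rule sum.cong[OF refl])
        fix i assume i: "i \<in> I - J"
        then have lin: "linear (B i)" using B by blast
        have "insert i J \<subseteq> I" "finite (insert i J)" using i True fin by auto
        have "0 = koszul_sign i J *\<^sub>R B i (koszul_diff I A w (insert i J))"
          using B0 i by (simp add: dw)
        also have "koszul_diff I A w (insert i J) = koszul_sign i J *\<^sub>R A i (w J)
            + (\<Sum>j\<in>J. koszul_sign j (insert i J) *\<^sub>R A j (w (insert i (J - {j}))))"
        proof -
          have "J - {i} = J" using i by auto
          moreover have "insert i J - {j} = insert i (J - {j})" if "j \<in> J" for j
            using i that by auto
          ultimately show ?thesis
            using fin i by (simp add: koszul_diff_sign[OF \<open>insert i J \<subseteq> I\<close>] koszul_sign_self)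
        qed
        also have "koszul_sign i J *\<^sub>R B i \<dots> = B i (A i (w J))
            + (\<Sum>j\<in>J. (koszul_sign i J * koszul_sign j (insert i J)) *\<^sub>R ?X j i)"
          by (simp add: linear_add[OF lin] linear_sum[OF lin] linear_scale[OF lin] scaleR_add_right
              scaleR_sum_right koszul_sign_square)
        also have "(\<Sum>j\<in>J. (koszul_sign i J * koszul_sign j (insert i J)) *\<^sub>R ?X j i)
            = (\<Sum>j\<in>J. - ((koszul_sign j J * koszul_sign i (J - {j})) *\<^sub>R ?X j i))"
        proof (rule sum.cong[OF refl])
          fix j assume j: "j \<in> J"
          have "insert i J - {i} = J" and "i \<noteq> j" using i j by auto
          have "koszul_sign i J * koszul_sign j (insert i J) = - (koszul_sign j J * koszul_sign i (J - {j}))"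
          proof -
            define s :: real where "s = (if i < j then -1 else 1)"
            have "koszul_sign j (insert i J) = s * koszul_sign j J"
              using koszul_sign_remove[OF \<open>finite (insert i J)\<close> insertI1, of j]
              unfolding \<open>insert i J - {i} = J\<close> s_def .
            moreover have "koszul_sign i J = - s * koszul_sign i (J - {j})"
            proof -
              have "(if j < i then - 1 else 1) = - s"
                using \<open>i \<noteq> j\<close> by (cases i j rule: linorder_cases) (auto simp: s_def)
              then show ?thesis by (simp only: koszul_sign_remove[OF fin j, of i])
            qed
            moreover have "s * s = 1" by (simp add: s_def)
            ultimately show ?thesis by simp
          qed
          then show "(koszul_sign i J * koszul_sign j (insert i J)) *\<^sub>R ?X j i
              = - ((koszul_sign j J * koszul_sign i (J - {j})) *\<^sub>R ?X j i)" by simp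
        qed
        finally show "(\<Sum>j\<in>J. (koszul_sign j J * koszul_sign i (J - {j})) *\<^sub>R ?X j i) = B i (A i (w J))"
          by (simp add: sum_negf)
      qed
      also have "(\<Sum>j\<in>J. B j (A j (w J))) + (\<Sum>i\<in>I - J. B i (A i (w J))) = w J"
        using sum.subset_diff[OF True I, of "\<lambda>i. B i (A i (w J))"] inv[of "w J"] by (simp add: add.commute)
      finally show ?thesis .
    next
      case False
      then show ?thesis using w by (auto simp: koszul_diff_def koszul_forms_def)
    qed
    then have "koszul_diff I A v = w" by auto
    ultimately show "w \<in> koszul_diff I A ` koszul_forms I p" by blast
  qed
qed

text \<open>With \<open>P = \<Sum>i. A\<^sub>i\<^sup>* A\<^sub>i\<close> invertible, \<open>B\<^sub>i = P\<^sup>-\<^sup>1 A\<^sub>i\<^sup>*\<close> is a left inverse of the family. Normality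
  enters through Fuglede's theorem, by which the \<open>B\<^sub>i\<close> commute with the \<open>A\<^sub>j\<close>.\<close>

theorem bounded_below_imp_koszul_exact:
  fixes A :: "'i::linorder \<Rightarrow> 'a \<Rightarrow> 'a::complex_hilbert"
  assumes bb: "jointly_bounded_below I A" and I: "finite I"
    and A: "\<And>i. i \<in> I \<Longrightarrow> normal_op (A i)"
    and comm: "\<And>i j x. i \<in> I \<Longrightarrow> j \<in> I \<Longrightarrow> A i (A j x) = A j (A i x)"
  shows "koszul_exact I A"
proof -
  note AB = normal_op_bounded[OF A]
  note AB' = bounded_clinear_adj[OF AB]
  have dc: "A j (adj (A i) x) = adj (A i) (A j x)" if "i \<in> I" "j \<in> I" for i j x
    by (rule normal_ops_doubly_commute[symmetric, OF A A]) (use that comm in auto)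
  define P where "P x = (\<Sum>i\<in>I. adj (A i) (A i x))" for x
  have sa: "self_adjoint (\<lambda>x. adj (A i) (A i x))" if "i \<in> I" for i
    by (rule positive_op_self_adjoint[OF positive_op_adj_compose[OF AB[OF that]]])
  have P: "self_adjoint P"
    unfolding self_adjoint_def P_def cinner_sum_left cinner_sum_right
    by (intro conjI allI bounded_clinear_sum_op sum.cong refl)
      (auto simp: self_adjoint_cinner[OF sa] self_adjoint_bounded[OF sa])
  note PB = self_adjoint_bounded[OF P]
  obtain C where C: "\<And>x. norm x \<le> C * (\<Sum>i\<in>I. norm (A i x))"
    using bb by (auto simp: jointly_bounded_below_def)
  define D where "D = C\<^sup>2 * card I"
  have P_low: "norm x \<le> D * norm (P x)" for x
  proof (cases "x = 0")
    case False
    have "(norm x)\<^sup>2 \<le> (C * (\<Sum>i\<in>I. norm (A i x)))\<^sup>2"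
      using C by (intro power_mono) auto
    also have "\<dots> \<le> C\<^sup>2 * ((\<Sum>i\<in>I. (norm (A i x))\<^sup>2) * card I)"
      unfolding power_mult_distrib by (intro mult_left_mono sum_squared_le_sum_of_squares) simp
    also have "\<dots> = D * inner (P x) x"
      by (simp add: D_def P_def inner_sum_left norm_adj_compose[OF AB])
    also have "\<dots> \<le> D * (norm (P x) * norm x)"
      by (intro mult_left_mono norm_cauchy_schwarz) (simp add: D_def)
    finally have "norm x * norm x \<le> (D * norm (P x)) * norm x"
      by (simp add: power2_eq_square)
    then show ?thesis by (rule mult_right_le_imp_le) (use False in simp)
  qed (simp add: bounded_clinear_zero[OF PB])
  have inj: "x = 0" if "P x = 0" for x
    using P_low[of x] that by simp
  have "complete (range P)"
  proof (rule complete_isometric_image[of "1 / (\<bar>D\<bar> + 1)"])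
    have "norm x \<le> (\<bar>D\<bar> + 1) * norm (P x)" for x
      using P_low[of x] mult_right_mono[of D "\<bar>D\<bar> + 1" "norm (P x)"] by fastforce
    then show "\<forall>x\<in>UNIV. 1 / (\<bar>D\<bar> + 1) * norm x \<le> norm (P x)"
      by (simp add: pos_divide_le_eq mult.commute add_nonneg_pos)
  qed (simp_all add: add_nonneg_pos bounded_clinear_bounded_linear[OF PB] complete_UNIV)
  then have "closed (range P)" by (rule complete_imp_closed)
  then have "\<forall>y. \<exists>x. P x = y" using self_adjoint_surj[OF P inj] by blast
  then obtain Q where PQ: "\<And>y. P (Q y) = y" by metis
  have P_inj: "x = y" if "P x = P y" for x y
    using inj[of "x - y"] that by (simp add: bounded_clinear_diff[OF PB])
  have QP: "Q (P x) = x" for x by (rule P_inj) (simp add: PQ)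
  have PA: "P (A j x) = A j (P x)" if "j \<in> I" for j x
    using that by (auto simp: P_def bounded_clinear_sum[OF AB] dc comm intro!: sum.cong)
  have QA: "Q (A j x) = A j (Q x)" if "j \<in> I" for j x
    by (rule P_inj) (simp add: PA[OF that] PQ)
  have Qlin: "linear Q"
  proof (rule linearI)
    show "Q (x + y) = Q x + Q y" for x y
      by (rule P_inj) (simp add: bounded_clinear_add[OF PB] PQ)
    show "Q (r *\<^sub>R x) = r *\<^sub>R Q x" for r x
      by (rule P_inj) (simp add: bounded_clinear_scaleR[OF PB] PQ)
  qed
  show ?thesis
  proof (rule koszul_exact_of_inverse[of I A "\<lambda>i x. Q (adj (A i) x)"])
    show "A i (A j x) = A j (A i x)" if "i \<in> I" "j \<in> I" for i j x
      using that by (rule comm)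
    show "linear (A i)" if "i \<in> I" for i
      using bounded_linear.linear[OF bounded_clinear_bounded_linear[OF AB[OF that]]] .
    show "linear (\<lambda>x. Q (adj (A i) x))" if "i \<in> I" for i
      using linear_compose[OF bounded_linear.linear[OF bounded_clinear_bounded_linear[OF AB'[OF that]]] Qlin]
      by (simp add: comp_def)
    show "A j (Q (adj (A i) x)) = Q (adj (A i) (A j x))" if "i \<in> I" "j \<in> I" for i j x
      using QA[OF that(2)] dc[OF that] by metis
    show "(\<Sum>i\<in>I. Q (adj (A i) (A i x))) = x" for x
      using QP[of x] by (simp add: P_def linear_sum[OF Qlin])
  qed (rule I)
qed


section \<open>Bounds for the points of the domain\<close>

lemma five_distinct [simp]:
  "(1::5) \<noteq> 2" "(1::5) \<noteq> 3" "(1::5) \<noteq> 4" "(1::5) \<noteq> 5" "(2::5) \<noteq> 3" "(2::5) \<noteq> 4" "(2::5) \<noteq> 5"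
  "(3::5) \<noteq> 4" "(3::5) \<noteq> 5" "(4::5) \<noteq> 5"
  "(2::5) \<noteq> 1" "(3::5) \<noteq> 1" "(4::5) \<noteq> 1" "(5::5) \<noteq> 1" "(3::5) \<noteq> 2" "(4::5) \<noteq> 2" "(5::5) \<noteq> 2"
  "(4::5) \<noteq> 3" "(5::5) \<noteq> 3" "(5::5) \<noteq> 4"
  by simp_all

lemma four_distinct [simp]:
  "(1::4) \<noteq> 2" "(1::4) \<noteq> 3" "(1::4) \<noteq> 4" "(2::4) \<noteq> 3" "(2::4) \<noteq> 4" "(3::4) \<noteq> 4"
  "(2::4) \<noteq> 1" "(3::4) \<noteq> 1" "(4::4) \<noteq> 1" "(3::4) \<noteq> 2" "(4::4) \<noteq> 2" "(4::4) \<noteq> 3"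
  by simp_all

lemma tuple5_nth [simp]:
  "tuple5 a b c d e 1 = a" "tuple5 a b c d e 2 = b" "tuple5 a b c d e 3 = c"
  "tuple5 a b c d e 4 = d" "tuple5 a b c d e 5 = e"
  by (simp_all only: tuple5_def five_distinct if_False refl if_True)

lemma tuple4_nth [simp]:
  "tuple4 a b c d 1 = a" "tuple4 a b c d 2 = b" "tuple4 a b c d 3 = c" "tuple4 a b c d 4 = d"
  by (simp_all only: tuple4_def four_distinct if_False refl if_True)

lemma all_4: "(\<forall>i::4. P i) \<longleftrightarrow> P 1 \<and> P 2 \<and> P 3 \<and> P 4"
  by (metis exhaust_4)

text \<open>An eigenvector of \<open>A X\<close> for the eigenvalue \<open>1\<close> keeps the norms of such \<open>X\<close> away from \<open>0\<close>, so that
  the infimum defining \<open>\<mu>\<close> is positive.\<close>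

lemma mu_le_one_imp:
  fixes A X :: "complex^'n^'n"
  assumes mu: "mu E A \<le> 1" and X: "X \<in> E" and sing: "det (mat 1 - A ** X) = 0"
  shows "1 \<le> onorm ((*v) X)"
proof (rule ccontr)
  assume small: "\<not> ?thesis"
  define S where "S = {onorm ((*v) X) | X. X \<in> E \<and> det (mat 1 - A ** X) = 0}"
  define c where "c = 1 / (onorm ((*v) A) + 1)"
  have A0: "0 \<le> onorm ((*v) A)" by (rule onorm_pos_le) simp
  then have c: "0 < c" by (simp add: c_def)
  have low: "c \<le> onorm ((*v) Y)" if "det (mat 1 - A ** Y) = 0" for Y
  proof -
    have "\<not> invertible (mat 1 - A ** Y)"
      using that invertible_det_nz by blast
    then obtain v where v: "v \<noteq> 0" "(mat 1 - A ** Y) *v v = 0"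
      using matrix_left_invertible_ker invertible_left_inverse by blast
    then have "v = A *v (Y *v v)"
      by (simp add: matrix_vector_mult_diff_rdistrib matrix_vector_mul_assoc)
    then have "norm v \<le> onorm ((*v) A) * norm (Y *v v)"
      by (metis onorm matrix_vector_mul_bounded_linear)
    also have "\<dots> \<le> onorm ((*v) A) * (onorm ((*v) Y) * norm v)"
      by (intro mult_left_mono onorm A0 matrix_vector_mul_bounded_linear)
    finally have "1 * norm v \<le> (onorm ((*v) A) * onorm ((*v) Y)) * norm v" by simp
    then have "1 \<le> onorm ((*v) A) * onorm ((*v) Y)"
      by (rule mult_right_le_imp_le) (use v in simp)
    also have "\<dots> \<le> (onorm ((*v) A) + 1) * onorm ((*v) Y)"
      by (intro mult_right_mono onorm_pos_le matrix_vector_mul_bounded_linear) simp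
    finally show ?thesis
      using A0 by (simp add: c_def pos_divide_le_eq mult.commute)
  qed
  have XS: "onorm ((*v) X) \<in> S" using X sing by (auto simp: S_def)
  have "c \<le> Inf S" using XS low by (intro cInf_greatest) (auto simp: S_def)
  moreover have "Inf S \<le> onorm ((*v) X)"
    using low by (intro cInf_lower[OF XS] bdd_belowI[of _ c]) (auto simp: S_def)
  ultimately have "0 < Inf S" "Inf S < 1" using c small by linarith+
  moreover have "mu E A = 1 / Inf S" using X sing by (auto simp: mu_def S_def)
  ultimately show False using mu by (simp add: pos_divide_le_eq)
qed

text \<open>With first diagonal entry \<open>0\<close>, the matrices in \<open>E\<close> see only the polynomial
  \<open>1 - y\<^sub>1 z + y\<^sub>2 z\<^sup>2 = (1 - \<alpha> z) (1 - \<beta> z)\<close>, which can have no zero in the open unit disc.\<close>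

lemma Gamma_E_bounds:
  assumes "vec_lambda (tuple5 x1 x2 x3 y1 y2) \<in> Gamma_E"
  shows "cmod y1 \<le> 2" "cmod y2 \<le> 1"
proof -
  obtain A :: "complex^3^3" where mu: "mu E_3_2_12 A \<le> 1"
    and eq: "vec_lambda (tuple5 x1 x2 x3 y1 y2) = vec_lambda (tuple5
        (A$1$1)
        (det (vector [vector [A$1$1, A$1$2], vector [A$2$1, A$2$2]] :: complex^2^2)
         + det (vector [vector [A$1$1, A$1$3], vector [A$3$1, A$3$3]] :: complex^2^2))
        (det A)
        (A$2$2 + A$3$3)
        (det (vector [vector [A$2$2, A$2$3], vector [A$3$2, A$3$3]] :: complex^2^2)))"
    using assms unfolding Gamma_E_def by blast
  have y: "y1 = A$2$2 + A$3$3" "y2 = A$2$2 * A$3$3 - A$2$3 * A$3$2"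
    using arg_cong[OF eq, of "\<lambda>v. v $ 4"] arg_cong[OF eq, of "\<lambda>v. v $ 5"]
    by (simp_all add: det_2)
  have root: "cmod \<alpha> \<le> 1" if \<alpha>: "\<alpha>\<^sup>2 - y1 * \<alpha> + y2 = 0" for \<alpha>
  proof (rule ccontr)
    assume big: "\<not> cmod \<alpha> \<le> 1"
    define z where "z = 1 / \<alpha>"
    have \<alpha>0: "\<alpha> \<noteq> 0" using big by auto
    have z: "cmod z < 1" using big \<alpha>0 by (simp add: z_def norm_divide divide_less_eq)
    define X :: "complex^3^3" where "X = (\<chi> i j. if i = j then (if i = 1 then 0 else z) else 0)"
    have "X \<in> E_3_2_12" unfolding X_def E_3_2_12_def by blast
    moreover have "det (mat 1 - A ** X) = 1 - y1 * z + y2 * z\<^sup>2"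
      by (simp add: det_3 X_def matrix_matrix_mult_def sum_3 mat_def y algebra_simps power2_eq_square)
    moreover have "1 - y1 * z + y2 * z\<^sup>2 = (\<alpha>\<^sup>2 - y1 * \<alpha> + y2) / \<alpha>\<^sup>2"
      using \<alpha>0 by (simp add: z_def field_simps power2_eq_square)
    ultimately have "1 \<le> onorm ((*v) X)"
      using mu_le_one_imp[OF mu, of X] \<alpha> by simp
    moreover have "onorm ((*v) X) \<le> cmod z"
    proof (rule onorm_le)
      fix v :: "complex^3"
      have "norm (X *v v) \<le> norm (cmod z *\<^sub>R v)"
      proof (rule norm_le_componentwise_cart)
        fix i :: 3
        show "norm ((X *v v) $ i) \<le> norm ((cmod z *\<^sub>R v) $ i)"
          using exhaust_3[of i]
          by (auto simp: X_def matrix_vector_mult_def sum_3 norm_mult)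
      qed
      then show "norm (X *v v) \<le> cmod z * norm v" by simp
    qed
    ultimately show False using z by simp
  qed
  define s where "s = csqrt (y1\<^sup>2 - 4 * y2)"
  define \<alpha> \<beta> where "\<alpha> = (y1 + s) / 2" and "\<beta> = (y1 - s) / 2"
  have s: "s\<^sup>2 = y1\<^sup>2 - 4 * y2" by (simp add: s_def)
  have sum: "\<alpha> + \<beta> = y1" by (simp add: \<alpha>_def \<beta>_def field_simps)
  have "\<alpha> * \<beta> = (y1\<^sup>2 - s\<^sup>2) / 4"
    by (simp add: \<alpha>_def \<beta>_def field_simps power2_eq_square)
  then have prod: "\<alpha> * \<beta> = y2" by (simp add: s)
  have "cmod \<alpha> \<le> 1" "cmod \<beta> \<le> 1"
    by (intro root; simp add: sum[symmetric] prod[symmetric] power2_eq_square algebra_simps)+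
  then show "cmod y1 \<le> 2" "cmod y2 \<le> 1"
    using norm_triangle_ineq[of \<alpha> \<beta>] mult_mono[of "cmod \<alpha>" 1 "cmod \<beta>" 1]
    by (auto simp: sum prod[symmetric] norm_mult)
qed

lemma K1_bounds:
  assumes "z \<in> K1"
  shows "z $ 1 = cnj (z $ 5) * z $ 3" "z $ 2 = cnj (z $ 4) * z $ 3" "cmod (z $ 3) = 1"
    "cmod (z $ 4) \<le> 2" "cmod (z $ 5) \<le> 1"
  using assms Gamma_E_bounds unfolding K1_def by auto


section \<open>Spectrum and structure of a \<open>\<Gamma>\<close>-unitary\<close>

lemma taylor_spectrum_bounded_below:
  fixes N :: "'i::{finite,linorder} \<Rightarrow> 'a::complex_hilbert \<Rightarrow> 'a"
  assumes N: "\<And>i. normal_op (N i)" and comm: "\<And>i j x. N i (N j x) = N j (N i x)"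
  shows "z \<in> taylor_spectrum N \<longleftrightarrow> \<not> jointly_bounded_below UNIV (\<lambda>i x. N i x - z $ i *\<^sub>C x)"
proof -
  let ?A = "\<lambda>i x. N i x - z $ i *\<^sub>C x"
  have nA: "normal_op (?A i)" for i by (rule normal_op_shift[OF N])
  have cA: "?A i (?A j x) = ?A j (?A i x)" for i j x
    by (simp add: bounded_clinear_diff[OF normal_op_bounded[OF N]]
        bounded_clinear_scaleC[OF normal_op_bounded[OF N]] comm[of i j] scaleC_diff_right scaleC_scaleC
        mult.commute)
  have "koszul_exact UNIV ?A \<longleftrightarrow> jointly_bounded_below UNIV ?A"
  proof
    assume "koszul_exact UNIV ?A"
    then show "jointly_bounded_below UNIV ?A"
      by (rule koszul_exact_imp_bounded_below) (simp_all only: finite normal_op_bounded[OF nA] cA)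
  next
    assume "jointly_bounded_below UNIV ?A"
    then show "koszul_exact UNIV ?A"
      by (rule bounded_below_imp_koszul_exact) (simp_all only: finite nA cA)
  qed
  then show ?thesis by (simp add: taylor_spectrum_def taylor_singular_def)
qed

text \<open>An operator that behaves like a scalar of modulus at most \<open>b\<close> near each joint approximate
  eigenvector is bounded by \<open>b\<close>: apply the existence of joint approximate eigenvectors with the
  extra operator \<open>B\<^sup>* B\<close>, whose approximate eigenvalue can be taken at least \<open>\<parallel>B y\<parallel>\<^sup>2\<close> for a given unit
  vector \<open>y\<close>. With \<open>b = 0\<close> this transfers equations from the spectrum to the operators.\<close>

theorem norm_le_by_taylor_spectrum:
  fixes N :: "'i::{finite,linorder} \<Rightarrow> 'a::complex_hilbert \<Rightarrow> 'a"
  assumes N: "\<And>i. normal_op (N i)" and comm: "\<And>i j x. N i (N j x) = N j (N i x)"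
    and B: "bounded_clinear B"
    and BN: "\<And>i x. B (N i x) = N i (B x)" and BN': "\<And>i x. B (adj (N i) x) = adj (N i) (B x)"
    and b: "0 \<le> b"
    and bound: "\<And>z. z \<in> taylor_spectrum N \<Longrightarrow>
      \<exists>C. \<forall>x. norm (B x) \<le> b * norm x + C * (\<Sum>i\<in>UNIV. norm (N i x - z $ i *\<^sub>C x))"
  shows "norm (B x) \<le> b * norm x"
proof (cases "x = 0")
  case False
  note NB = normal_op_bounded[OF N]
  have B'N: "adj B (N i x) = N i (adj B x)" for i x
    using fun_cong[OF arg_cong[of "\<lambda>x. B (adj (N i) x)" "\<lambda>x. adj (N i) (B x)" adj, OF ext[OF BN']], of x]
    by (simp add: adj_compose B bounded_clinear_adj[OF NB] adj_adj[OF NB])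
  define y where "y = (1 / norm x) *\<^sub>R x"
  have y: "norm y = 1" using False by (simp add: y_def)
  have "self_adjoint (\<lambda>x. adj B (B x))"
    by (rule positive_op_self_adjoint[OF positive_op_adj_compose[OF B]])
  from normal_family_approximate_eigenvector[of N, OF N comm this _ y]
  obtain m z where m: "inner (adj B (B y)) y \<le> m"
    and z: "\<And>\<epsilon>. 0 < \<epsilon> \<Longrightarrow> \<exists>x. norm x = 1 \<and> norm (adj B (B x) - m *\<^sub>R x) < \<epsilon> \<and>
      (\<forall>i. norm (N i x - z i *\<^sub>C x) < \<epsilon>)"
    by (auto simp: BN B'N)
  define k where "k = real (card (UNIV :: 'i set))"
  have k: "0 < k" by (simp add: k_def card_gt_0_iff)
  have sum_le: "(\<Sum>i\<in>UNIV. norm (N i x - z i *\<^sub>C x)) \<le> k * \<epsilon>"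
    if "\<forall>i. norm (N i x - z i *\<^sub>C x) < \<epsilon>" for x \<epsilon>
    unfolding k_def using that by (intro sum_bounded_above) (auto intro: less_imp_le)
  have "vec_lambda z \<in> taylor_spectrum N"
    unfolding taylor_spectrum_bounded_below[of N, OF N comm]
  proof
    assume "jointly_bounded_below UNIV (\<lambda>i x. N i x - vec_lambda z $ i *\<^sub>C x)"
    then obtain C where C: "\<And>x. norm x \<le> C * (\<Sum>i\<in>UNIV. norm (N i x - z i *\<^sub>C x))"
      by (auto simp: jointly_bounded_below_def)
    define \<epsilon> where "\<epsilon> = 1 / (2 * k * (\<bar>C\<bar> + 1))"
    have "0 < \<epsilon>" using k by (simp add: \<epsilon>_def add_nonneg_pos)
    then obtain x where x: "norm x = 1" "\<forall>i. norm (N i x - z i *\<^sub>C x) < \<epsilon>" using z by blast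
    have "1 \<le> C * (\<Sum>i\<in>UNIV. norm (N i x - z i *\<^sub>C x))" using C[of x] x(1) by simp
    also have "\<dots> \<le> (\<bar>C\<bar> + 1) * (k * \<epsilon>)"
      using sum_le[OF x(2)] by (intro mult_mono) (auto intro: sum_nonneg)
    also have "\<dots> = 1 / 2"
    proof -
      have "D * (k * (1 / (2 * k * D))) = 1 / 2" if "0 < D" for D :: real
        using k that by simp
      then show ?thesis unfolding \<epsilon>_def by (simp add: add_nonneg_pos)
    qed
    finally show False by simp
  qed
  from bound[OF this] obtain C where
    C: "\<And>x. norm (B x) \<le> b * norm x + C * (\<Sum>i\<in>UNIV. norm (N i x - z i *\<^sub>C x))" by auto
  have le: "m \<le> (b + \<bar>C\<bar> * (k * \<epsilon>))\<^sup>2 + \<epsilon>" if \<epsilon>: "0 < \<epsilon>" for \<epsilon>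
  proof -
    obtain x where x: "norm x = 1" "norm (adj B (B x) - m *\<^sub>R x) < \<epsilon>"
      "\<forall>i. norm (N i x - z i *\<^sub>C x) < \<epsilon>" using z[OF \<epsilon>] by blast
    have "m = inner (adj B (B x)) x - inner (adj B (B x) - m *\<^sub>R x) x"
      using x(1) by (simp add: inner_diff_left power2_norm_eq_inner[symmetric])
    also have "\<dots> \<le> (norm (B x))\<^sup>2 + \<epsilon>"
      using Cauchy_Schwarz_ineq2[of "adj B (B x) - m *\<^sub>R x" x] x(1,2)
      by (simp add: norm_adj_compose[OF B] abs_le_iff)
    finally have "m \<le> (norm (B x))\<^sup>2 + \<epsilon>" .
    moreover have "norm (B x) \<le> b + \<bar>C\<bar> * (k * \<epsilon>)"
    proof -
      have "C * (\<Sum>i\<in>UNIV. norm (N i x - z i *\<^sub>C x)) \<le> \<bar>C\<bar> * (k * \<epsilon>)"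
        using sum_le[OF x(3)] by (intro mult_mono) (auto intro: sum_nonneg)
      then show ?thesis using C[of x] x(1) by simp
    qed
    ultimately show ?thesis using power_mono[of "norm (B x)" _ 2] by fastforce
  qed
  have "(\<lambda>n. (b + \<bar>C\<bar> * (k * inverse (real (Suc n))))\<^sup>2 + inverse (real (Suc n)))
      \<longlonglongrightarrow> (b + \<bar>C\<bar> * (k * 0))\<^sup>2 + 0"
    by (intro tendsto_intros LIMSEQ_inverse_real_of_nat)
  then have "m \<le> (b + \<bar>C\<bar> * (k * 0))\<^sup>2 + 0"
    by (rule LIMSEQ_le_const) (use le in auto)
  then have "(norm (B y))\<^sup>2 \<le> b\<^sup>2" using m by (simp add: norm_adj_compose[OF B])
  then have "norm (B y) \<le> b" using b by (rule power2_le_imp_le)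
  then show ?thesis
    using False by (simp add: y_def bounded_clinear_scaleR[OF B] field_simps)
qed (simp add: bounded_clinear_zero[OF B])

text \<open>The equations and bounds valid on \<open>K\<^sub>1\<close>, transferred to the operators. The commutation
  hypotheses of the transfer hold because all \<open>N\<^sub>i\<close> and \<open>N\<^sub>j\<^sup>*\<close> commute.\<close>

lemma Gamma_unitary_structure:
  fixes N :: "5 \<Rightarrow> 'a::complex_hilbert \<Rightarrow> 'a"
  assumes "Gamma_unitary N"
  shows "\<And>i. normal_op (N i)" and "\<And>i j x. N i (N j x) = N j (N i x)"
    and "\<And>i j x. adj (N i) (N j x) = N j (adj (N i) x)"
    and "\<And>x. N 1 x = adj (N 5) (N 3 x)" and "\<And>x. N 2 x = adj (N 4) (N 3 x)"
    and "\<And>x. adj (N 3) (N 3 x) = x"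
    and "\<And>x. norm (N 4 x) \<le> 2 * norm x" and "\<And>x. norm (N 5 x) \<le> norm x"
proof -
  show N: "normal_op (N i)" and comm: "N i (N j x) = N j (N i x)" for i j x
    using assms by (auto simp: Gamma_unitary_def commuting_on_def)
  have spec: "taylor_spectrum N \<subseteq> K1" using assms by (simp add: Gamma_unitary_def)
  note NB = normal_op_bounded[OF N]
  note NB' = bounded_clinear_adj[OF NB]
  show dc: "adj (N i) (N j x) = N j (adj (N i) x)" for i j x
    by (rule normal_ops_doubly_commute) (rule N comm)+
  have comm': "adj (N i) (adj (N j) x) = adj (N j) (adj (N i) x)" for i j x
    using fun_cong[OF arg_cong[of "\<lambda>x. N j (N i x)" "\<lambda>x. N i (N j x)" adj, OF ext[OF comm]], of x]
    by (simp add: adj_compose[OF NB NB])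
  define e where "e z x = (\<Sum>i\<in>UNIV. norm (N i x - z $ i *\<^sub>C x))" for z and x
  have e_ge: "norm (N i x - z $ i *\<^sub>C x) \<le> e z x" for i x z
    unfolding e_def by (rule member_le_sum) auto
  have e0: "0 \<le> e z x" for z x unfolding e_def by (intro sum_nonneg) auto
  \<comment> \<open>near an approximate eigenvector \<open>N\<^sub>j\<^sup>* N\<^sub>k\<close> acts as the scalar \<open>cnj z\<^sub>j z\<^sub>k\<close>\<close>
  have prod: "\<exists>C. \<forall>x. norm (adj (N j) (N k x) - (cnj (z $ j) * z $ k) *\<^sub>C x) \<le> C * e z x" for j k z
  proof -
    obtain b where b: "0 < b" "\<And>x. norm (adj (N j) x) \<le> b * norm x"
      using bounded_clinear_on_bound[OF NB'[of j]] by auto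
    have "norm (adj (N j) (N k x) - (cnj (z $ j) * z $ k) *\<^sub>C x) \<le> (b + cmod (z $ k)) * e z x" for x
    proof -
      have "adj (N j) (N k x) - (cnj (z $ j) * z $ k) *\<^sub>C x =
          adj (N j) (N k x - z $ k *\<^sub>C x) + z $ k *\<^sub>C (adj (N j) x - cnj (z $ j) *\<^sub>C x)"
        by (simp add: bounded_clinear_diff[OF NB'] bounded_clinear_scaleC[OF NB'] scaleC_diff_right
            scaleC_scaleC mult.commute)
      also have "norm \<dots> \<le> b * norm (N k x - z $ k *\<^sub>C x) + cmod (z $ k) * norm (N j x - z $ j *\<^sub>C x)"
        using b(2) by (intro norm_triangle_mono) (simp_all add: norm_scaleC normal_op_norm_shift[OF N])
      also have "\<dots> \<le> b * e z x + cmod (z $ k) * e z x"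
        using b(1) by (intro add_mono mult_left_mono e_ge) auto
      finally show ?thesis by (simp add: distrib_right)
    qed
    then show ?thesis by blast
  qed
  have relation: "N i x = adj (N j) (N k x)"
    if rel: "\<And>z. z \<in> K1 \<Longrightarrow> z $ i = cnj (z $ j) * z $ k" for i j k x
  proof -
    define B where "B x = N i x - adj (N j) (N k x)" for x
    have "norm (B x) \<le> 0 * norm x"
    proof (rule norm_le_by_taylor_spectrum[of N, OF N comm])
      show "bounded_clinear B"
        unfolding B_def[abs_def]
        by (rule bounded_clinear_minus_op[OF NB bounded_clinear_compose[OF NB' NB]])
      show "B (N l x) = N l (B x)" "B (adj (N l) x) = adj (N l) (B x)" for l x
        by (simp_all only: B_def bounded_clinear_diff[OF NB] bounded_clinear_diff[OF NB'] comm dc comm')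
      fix z assume "z \<in> taylor_spectrum N"
      then have z: "z $ i = cnj (z $ j) * z $ k" using spec rel by blast
      obtain C where C: "\<And>x. norm (adj (N j) (N k x) - z $ i *\<^sub>C x) \<le> C * e z x"
        using prod[of j k z] unfolding z by blast
      have "norm (B x) \<le> 0 * norm x + (1 + C) * (\<Sum>i\<in>UNIV. norm (N i x - z $ i *\<^sub>C x))" for x
        using norm_triangle_ineq4[of "N i x - z $ i *\<^sub>C x" "adj (N j) (N k x) - z $ i *\<^sub>C x"]
          C[of x] e_ge[of i x z]
        by (simp add: B_def e_def[symmetric] algebra_simps)
      then show "\<exists>C. \<forall>x. norm (B x) \<le> 0 * norm x + C * (\<Sum>i\<in>UNIV. norm (N i x - z $ i *\<^sub>C x))"
        by blast
    qed simp
    then show ?thesis by (simp add: B_def)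
  qed
  show "N 1 x = adj (N 5) (N 3 x)" "N 2 x = adj (N 4) (N 3 x)" for x
    by (rule relation, rule K1_bounds, assumption)+
  show "adj (N 3) (N 3 x) = x" for x
  proof -
    define B where "B x = adj (N 3) (N 3 x) - x" for x
    have "norm (B x) \<le> 0 * norm x"
    proof (rule norm_le_by_taylor_spectrum[of N, OF N comm])
      show "bounded_clinear B"
        unfolding B_def[abs_def]
        by (rule bounded_clinear_minus_op[OF bounded_clinear_compose[OF NB' NB] bounded_clinear_ident])
      show "B (N l x) = N l (B x)" "B (adj (N l) x) = adj (N l) (B x)" for l x
        by (simp_all only: B_def bounded_clinear_diff[OF NB] bounded_clinear_diff[OF NB'] comm dc comm')
      fix z assume "z \<in> taylor_spectrum N"
      then have "cmod (z $ 3) = 1" using spec K1_bounds(3) by blast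
      then have "cnj (z $ 3) * z $ 3 = 1"
        using complex_norm_square[of "z $ 3"] by (simp add: mult.commute)
      then show "\<exists>C. \<forall>x. norm (B x) \<le> 0 * norm x + C * (\<Sum>i\<in>UNIV. norm (N i x - z $ i *\<^sub>C x))"
        using prod[of 3 3 z] by (simp add: B_def e_def)
    qed simp
    then show ?thesis by (simp add: B_def)
  qed
  have "norm (N i x) \<le> b * norm x" if "\<And>z. z \<in> K1 \<Longrightarrow> cmod (z $ i) \<le> b" "0 \<le> b" for i b x
  proof (rule norm_le_by_taylor_spectrum[of N, OF N comm NB])
    fix z assume "z \<in> taylor_spectrum N"
    then have z: "cmod (z $ i) \<le> b" using spec that by blast
    have "norm (N i x) \<le> b * norm x + 1 * (\<Sum>i\<in>UNIV. norm (N i x - z $ i *\<^sub>C x))" for x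
      using norm_triangle_ineq2[of "N i x" "z $ i *\<^sub>C x"] e_ge[of i x z]
        mult_right_mono[OF z, of "norm x"]
      by (simp add: norm_scaleC e_def)
    then show "\<exists>C. \<forall>x. norm (N i x) \<le> b * norm x + C * (\<Sum>i\<in>UNIV. norm (N i x - z $ i *\<^sub>C x))"
      by blast
  qed (use that in \<open>simp_all only: comm[of i] dc\<close>)
  from this[of 4 2] this[of 5 1] show "norm (N 4 x) \<le> 2 * norm x" "norm (N 5 x) \<le> norm x" for x
    using K1_bounds(4,5) by auto
qed

lemma Gamma_unitary_norms:
  fixes N :: "5 \<Rightarrow> 'a::complex_hilbert \<Rightarrow> 'a"
  assumes N: "Gamma_unitary N"
  shows "norm (N 3 x) = norm x" "norm (N 1 x) = norm (N 5 x)" "norm (N 2 x) = norm (N 4 x)"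
proof -
  note S = Gamma_unitary_structure[OF N]
  show iso: "norm (N 3 x) = norm x" for x
    using norm_adj_compose[OF normal_op_bounded[OF S(1)], of 3 x]
    by (simp add: S(6) power2_norm_eq_inner[symmetric] power2_eq_iff_nonneg)
  show "norm (N 1 x) = norm (N 5 x)" "norm (N 2 x) = norm (N 4 x)"
    by (simp_all add: S(4,5) normal_op_norm_adj[OF S(1)] S(2)[of _ 3] iso)
qed

text \<open>If \<open>\<parallel>A x\<parallel> = \<parallel>B x\<parallel>\<close> for all \<open>x\<close>, then \<open>\<bar>\<bar>a\<bar> - \<bar>b\<bar>\<bar> \<parallel>x\<parallel> \<le> \<parallel>A x - a x\<parallel> + \<parallel>B x - b x\<parallel>\<close> by the triangle
  inequality, so \<open>\<bar>a\<bar> = \<bar>b\<bar>\<close> at each point of the joint spectrum. The bounds on single coordinates follow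
  in the same way.\<close>

lemma Gamma_unitary_reduced_spectrum:
  fixes N :: "5 \<Rightarrow> 'a::complex_hilbert \<Rightarrow> 'a"
  assumes N: "Gamma_unitary N"
  shows "taylor_spectrum (tuple4 (N 1) (N 2) (N 4) (N 5)) \<subseteq>
    {vec_lambda (tuple4 z1 (2 * z2) (2 * zt1) zt2) | z1 z2 zt1 zt2.
      cmod z1 = cmod zt2 \<and> cmod zt2 \<le> 1 \<and> cmod z2 = cmod zt1 \<and> cmod zt1 \<le> 1}"
proof
  note S = Gamma_unitary_structure[OF N] and norms = Gamma_unitary_norms[OF N]
  let ?M = "tuple4 (N 1) (N 2) (N 4) (N 5)"
  have M: "\<And>i. normal_op (?M i)" "\<And>i j x. ?M i (?M j x) = ?M j (?M i x)"
    unfolding all_4[symmetric] using S(1,2) by (simp_all add: tuple4_def)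
  fix z assume "z \<in> taylor_spectrum ?M"
  then have nb: "\<not> jointly_bounded_below UNIV (\<lambda>i x. ?M i x - z $ i *\<^sub>C x)"
    using taylor_spectrum_bounded_below[of ?M, OF M] by blast
  define e where "e x = (\<Sum>i\<in>UNIV. norm (?M i x - z $ i *\<^sub>C x))" for x
  have e_ge: "norm (?M i x - z $ i *\<^sub>C x) \<le> e x" for i x
    unfolding e_def by (rule member_le_sum) auto
  have no_bound: False if c: "0 < c" and le: "\<And>x. c * norm x \<le> 2 * e x" for c
  proof -
    have "norm x \<le> (2 / c) * e x" for x using le[of x] c by (simp add: field_simps)
    then show False using nb unfolding jointly_bounded_below_def e_def by blast
  qed
  have near: "\<bar>norm (?M i x) - cmod (z $ i) * norm x\<bar> \<le> e x" for i x
    using norm_triangle_ineq3[of "?M i x" "z $ i *\<^sub>C x"] e_ge[of i x] by (simp add: norm_scaleC)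
  have equal: "cmod (z $ i) = cmod (z $ j)" if "\<And>x. norm (?M i x) = norm (?M j x)" for i j
  proof (rule ccontr)
    assume "cmod (z $ i) \<noteq> cmod (z $ j)"
    then have "0 < \<bar>cmod (z $ i) - cmod (z $ j)\<bar>" by simp
    moreover have "\<bar>cmod (z $ i) - cmod (z $ j)\<bar> * norm x \<le> 2 * e x" for x
    proof -
      have "\<bar>cmod (z $ i) - cmod (z $ j)\<bar> * norm x = \<bar>cmod (z $ i) * norm x - cmod (z $ j) * norm x\<bar>"
        by (simp add: left_diff_distrib[symmetric] abs_mult)
      then show ?thesis using near[where i = i] near[where i = j] that by (smt (verit))
    qed
    ultimately show False by (rule no_bound)
  qed
  have le: "cmod (z $ i) \<le> b" if "\<And>x. norm (?M i x) \<le> b * norm x" for i b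
  proof (rule ccontr)
    assume "\<not> cmod (z $ i) \<le> b"
    then have "0 < cmod (z $ i) - b" by simp
    moreover have "(cmod (z $ i) - b) * norm x \<le> 2 * e x" for x
      using near[of i x] that[of x] by (simp add: left_diff_distrib abs_le_iff)
    ultimately show False by (rule no_bound)
  qed
  have "cmod (z $ 1) = cmod (z $ 4)" "cmod (z $ 2) = cmod (z $ 3)"
    by (rule equal, simp add: norms)+
  moreover have "cmod (z $ 4) \<le> 1" "cmod (z $ 3) \<le> 2"
    by (rule le, simp add: S(7,8))+
  moreover have "z = vec_lambda (tuple4 (z $ 1) (2 * (z $ 2 / 2)) (2 * (z $ 3 / 2)) (z $ 4))"
    by (simp add: vec_eq_iff all_4)
  ultimately show "z \<in> {vec_lambda (tuple4 z1 (2 * z2) (2 * zt1) zt2) | z1 z2 zt1 zt2.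
      cmod z1 = cmod zt2 \<and> cmod zt2 \<le> 1 \<and> cmod z2 = cmod zt1 \<and> cmod zt1 \<le> 1}"
    by (intro CollectI exI[of _ "z $ 1"] exI[of _ "z $ 2 / 2"] exI[of _ "z $ 3 / 2"] exI[of _ "z $ 4"])
      (auto simp: norm_divide)
qed


section \<open>Isometric dilations and the defect space\<close>

lemma bounded_clinear_on_weaken: "bounded_clinear_on X Y T \<Longrightarrow> bounded_clinear_on X UNIV T"
  unfolding bounded_clinear_on_def by blast

lemma isometric_on_cinner:
  fixes V :: "'a::complex_hilbert \<Rightarrow> 'b::complex_hilbert"
  assumes X: "closed_csubspace X" and V: "isometric_on X Y V" and x: "x \<in> X" "y \<in> X"
  shows "cinner (V x) (V y) = cinner x y"
proof -
  have add: "V (u + v) = V u + V v" and scale: "V (c *\<^sub>C u) = c *\<^sub>C V u" and norm: "norm (V u) = norm u"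
    if "u \<in> X" "v \<in> X" for u v c
    using V that by (auto simp: isometric_on_def bounded_clinear_on_def)
  have re: "Re (cinner (V u) (V v)) = Re (cinner u v)" if uv: "u \<in> X" "v \<in> X" for u v
  proof -
    have "inner p q = ((norm (p + q))\<^sup>2 - (norm p)\<^sup>2 - (norm q)\<^sup>2) / 2" for p q :: "'c::real_inner"
      by (simp add: power2_norm_eq_inner inner_add inner_commute)
    from this[of u v] this[of "V u" "V v"] show ?thesis
      using norm[OF csubspace_add[OF X uv] uv(1)] norm[OF uv] norm[OF uv(2,1)] add[OF uv]
      by (simp add: Re_cinner)
  qed
  show ?thesis
  proof (rule complex_eqI)
    have "Re (\<i> * cinner (V x) (V y)) = Re (\<i> * cinner x y)"
      using re[OF csubspace_scaleC[OF X x(1)] x(2), of \<i>] scale[OF x] by (simp add: cinner_scaleC_left)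
    then show "Im (cinner (V x) (V y)) = Im (cinner x y)" by simp
  qed (rule re[OF x])
qed

lemma closed_csubspace_closure_range:
  assumes D: "bounded_clinear D"
  shows "closed_csubspace (closure (range D))"
  unfolding closed_csubspace_def
proof (intro conjI ballI allI)
  show "0 \<in> closure (range D)"
    using closure_subset[of "range D"] range_eqI[of 0 D 0] by (auto simp: bounded_clinear_zero[OF D])
  fix x assume "x \<in> closure (range D)"
  then obtain s where s: "\<And>n. s n \<in> range D" "s \<longlonglongrightarrow> x"
    unfolding closure_sequential by blast
  show "c *\<^sub>C x \<in> closure (range D)" for c
    unfolding closure_sequential
  proof (intro exI conjI allI)
    show "c *\<^sub>C s n \<in> range D" for n
      using s(1)[of n] by (auto simp flip: bounded_clinear_scaleC[OF D])
  qed (rule tendsto_scaleC[OF s(2)])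
  fix y assume "y \<in> closure (range D)"
  then obtain t where t: "\<And>n. t n \<in> range D" "t \<longlonglongrightarrow> y"
    unfolding closure_sequential by blast
  show "x + y \<in> closure (range D)"
    unfolding closure_sequential
  proof (intro exI conjI allI)
    show "s n + t n \<in> range D" for n
      using s(1)[of n] t(1)[of n] by (auto simp flip: bounded_clinear_add[OF D])
  qed (rule tendsto_add[OF s(2) t(2)])
qed simp

lemma closure_range_sequence:
  fixes D :: "'a \<Rightarrow> 'b::first_countable_topology"
  assumes "x \<in> closure (range D)"
  shows "\<exists>h. (\<lambda>n. D (h n)) \<longlonglongrightarrow> x"
proof -
  from assms[unfolded closure_sequential]
  obtain s where s: "(\<forall>n. s n \<in> range D) \<and> s \<longlonglongrightarrow> x" ..
  have "\<forall>n. \<exists>h. D h = s n"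
  proof
    show "\<exists>h. D h = s n" for n using s[THEN conjunct1, rule_format, of n] by (auto simp: image_iff)
  qed
  from choice[OF this] obtain h where "\<forall>n. D (h n) = s n" ..
  then show ?thesis using s by (intro exI[of _ h]) simp
qed

lemma bounded_clinear_on_tendsto:
  assumes X: "closed_csubspace X" and F: "bounded_clinear_on X Y F"
    and s: "\<And>n. s n \<in> X" "s \<longlonglongrightarrow> x" and x: "x \<in> X"
  shows "(\<lambda>n. F (s n)) \<longlonglongrightarrow> F x"
proof -
  obtain B where B: "\<And>u. u \<in> X \<Longrightarrow> norm (F u) \<le> B * norm u"
    using bounded_clinear_on_bound[OF F] by auto
  have add: "F (u + v) = F u + F v" if "u \<in> X" "v \<in> X" for u v
    using F that by (simp add: bounded_clinear_on_def)
  have d: "F (s n) - F x = F (s n - x)" for n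
    using add[OF csubspace_diff[OF X s(1) x] x, of n] by simp
  show ?thesis
  proof (rule LIM_zero_cancel, rule Lim_null_comparison)
    show "\<forall>\<^sub>F n in sequentially. norm (F (s n) - F x) \<le> B * norm (s n - x)"
      unfolding d using B[OF csubspace_diff[OF X s(1) x]] by simp
    show "(\<lambda>n. B * norm (s n - x)) \<longlonglongrightarrow> 0"
      using tendsto_mult[OF tendsto_const tendsto_norm[OF LIM_zero[OF s(2)]], of B] by simp
  qed
qed

lemma bounded_clinear_on_eq_on_closure:
  assumes D: "bounded_clinear D" and F: "bounded_clinear_on (closure (range D)) Y F"
    and G: "bounded_clinear_on (closure (range D)) Z G" and eq: "\<And>h. F (D h) = G (D h)"
    and x: "x \<in> closure (range D)"
  shows "F x = G x"
proof -
  note X = closed_csubspace_closure_range[OF D]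
  obtain h where h: "(\<lambda>n. D (h n)) \<longlonglongrightarrow> x" using closure_range_sequence[OF x] by blast
  have "D (h n) \<in> closure (range D)" for n
    by (rule subsetD[OF closure_subset]) simp
  from bounded_clinear_on_tendsto[OF X F this h x] bounded_clinear_on_tendsto[OF X G this h x]
  show ?thesis unfolding eq by (rule LIMSEQ_unique)
qed

text \<open>The partial isometry of a polar decomposition: \<open>D h \<mapsto> E h\<close> is well defined and isometric, hence
  extends to the closure.\<close>

lemma isometry_extension:
  fixes D :: "'a::complex_hilbert \<Rightarrow> 'b::complex_hilbert" and E :: "'a \<Rightarrow> 'c::complex_hilbert"
  assumes D: "bounded_clinear D" and E: "bounded_clinear E" and norm: "\<And>h. norm (E h) = norm (D h)"
    and K: "closed_csubspace K" and EK: "\<And>h. E h \<in> K"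
  shows "\<exists>U. isometric_on (closure (range D)) K U \<and> (\<forall>h. U (D h) = E h)"
proof -
  note X = closed_csubspace_closure_range[OF D]
  define f where "f y = E (SOME h. D h = y)" for y
  have f: "f (D h) = E h" for h
  proof -
    have "D (SOME h'. D h' = D h) = D h" by (rule someI) simp
    then have "norm (D ((SOME h'. D h' = D h) - h)) = 0" by (simp add: bounded_clinear_diff[OF D])
    then have "E ((SOME h'. D h' = D h) - h) = 0" by (simp add: norm[symmetric])
    then show ?thesis by (simp add: f_def bounded_clinear_diff[OF E])
  qed
  have "dist (f (D g)) (f (D h)) = dist (D g) (D h)" for g h
    using norm[of "g - h"] by (simp add: f dist_norm bounded_clinear_diff[OF D] bounded_clinear_diff[OF E])
  then have "uniformly_continuous_on (range D) f"
    unfolding uniformly_continuous_on_def by auto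
  from uniformly_continuous_on_extension_on_closure[OF this]
  obtain U where U: "uniformly_continuous_on (closure (range D)) U" "\<And>y. y \<in> range D \<Longrightarrow> f y = U y"
    by metis
  have UD: "U (D h) = E h" for h using U(2)[of "D h"] f by simp
  have lim: "(\<lambda>n. E (h n)) \<longlonglongrightarrow> U x" if "(\<lambda>n. D (h n)) \<longlonglongrightarrow> x" "x \<in> closure (range D)" for h x
  proof -
    have "(\<lambda>n. U (D (h n))) \<longlonglongrightarrow> U x"
      by (rule continuous_on_tendsto_compose[OF uniformly_continuous_imp_continuous[OF U(1)] that])
        (simp add: subsetD[OF closure_subset])
    then show ?thesis by (simp add: UD)
  qed
  have "isometric_on (closure (range D)) K U"
    unfolding isometric_on_def
  proof (intro conjI ballI)
    fix x assume x: "x \<in> closure (range D)"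
    then obtain h where h: "(\<lambda>n. D (h n)) \<longlonglongrightarrow> x" using closure_range_sequence by blast
    show nx: "norm (U x) = norm x"
      using tendsto_norm[OF lim[OF h x]] tendsto_norm[OF h] unfolding norm by (rule LIMSEQ_unique)
  next
    show "bounded_clinear_on (closure (range D)) K U"
    proof (rule bounded_clinear_onI[where B = 1])
      fix x assume x: "x \<in> closure (range D)"
      then obtain h where h: "(\<lambda>n. D (h n)) \<longlonglongrightarrow> x" using closure_range_sequence by blast
      show "U x \<in> K"
        using closed_sequentially[OF csubspace_closed[OF K] _ lim[OF h x]] EK by blast
      show "U (c *\<^sub>C x) = c *\<^sub>C U x" for c
      proof (rule LIMSEQ_unique)
        have "(\<lambda>n. D (c *\<^sub>C h n)) \<longlonglongrightarrow> c *\<^sub>C x"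
          unfolding bounded_clinear_scaleC[OF D] by (rule tendsto_scaleC[OF h])
        then show "(\<lambda>n. E (c *\<^sub>C h n)) \<longlonglongrightarrow> U (c *\<^sub>C x)"
          by (rule lim) (rule csubspace_scaleC[OF X x])
        show "(\<lambda>n. E (c *\<^sub>C h n)) \<longlonglongrightarrow> c *\<^sub>C U x"
          unfolding bounded_clinear_scaleC[OF E] by (rule tendsto_scaleC[OF lim[OF h x]])
      qed
      show "norm (U x) \<le> 1 * norm x"
        using LIMSEQ_unique[OF tendsto_norm[OF lim[OF h x], unfolded norm] tendsto_norm[OF h]] by simp
      fix y assume y: "y \<in> closure (range D)"
      then obtain g where g: "(\<lambda>n. D (g n)) \<longlonglongrightarrow> y" using closure_range_sequence by blast
      show "U (x + y) = U x + U y"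
      proof (rule LIMSEQ_unique)
        have "(\<lambda>n. D (h n + g n)) \<longlonglongrightarrow> x + y"
          unfolding bounded_clinear_add[OF D] by (rule tendsto_add[OF h g])
        then show "(\<lambda>n. E (h n + g n)) \<longlonglongrightarrow> U (x + y)"
          by (rule lim) (rule csubspace_add[OF X x y])
        show "(\<lambda>n. E (h n + g n)) \<longlonglongrightarrow> U x + U y"
          unfolding bounded_clinear_add[OF E] by (rule tendsto_add[OF lim[OF h x] lim[OF g y]])
      qed
    qed
  qed
  then show ?thesis using UD by blast
qed

text \<open>An operator on the defect space is determined by \<open>D G D\<close>, because \<open>D\<close> is injective on the
  closure of its range.\<close>

lemma defect_compression_unique:
  assumes D: "self_adjoint D"
    and F: "bounded_clinear_on (closure (range D)) (closure (range D)) F"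
    and G: "bounded_clinear_on (closure (range D)) (closure (range D)) G"
    and eq: "\<And>h. D (F (D h)) = D (G (D h))" and x: "x \<in> closure (range D)"
  shows "F x = G x"
proof (rule bounded_clinear_on_eq_on_closure[OF self_adjoint_bounded[OF D] F G _ x])
  fix h
  note DB = self_adjoint_bounded[OF D]
  note X = closed_csubspace_closure_range[OF DB]
  define y where "y = F (D h) - G (D h)"
  have "D h \<in> closure (range D)" by (rule subsetD[OF closure_subset]) simp
  then have y: "y \<in> closure (range D)"
    using F G unfolding y_def bounded_clinear_on_def by (intro csubspace_diff[OF X]) blast+
  have "D y = 0" using eq[of h] by (simp add: y_def bounded_clinear_diff[OF DB])
  then have orth: "cinner y (D u) = 0" for u
    using self_adjoint_cinner[OF D, of y u] by simp
  obtain u where u: "(\<lambda>n. D (u n)) \<longlonglongrightarrow> y" using closure_range_sequence[OF y] by blast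
  have "(\<lambda>n. cinner y (D (u n))) \<longlonglongrightarrow> cinner y y"
    by (rule bounded_linear.tendsto[OF bounded_linear_cinner_right u])
  then have "cinner y y = 0" unfolding orth by (metis LIMSEQ_const_iff)
  then show "F (D h) = G (D h)" by (simp add: cinner_self y_def)
qed

lemma adj_on_cong: "(\<And>x. x \<in> X \<Longrightarrow> S x = T x) \<Longrightarrow> adj_on X S y = adj_on X T y"
  unfolding adj_on_def by (rule arg_cong[where f = The]) (auto simp: fun_eq_iff)

text \<open>\<open>N\<close> is the \<open>\<Gamma>\<close>-unitary itself rather than its restriction to \<open>K\<close>, because its adjoints are those of
  operators on the whole space. The last assumption is the dilation property
  \<open>(N\<^sub>i restricted to K)\<^sup>* J = J S\<^sub>i\<^sup>*\<close>, written without the adjoint on \<open>K\<close>.\<close>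

locale Gamma_dilation =
  fixes K :: "'k::complex_hilbert set" and N :: "5 \<Rightarrow> 'k \<Rightarrow> 'k"
    and J :: "'h::complex_hilbert \<Rightarrow> 'k" and S :: "5 \<Rightarrow> 'h \<Rightarrow> 'h"
  assumes K: "closed_csubspace K" and N: "Gamma_unitary N"
    and NK: "x \<in> K \<Longrightarrow> N i x \<in> K"
    and J: "isometric_on UNIV K J" and S: "bounded_clinear (S i)"
    and dilation: "x \<in> K \<Longrightarrow> cinner (N i x) (J h) = cinner x (J (adj (S i) h))"
begin

lemma N_bounded: "bounded_clinear (N i)"
  by (rule normal_op_bounded[OF Gamma_unitary_structure(1)[OF N]])

lemmas N_commute = Gamma_unitary_structure(2)[OF N]

lemma J_bounded: "bounded_clinear J" and J_in: "J h \<in> K"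
  using J unfolding isometric_on_def bounded_clinear_on_def by blast+

lemma J_cinner: "cinner (J g) (J h) = cinner g h"
  by (rule isometric_on_cinner[OF _ J]) auto

lemma adj_J_J: "adj J (J h) = h"
  by (rule cinner_ext) (simp add: cinner_adj[OF J_bounded, symmetric] J_cinner)

lemma adj_J_N: "x \<in> K \<Longrightarrow> adj J (N i x) = S i (adj J x)"
  by (rule cinner_ext_left)
    (metis S J_bounded cinner_adj cinner_adj' dilation)

lemma norm_adj_J: "norm (adj J y) \<le> norm y"
proof (cases "adj J y = 0")
  case False
  have "(norm (adj J y))\<^sup>2 = cmod (cinner (J (adj J y)) y)"
    by (simp add: cinner_adj[OF J_bounded] cinner_self norm_power)
  also have "\<dots> \<le> norm (adj J y) * norm y"
    using norm_cinner_le[of "J (adj J y)" y] J by (simp add: isometric_on_def)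
  finally show ?thesis using False by (simp add: power2_eq_square)
qed simp

lemma S3_contraction: "norm (S 3 h) \<le> norm h"
proof -
  have "norm (S 3 h) = norm (adj J (N 3 (J h)))"
    by (simp add: adj_J_N J_in adj_J_J)
  also have "\<dots> \<le> norm (J h)"
    using norm_adj_J[of "N 3 (J h)"] by (simp add: Gamma_unitary_norms[OF N])
  finally show ?thesis using J by (simp add: isometric_on_def)
qed

lemma N3_cinner: "cinner (N 3 x) (N 3 y) = cinner x y"
  by (simp add: cinner_adj[OF N_bounded] Gamma_unitary_structure(6)[OF N])

abbreviation D where "D \<equiv> defect_op (S 3)"
abbreviation X where "X \<equiv> defect_space (S 3)"

lemma D: "self_adjoint D" and D_square: "D (D h) = h - adj (S 3) (S 3 h)"
  using defect_op_properties[OF S S3_contraction] by auto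

lemma X: "closed_csubspace X" and D_in: "D h \<in> X"
  unfolding defect_space_def
  by (rule closed_csubspace_closure_range[OF self_adjoint_bounded[OF D]],
      rule subsetD[OF closure_subset]) simp

text \<open>The defect of the dilation: the part of \<open>N\<^sub>3 J\<close> that leaves the range of \<open>J\<close>.\<close>

definition E where "E h = N 3 (J h) - J (S 3 h)"

lemma E_bounded: "bounded_clinear E"
  unfolding E_def[abs_def] by (rule bounded_clinear_minus_op[OF bounded_clinear_compose[OF N_bounded
        J_bounded] bounded_clinear_compose[OF J_bounded S]])

lemma E_in: "E h \<in> K"
  unfolding E_def by (intro csubspace_diff[OF K] NK J_in)

lemma adj_J_E: "adj J (E h) = 0"
  by (simp add: E_def bounded_clinear_diff[OF bounded_clinear_adj[OF J_bounded]] adj_J_N J_in adj_J_J)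

lemma E_cinner: "cinner (E g) (E h) = cinner (D g) (D h)"
proof -
  have "cinner (E g) (E h) = cinner (E g) (N 3 (J h)) - cinner (adj J (E g)) (S 3 h)"
    by (simp add: E_def[of h] cinner_diff_right cinner_adj'[OF J_bounded])
  also have "\<dots> = cinner (N 3 (J g)) (N 3 (J h)) - cinner (S 3 g) (adj J (N 3 (J h)))"
    by (simp add: adj_J_E) (simp add: E_def cinner_diff_left cinner_adj[OF J_bounded])
  also have "\<dots> = cinner g h - cinner g (adj (S 3) (S 3 h))"
    by (simp add: N3_cinner J_cinner adj_J_N J_in adj_J_J cinner_adj[OF S])
  also have "\<dots> = cinner (D g) (D h)"
    by (simp add: self_adjoint_cinner[OF D] D_square cinner_diff_right)
  finally show ?thesis .
qed

lemma E_norm: "norm (E h) = norm (D h)"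
proof -
  have "complex_of_real ((norm (E h))\<^sup>2) = of_real ((norm (D h))\<^sup>2)"
    unfolding cinner_self[symmetric] by (rule E_cinner)
  then show ?thesis by (simp only: of_real_eq_iff) (simp add: power2_eq_iff_nonneg)
qed

lemma defect_isometry_ex: "\<exists>U. isometric_on X K U \<and> (\<forall>h. U (D h) = E h)"
  unfolding defect_space_def
  by (rule isometry_extension[OF self_adjoint_bounded[OF D] E_bounded E_norm K E_in])

text \<open>The operator form of the relations that define \<open>K\<^sub>1\<close>; it is symmetric because \<open>N\<^sub>3\<close> is unitary
  and commutes with all adjoints.\<close>

definition partner :: "5 \<Rightarrow> 5 \<Rightarrow> bool" where
  "partner i j \<longleftrightarrow> (\<forall>x. N i x = adj (N j) (N 3 x))"

lemma partner_sym:
  assumes "partner i j"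
  shows "partner j i"
  unfolding partner_def
proof
  fix x
  note ST = Gamma_unitary_structure[OF N]
  have "N i = (\<lambda>x. adj (N j) (N 3 x))"
    using assms by (simp add: partner_def fun_eq_iff)
  then have "adj (N i) y = adj (N 3) (N j y)" for y
    using adj_compose[OF bounded_clinear_adj[OF N_bounded] N_bounded, of j 3]
    by (simp only: adj_adj[OF N_bounded])
  then show "N j x = adj (N i) (N 3 x)"
    by (simp add: ST(2)[of j 3] ST(6))
qed

lemma partners: "partner 1 5" "partner 5 1" "partner 2 4" "partner 4 2"
proof -
  show "partner 1 5" "partner 2 4"
    by (auto simp: partner_def Gamma_unitary_structure(4,5)[OF N])
  then show "partner 5 1" "partner 4 2" by (auto intro: partner_sym)
qed

lemma partner_cinner:
  assumes "partner i j"
  shows "cinner (N i x) (N 3 y) = cinner x (N j y)"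
proof -
  have "N i x = N 3 (adj (N j) x)"
    using assms Gamma_unitary_structure(3)[OF N, of j 3] by (simp add: partner_def)
  then have "cinner (N i x) (N 3 y) = cinner (adj (N j) x) y"
    by (simp only: N3_cinner)
  then show ?thesis by (simp only: cinner_adj'[OF N_bounded])
qed

text \<open>On the kernel of \<open>D\<close> the dilation does not leave the range of \<open>J\<close>: there \<open>E h = 0\<close>, and compressing
  \<open>N\<^sub>i J h = N\<^sub>j\<^sup>* N\<^sub>3 J h = N\<^sub>j\<^sup>* J S\<^sub>3 h\<close> to \<open>K\<close> gives \<open>J S\<^sub>j\<^sup>* S\<^sub>3 h\<close>.\<close>

lemma kernel_dilation:
  assumes h: "D h = 0" and p: "partner i j"
  shows "N 3 (J h) = J (S 3 h)" "N i (J h) = J (S i h)"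
proof -
  have "E h = 0" using E_norm[of h] h by simp
  then show N3: "N 3 (J h) = J (S 3 h)" by (simp add: E_def)
  let ?v = "J (adj (S j) (S 3 h))"
  have "N i (J h) - ?v \<in> K" by (intro csubspace_diff[OF K] NK J_in)
  then have "cinner (N i (J h) - ?v) (N i (J h)) = cinner (N i (J h) - ?v) ?v"
    using p by (simp add: partner_def N3 cinner_adj[OF N_bounded, symmetric] dilation)
  then have "cinner (N i (J h) - ?v) (N i (J h) - ?v) = 0" by (simp add: cinner_diff_right)
  then have eq: "N i (J h) = ?v" by (simp add: cinner_self)
  have "S i h = adj J (N i (J h))"
    by (simp add: adj_J_N J_in adj_J_J)
  also have "\<dots> = adj (S j) (S 3 h)"
    unfolding eq by (rule adj_J_J)
  finally show "N i (J h) = J (S i h)"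
    using eq by simp
qed

end

locale Gamma_dilation_defect = Gamma_dilation K N J S
  for K :: "'k::complex_hilbert set" and N and J :: "'h::complex_hilbert \<Rightarrow> 'k" and S +
  fixes U :: "'h \<Rightarrow> 'k"
  assumes U: "isometric_on X K U" and U_D: "U (D h) = E h"
begin

lemma U_bounded: "bounded_clinear_on X K U"
  using U by (simp add: isometric_on_def)

lemma U_in: "x \<in> X \<Longrightarrow> U x \<in> K"
  using U_bounded by (simp add: bounded_clinear_on_def)

lemma U_cinner: "x \<in> X \<Longrightarrow> y \<in> X \<Longrightarrow> cinner (U x) (U y) = cinner x y"
  by (rule isometric_on_cinner[OF X U])

lemma adj_J_U:
  assumes x: "x \<in> X"
  shows "adj J (U x) = 0"
proof (rule bounded_clinear_on_eq_on_closure[OF self_adjoint_bounded[OF D],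
      of UNIV "\<lambda>x. adj J (U x)" UNIV "\<lambda>x. 0" x, folded defect_space_def])
  show "bounded_clinear_on X UNIV (\<lambda>x. adj J (U x))"
    using U_bounded bounded_clinear_adj[OF J_bounded] norm_adj_J
    by (auto simp: bounded_clinear_on_def) (meson order_trans)
  show "bounded_clinear_on X UNIV (\<lambda>x. 0 :: 'h)"
    by (rule bounded_clinear_onI[where B = 1]) auto
qed (auto simp: U_D adj_J_E x)

abbreviation U' where "U' \<equiv> adj_on X U"

lemma U'_bounded: "bounded_clinear_on UNIV X U'"
  by (rule bounded_clinear_adj_on[OF X U_bounded])

lemma U'_in: "U' y \<in> X" and U'_cinner: "x \<in> X \<Longrightarrow> cinner (U x) y = cinner x (U' y)"
  and U'_cinner': "x \<in> X \<Longrightarrow> cinner y (U x) = cinner (U' y) x"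
  by (auto intro: adj_on_in[OF X U_bounded] cinner_adj_on[OF X U_bounded] cinner_adj_on'[OF X U_bounded])

lemma U'_add: "U' (x + y) = U' x + U' y"
  using U'_bounded by (simp add: bounded_clinear_on_def)

lemma U'_J: "U' (J h) = 0"
proof (rule adj_on_eqI[OF X csubspace_zero[OF X]])
  show "cinner (U u) (J h) = cinner u 0" if "u \<in> X" for u
    using adj_J_U[OF that] by (simp add: cinner_adj'[OF J_bounded])
qed

lemma U'_N3_J: "U' (N 3 (J h)) = D h"
proof -
  have "U' (U (D h)) = D h"
    by (rule adj_on_eqI[OF X D_in]) (simp add: U_cinner D_in)
  moreover have "N 3 (J h) = U (D h) + J (S 3 h)" by (simp add: U_D E_def)
  ultimately show ?thesis by (simp add: U'_add U'_J)
qed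

definition compression where "compression i x = U' (N i (U x))"

lemma compression_bounded: "bounded_clinear_on X X (compression i)"
proof -
  obtain b where b: "0 < b" "\<And>x. norm (N i x) \<le> b * norm x"
    using bounded_clinear_on_bound[OF N_bounded] by auto
  obtain c where c: "0 < c" "\<And>x. norm (U' x) \<le> c * norm x"
    using bounded_clinear_on_bound[OF U'_bounded] by auto
  show ?thesis
  proof (rule bounded_clinear_onI[where B = "c * b"])
    fix x assume x: "x \<in> X"
    show "norm (compression i x) \<le> c * b * norm x"
    proof -
      have "norm (compression i x) \<le> c * norm (N i (U x))" unfolding compression_def by (rule c(2))
      also have "\<dots> \<le> c * (b * norm (U x))" using c(1) by (intro mult_left_mono b(2)) auto
      finally show ?thesis using U x by (simp add: isometric_on_def mult.assoc)
    qed
  qed (use U_bounded U'_bounded in \<open>auto simp: compression_def bounded_clinear_on_def U'_in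
      bounded_clinear_add[OF N_bounded] bounded_clinear_scaleC[OF N_bounded]\<close>)
qed

lemma orthogonal_to_J: "x \<in> X \<Longrightarrow> cinner (N i (U x)) (J h) = 0"
  by (simp only: dilation[OF U_in]) (simp add: cinner_adj'[OF J_bounded] adj_J_U)

text \<open>The compressions of the dilation to the defect space solve the equations of the fundamental
  operators: \<open>D (U\<^sup>* N\<^sub>i U) D = E\<^sup>* N\<^sub>i E\<close>, and only \<open>N\<^sub>3 J\<close> survives of the second \<open>E\<close>.\<close>

lemma compression_equation:
  assumes p: "partner i j"
  shows "D (compression i (D h)) = S i h - adj (S j) (S 3 h)"
proof (rule cinner_ext_left)
  fix u
  have "cinner (D (compression i (D h))) u = cinner (N i (U (D h))) (U (D u))"
    by (simp add: self_adjoint_cinner[OF D] compression_def U'_cinner'[OF D_in])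
  also have "\<dots> = cinner (N i (U (D h))) (N 3 (J u))"
    by (simp add: U_D[of u] E_def cinner_diff_right orthogonal_to_J[OF D_in])
  also have "\<dots> = cinner (E h) (N j (J u))"
    by (simp add: partner_cinner[OF p] U_D)
  also have "\<dots> = cinner (N 3 (J h)) (N j (J u)) - cinner (S 3 h) (adj J (N j (J u)))"
    by (simp add: E_def cinner_diff_left cinner_adj[OF J_bounded])
  also have "cinner (N 3 (J h)) (N j (J u)) = cinner (adj J (N i (J h))) u"
    using p by (simp add: partner_def cinner_adj'[OF N_bounded] cinner_adj'[OF J_bounded, symmetric])
  finally show "cinner (D (compression i (D h))) u = cinner (S i h - adj (S j) (S 3 h)) u"
    by (simp add: adj_J_N J_in adj_J_J cinner_diff_left cinner_adj'[OF S])
qed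

text \<open>Again the \<open>J S\<^sub>3\<close> part of \<open>U D = E\<close> is invisible, and \<open>N\<^sub>i\<^sup>* N\<^sub>3 = N\<^sub>j\<close>.\<close>

lemma compression_adj:
  assumes p: "partner i j"
  shows "adj_on X (compression i) (D h) = U' (N j (J h))"
proof (rule adj_on_eqI[OF X U'_in])
  fix u assume u: "u \<in> X"
  have "cinner (compression i u) (D h) = cinner (N i (U u)) (U (D h))"
    by (simp add: compression_def U'_cinner'[OF D_in])
  also have "\<dots> = cinner (N i (U u)) (N 3 (J h))"
    by (simp add: U_D E_def cinner_diff_right orthogonal_to_J[OF u])
  also have "\<dots> = cinner (U u) (N j (J h))" by (rule partner_cinner[OF p])
  also have "\<dots> = cinner u (U' (N j (J h)))" by (rule U'_cinner[OF u])
  finally show "cinner (compression i u) (D h) = cinner u (U' (N j (J h)))" .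
qed

text \<open>On the kernel of \<open>D\<close>, \<open>J\<close> moves past the \<open>S\<^sub>k\<close> and turns them into \<open>N\<^sub>k\<close>. For \<open>k = 3\<close>, \<open>N\<^sub>3\<close> is then
  moved to the left and absorbed by \<open>U\<^sup>* N\<^sub>3 J = D\<close>.\<close>

lemma compression_adj_kernel:
  assumes h: "D h = 0" and p: "partner i j" "partner k l"
  shows "adj_on X (compression i) (D (S k h)) = U' (N j (N k (J h)))"
    and "adj_on X (compression i) (D (S 3 h)) = D (S j h)"
proof -
  show "adj_on X (compression i) (D (S k h)) = U' (N j (N k (J h)))"
    by (simp add: compression_adj[OF p(1)] kernel_dilation(2)[OF h p(2)])
  have "adj_on X (compression i) (D (S 3 h)) = U' (N j (N 3 (J h)))"
    by (simp add: compression_adj[OF p(1)] kernel_dilation(1)[OF h p(1)])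
  also have "\<dots> = D (S j h)"
    by (simp add: N_commute[of j 3] kernel_dilation(2)[OF h partner_sym[OF p(1)]] U'_N3_J)
  finally show "adj_on X (compression i) (D (S 3 h)) = D (S j h)" .
qed

lemma fundamental_op_eq_compression:
  assumes p: "partner i j" and G: "bounded_clinear_on X X G"
    and eq: "\<And>h. r *\<^sub>R (S i h - adj (S j) (S 3 h)) = D (G (D h))" and x: "x \<in> X"
  shows "G x = r *\<^sub>R compression i x"
proof (rule defect_compression_unique[OF D, of G "\<lambda>x. r *\<^sub>R compression i x" x,
      folded defect_space_def, OF G _ _ x])
  show "bounded_clinear_on X X (\<lambda>x. r *\<^sub>R compression i x)"
  proof -
    obtain c where "\<And>x. x \<in> X \<Longrightarrow> norm (compression i x) \<le> c * norm x"
      using bounded_clinear_on_bound[OF compression_bounded] by blast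
    then show ?thesis
      using compression_bounded[of i]
      by (intro bounded_clinear_onI[where B = "\<bar>r\<bar> * c"])
        (auto simp: bounded_clinear_on_def csubspace_scaleR[OF X] scaleR_add_right scaleC_scaleR
          mult.assoc intro: mult_left_mono)
  qed
  show "D (G (D h)) = D (r *\<^sub>R compression i (D h))" for h
    by (simp add: eq[symmetric] compression_equation[OF p]
        bounded_clinear_scaleR[OF self_adjoint_bounded[OF D]])
qed

lemma fundamental_op_adj:
  assumes "\<And>x. x \<in> X \<Longrightarrow> G x = r *\<^sub>R compression i x"
  shows "adj_on X G y = r *\<^sub>R adj_on X (compression i) y"
  by (rule adj_on_eqI[OF X])
    (simp_all add: assms csubspace_scaleR[OF X] adj_on_in[OF X compression_bounded] cinner_simps
      cinner_adj_on[OF X compression_bounded])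

lemma adj_compression_scaleR:
  "adj_on X (compression i) (r *\<^sub>R y) = r *\<^sub>R adj_on X (compression i) y"
  by (rule bounded_clinear_scaleR, rule bounded_clinear_on_weaken)
    (rule bounded_clinear_adj_on[OF X compression_bounded])

end

theorem theorem2p13:
  fixes S1 S2 S3 St1 St2 G1 G2 Gt1 Gt2 D :: "'h::complex_hilbert \<Rightarrow> 'h"
    and star :: "('h \<Rightarrow> 'h) \<Rightarrow> 'h \<Rightarrow> 'h"
  assumes "Gamma_contraction (tuple5 S1 S2 S3 St1 St2)"
    and "fundamental_ops S1 S2 S3 St1 St2 G1 G2 Gt1 Gt2"
    and "D = defect_op S3"
    and "star = adj_on (defect_space S3)"
    and "has_Gamma_isometric_dilation TYPE('k::complex_hilbert) (tuple5 S1 S2 S3 St1 St2)"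
  shows
    "has_subnormal_joint_dilation TYPE('k) (defect_space S3) G1 G2 Gt1 Gt2 \<and>
     (\<forall>h. D h = 0 \<longrightarrow>
       star Gt2 (D (St2 h)) - star G1 (D (S1 h)) = 0 \<and>
       star Gt2 (star G1 (D (S3 h))) - star G1 (star Gt2 (D (S3 h))) = 0 \<and>
       star G2 (D (S2 h)) - star Gt1 (D (St1 h)) = 0 \<and>
       star G2 (star Gt1 (D (S3 h))) - star Gt1 (star G2 (D (S3 h))) = 0 \<and>
       star Gt2 (D (S2 h)) - 2 *\<^sub>R star Gt1 (D (S1 h)) = 0 \<and>
       star Gt2 (star Gt1 (D (S3 h))) - star Gt1 (star Gt2 (D (S3 h))) = 0 \<and>
       2 *\<^sub>R star G2 (D (St2 h)) - star G1 (D (St1 h)) = 0 \<and>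
       star G2 (star G1 (D (S3 h))) - star G1 (star G2 (D (S3 h))) = 0 \<and>
       star Gt2 (D (St1 h)) - 2 *\<^sub>R star G2 (D (S1 h)) = 0 \<and>
       star Gt2 (star G2 (D (S3 h))) - star G2 (star Gt2 (D (S3 h))) = 0 \<and>
       2 *\<^sub>R star Gt1 (D (St2 h)) - star G1 (D (S2 h)) = 0 \<and>
       star Gt1 (star G1 (D (S3 h))) - star G1 (star Gt1 (D (S3 h))) = 0)"
proof -
  let ?S = "tuple5 S1 S2 S3 St1 St2"
  obtain K :: "'k set" and W J where W: "Gamma_isometry K W" and J: "isometric_on UNIV K J"
    and dil: "\<And>i h. adj_on K (W i) (J h) = J (adj (?S i) h)"
    using assms(5) unfolding has_Gamma_isometric_dilation_def by blast
  obtain N where K: "closed_csubspace K" and N: "Gamma_unitary N"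
    and NK: "\<And>i x. x \<in> K \<Longrightarrow> N i x \<in> K" and WN: "\<And>i x. x \<in> K \<Longrightarrow> W i x = N i x"
    using W unfolding Gamma_isometry_def by blast
  have NB: "bounded_clinear (N i)" for i
    by (rule normal_op_bounded[OF Gamma_unitary_structure(1)[OF N]])
  have NB_K: "bounded_clinear_on K K (N i)" for i
    by (rule bounded_clinear_on_restrict[OF NB NK])
  interpret Gamma_dilation K N J ?S
  proof
    show "bounded_clinear (?S i)" for i using assms(1) by (simp add: Gamma_contraction_def)
    show "cinner (N i x) (J h) = cinner x (J (adj (?S i) h))" if "x \<in> K" for i x h
    proof -
      have "adj_on K (W i) (J h) = adj_on K (N i) (J h)"
        by (rule adj_on_cong) (rule WN)
      then show ?thesis
        using cinner_adj_on[OF K NB_K that, of i "J h"] dil[of i h] by simp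
    qed
  qed (use K N NK J in auto)
  obtain U where "isometric_on X K U" "\<And>h. U (defect_op (?S 3) h) = E h"
    using defect_isometry_ex by blast
  then interpret Gamma_dilation_defect K N J ?S U
    by unfold_locales
  have fund: "bounded_clinear_on X X G1" "bounded_clinear_on X X G2"
      "bounded_clinear_on X X Gt1" "bounded_clinear_on X X Gt2"
    and eqs: "\<And>h. S1 h - adj St2 (S3 h) = defect_op S3 (G1 (defect_op S3 h))"
      "\<And>h. St2 h - adj S1 (S3 h) = defect_op S3 (Gt2 (defect_op S3 h))"
      "\<And>h. (1/2) *\<^sub>R S2 h - (1/2) *\<^sub>R adj St1 (S3 h) = defect_op S3 (G2 (defect_op S3 h))"
      "\<And>h. (1/2) *\<^sub>R St1 h - (1/2) *\<^sub>R adj S2 (S3 h) = defect_op S3 (Gt1 (defect_op S3 h))"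
    using assms(2) by (auto simp: fundamental_ops_def Let_def)
  have G1: "G1 x = 1 *\<^sub>R compression 1 x" if "x \<in> X" for x
    by (rule fundamental_op_eq_compression[OF partners(1) fund(1) _ that]) (simp add: eqs)
  have G2: "G2 x = (1/2) *\<^sub>R compression 2 x" if "x \<in> X" for x
    by (rule fundamental_op_eq_compression[OF partners(3) fund(2) _ that])
      (simp add: eqs[symmetric] scaleR_diff_right)
  have Gt1: "Gt1 x = (1/2) *\<^sub>R compression 4 x" if "x \<in> X" for x
    by (rule fundamental_op_eq_compression[OF partners(4) fund(3) _ that])
      (simp add: eqs[symmetric] scaleR_diff_right)
  have Gt2: "Gt2 x = 1 *\<^sub>R compression 5 x" if "x \<in> X" for x
    by (rule fundamental_op_eq_compression[OF partners(2) fund(4) _ that]) (simp add: eqs)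
  define A where "A i = adj_on X (compression i)" for i
  have star: "star G1 y = A 1 y" "star G2 y = (1/2) *\<^sub>R A 2 y" "star Gt1 y = (1/2) *\<^sub>R A 4 y"
    "star Gt2 y = A 5 y" for y
    using fundamental_op_adj[OF G1, of y] fundamental_op_adj[OF G2, of y]
      fundamental_op_adj[OF Gt1, of y] fundamental_op_adj[OF Gt2, of y]
    by (simp_all add: assms(4) A_def)
  have A_scale: "A i (r *\<^sub>R y) = r *\<^sub>R A i y" for i r y
    unfolding A_def by (rule adj_compression_scaleR)
  have dilated: "has_subnormal_joint_dilation TYPE('k) (defect_space S3) G1 G2 Gt1 Gt2"
  proof -
    let ?M = "tuple4 (N 1) (N 2) (N 4) (N 5)"
    have comm: "commuting_on Y ?M" for Y
      unfolding commuting_on_def all_4 by (simp add: N_commute)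
    have normal: "\<forall>i. normal_op (?M i)"
      using Gamma_unitary_structure(1)[OF N] by (simp add: tuple4_def)
    have half: "bounded_clinear_on K K (\<lambda>x. (1/2) *\<^sub>R N i x)" for i
      by (rule bounded_clinear_on_restrict[OF bounded_clinear_timesR[OF NB] csubspace_scaleR[OF K NK]])
    have U'_half: "U' ((1/2) *\<^sub>R y) = (1/2) *\<^sub>R U' y" for y
      by (rule bounded_clinear_scaleR, rule bounded_clinear_on_weaken, rule U'_bounded)
    have double: "(\<lambda>x. 2 *\<^sub>R ((1/2) *\<^sub>R N i x)) = N i" for i by simp
    have ops: "\<forall>x\<in>X. G1 x = U' (N 1 (U x)) \<and> G2 x = U' ((1/2) *\<^sub>R N 2 (U x)) \<and>
        Gt1 x = U' ((1/2) *\<^sub>R N 4 (U x)) \<and> Gt2 x = U' (N 5 (U x))"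
      unfolding U'_half by (simp add: G1 G2 Gt1 Gt2 compression_def)
    have "has_subnormal_joint_dilation TYPE('k) X G1 G2 Gt1 Gt2"
      unfolding has_subnormal_joint_dilation_def Let_def
      by (rule exI[of _ K], rule exI[of _ U], rule exI[of _ "N 1"], rule exI[of _ "\<lambda>x. (1/2) *\<^sub>R N 2 x"],
          rule exI[of _ "\<lambda>x. (1/2) *\<^sub>R N 4 x"], rule exI[of _ "N 5"], rule exI[of _ "N 1"],
          rule exI[of _ "\<lambda>x. (1/2) *\<^sub>R N 2 x"], rule exI[of _ "\<lambda>x. (1/2) *\<^sub>R N 4 x"],
          rule exI[of _ "N 5"], unfold double)
        (intro conjI K U NB_K half comm ops normal Gamma_unitary_reduced_spectrum[OF N] ballI refl)
    then show ?thesis by simp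
  qed
  have kernel: "defect_op (?S 3) h = 0" if "D h = 0" for h
    using that assms(3) by simp
  \<comment> \<open>on the kernel, \<open>A\<^sub>i D S\<^sub>k\<close> is \<open>U\<^sup>* N\<^sub>j N\<^sub>k J\<close> with \<open>j\<close> the partner of \<open>i\<close>\<close>
  have first:
    "A 1 (D (S1 h)) = U' (N 5 (N 1 (J h)))"
    "A 1 (D (S2 h)) = U' (N 5 (N 2 (J h)))"
    "A 1 (D (St1 h)) = U' (N 5 (N 4 (J h)))"
    "A 2 (D (S1 h)) = U' (N 4 (N 1 (J h)))"
    "A 2 (D (S2 h)) = U' (N 4 (N 2 (J h)))"
    "A 2 (D (St2 h)) = U' (N 4 (N 5 (J h)))"
    "A 4 (D (S1 h)) = U' (N 2 (N 1 (J h)))"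
    "A 4 (D (St1 h)) = U' (N 2 (N 4 (J h)))"
    "A 4 (D (St2 h)) = U' (N 2 (N 5 (J h)))"
    "A 5 (D (S2 h)) = U' (N 1 (N 2 (J h)))"
    "A 5 (D (St1 h)) = U' (N 1 (N 4 (J h)))"
    "A 5 (D (St2 h)) = U' (N 1 (N 5 (J h)))"
    if "D h = 0" for h
    using compression_adj_kernel(1)[OF kernel[OF that] partners(1) partners(1)]
      compression_adj_kernel(1)[OF kernel[OF that] partners(1) partners(3)]
      compression_adj_kernel(1)[OF kernel[OF that] partners(1) partners(4)]
      compression_adj_kernel(1)[OF kernel[OF that] partners(3) partners(1)]
      compression_adj_kernel(1)[OF kernel[OF that] partners(3) partners(3)]
      compression_adj_kernel(1)[OF kernel[OF that] partners(3) partners(2)]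
      compression_adj_kernel(1)[OF kernel[OF that] partners(4) partners(1)]
      compression_adj_kernel(1)[OF kernel[OF that] partners(4) partners(4)]
      compression_adj_kernel(1)[OF kernel[OF that] partners(4) partners(2)]
      compression_adj_kernel(1)[OF kernel[OF that] partners(2) partners(3)]
      compression_adj_kernel(1)[OF kernel[OF that] partners(2) partners(4)]
      compression_adj_kernel(1)[OF kernel[OF that] partners(2) partners(2)]
    by (simp_all add: assms(3) A_def)
  have third:
    "A 1 (D (S3 h)) = D (St2 h)"
    "A 2 (D (S3 h)) = D (St1 h)"
    "A 4 (D (S3 h)) = D (S2 h)"
    "A 5 (D (S3 h)) = D (S1 h)"
    if "D h = 0" for h
    using compression_adj_kernel(2)[OF kernel[OF that] partners(1) partners(1)]
      compression_adj_kernel(2)[OF kernel[OF that] partners(3) partners(1)]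
      compression_adj_kernel(2)[OF kernel[OF that] partners(4) partners(1)]
      compression_adj_kernel(2)[OF kernel[OF that] partners(2) partners(1)]
    by (simp_all add: assms(3) A_def)
  \<comment> \<open>each condition now says that two of the \<open>N\<^sub>i\<close> commute\<close>
  show ?thesis
    using dilated by (simp add: star A_scale first third N_commute)
qed

end
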